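(* Let $a,b,a',b'>0$ with $\frac{ab'}{a'b}>1$. Suppose that $f\in\mathcal F$ verifies $$M(f(\widetilde\Gamma_0))=\int_{C_{a,b}}K(\cdot,f)^2\,\widetilde\rho_0^{\,4}\,dL^3.$$ Then there is $\alpha\in\mathbb{R}$ such that $f=\widetilde f_\alpha$, where $$\widetilde f_\alpha(z,t)=\left(\frac{\sqrt{b'}\,e^{i\alpha}z\,e^{\frac{i}{2b}\left(1-\frac{a'b}{ab'}\right)t}}{\sqrt{\left(1-\frac{ab'}{a'b}\right)|z|^2+\frac{ab'}{a'}}},\ \frac{a'}{a}t\right).$$
   Context: The Heisenberg group $\mathbf{H}$ is $\mathbb{C}\times\mathbb{R}$ with law $(z,t)\ast(z',t')=(z+z',t+t'+2\Im(z\overline{z'}))$, norm $\|(z,t)\|=(|z|^4+t^2)^{1/4}$ and distance $d(p,q)=\|p^{-1}\ast q\|$. Set $Z=\partial_z+i\overline z\,\partial_t$, $\overline Z=\partial_{\overline z}-iz\,\partial_t$ and $\omega=dt-i\overline z\,dz+iz\,d\overline z$. A homeomorphism $f$ between domains of $\mathbf{H}$ is quasiconformal if $H(p,f)=\limsup_{r\to0}\frac{\max_{d(p,q)=r}d(f(p),f(q))}{\min_{d(p,q)=r}d(f(p),f(q))}$ is uniformly bounded. Standing assumption: all quasiconformal maps are $C^2$ and orientation preserving, and all curves are $C^1$. Such a map $f=(f_1,f_2)$ is contact ($f^\ast\omega=\lambda\omega$ with $\lambda$ a nowhere vanishing real function), and orientation preserving means that $\overline Zf_1=\mu Zf_1$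 and $\overline Z(f_2+i|f_1|^2)=\mu Z(f_2+i|f_1|^2)$ for some $\mu\in L^\infty$ with $\|\mu\|_{L^\infty}<1$. The distortion function is $K(p,f)=\frac{|Zf_1(p)|+|\overline Zf_1(p)|}{|Zf_1(p)|-|\overline Zf_1(p)|}$. A curve $\gamma=(\gamma_1,\gamma_2)$ in $\mathbf{H}$ is horizontal if $\dot\gamma_2=-2\Im(\overline{\gamma_1}\dot\gamma_1)$. For a family $\Gamma$ of horizontal curves in a domain $\Omega\subset\mathbf{H}$, $adm(\Gamma)$ is the set of measurable $\rho:\Omega\to[0,\infty]$ with $\int\rho(\gamma(s))|\dot\gamma_1(s)|ds\ge1$ for all $\gamma\in\Gamma$, and $M(\Gamma)=\inf_{\rho\in adm(\Gamma)}\int_\Omega\rho^4dL^3$ ($dL^3$ Lebesgue measure). For $r,R>0$: $C_{r,R}=\{(z,t)\in\mathbf{H}\mid0<t<r,\ |z|<\sqrt R\}$. $\mathcal F$ is the set of all orientation preserving quasiconformal maps from $C_{a,b}$ to $C_{a',b'}$ that map homeomorphically the boundary components of $C_{a,b}$ (bottom disc, top disc, lateral face) onto the corresponding boundary components of $C_{a',b'}$. $\widetilde\Gamma_0$ is the family of curves $\widetilde\gamma_z(s)=(ze^{-\frac{is}{2|z|^2}},s)$, $0<s<a$, for $0<|z|<\sqrt b$, and $\widetilde\rho_0(z,t)=\frac{2|z|}{a}$ is its extremal density in $C_{a,b}$. *)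

theory Defs
  imports "HOL-Analysis.Analysis" "HOL-Probability.Essential_Supremum"
begin

type_synonym heis = "complex \<times> real"

definition heis_mult :: "heis \<Rightarrow> heis \<Rightarrow> heis" where
  "heis_mult p q = (fst p + fst q, snd p + snd q + 2 * Im (fst p * cnj (fst q)))"

definition heis_inv :: "heis \<Rightarrow> heis" where
  "heis_inv p = (- fst p, - snd p)"

lemma heis_mult_inv: "heis_mult p (heis_inv p) = 0" "heis_mult (heis_inv p) p = 0"
  by (simp_all add: heis_mult_def heis_inv_def zero_prod_def)

text \<open>The Euclidean norm and distance of the product type are not the Heisenberg ones; the
  topologies coincide, so domains, homeomorphisms and smoothness are the library's.\<close>

definition heis_norm :: "heis \<Rightarrow> real" where
  "heis_norm p = root 4 (cmod (fst p) ^ 4 + snd p ^ 2)"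

definition heis_dist :: "heis \<Rightarrow> heis \<Rightarrow> real" where
  "heis_dist p q = heis_norm (heis_mult (heis_inv p) q)"

definition d_z :: "(heis \<Rightarrow> complex) \<Rightarrow> heis \<Rightarrow> complex" where
  "d_z g p = (frechet_derivative g (at p) (1, 0) - \<i> * frechet_derivative g (at p) (\<i>, 0)) / 2"

definition d_zbar :: "(heis \<Rightarrow> complex) \<Rightarrow> heis \<Rightarrow> complex" where
  "d_zbar g p = (frechet_derivative g (at p) (1, 0) + \<i> * frechet_derivative g (at p) (\<i>, 0)) / 2"

definition d_t :: "(heis \<Rightarrow> complex) \<Rightarrow> heis \<Rightarrow> complex" where
  "d_t g p = frechet_derivative g (at p) (0, 1)"

definition Z_op :: "(heis \<Rightarrow> complex) \<Rightarrow> heis \<Rightarrow> complex" where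
  "Z_op g p = d_z g p + \<i> * cnj (fst p) * d_t g p"

definition Zbar_op :: "(heis \<Rightarrow> complex) \<Rightarrow> heis \<Rightarrow> complex" where
  "Zbar_op g p = d_zbar g p - \<i> * fst p * d_t g p"

text \<open>The one-form \<open>dt - i conj(z) dz + i z d(conj z)\<close> at \<open>p\<close>, applied to a tangent vector \<open>v\<close>.\<close>

definition contact_form :: "heis \<Rightarrow> heis \<Rightarrow> complex" where
  "contact_form p v = of_real (snd v) - \<i> * cnj (fst p) * fst v + \<i> * fst p * cnj (fst v)"

definition contact_on :: "heis set \<Rightarrow> (heis \<Rightarrow> heis) \<Rightarrow> bool" where
  "contact_on \<Omega> f \<longleftrightarrow> (\<exists>l :: heis \<Rightarrow> real. \<forall>p\<in>\<Omega>. l p \<noteq> 0 \<and>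
     (\<forall>v. contact_form (f p) (frechet_derivative f (at p) v) = of_real (l p) * contact_form p v))"

text \<open>Twice continuously differentiable on an open set.\<close>

definition C2_on :: "'a::real_normed_vector set \<Rightarrow> ('a \<Rightarrow> 'b::real_normed_vector) \<Rightarrow> bool" where
  "C2_on \<Omega> f \<longleftrightarrow> (\<exists>(f' :: 'a \<Rightarrow> 'a \<Rightarrow>\<^sub>L 'b) (f'' :: 'a \<Rightarrow> 'a \<Rightarrow>\<^sub>L 'a \<Rightarrow>\<^sub>L 'b).
     (\<forall>p\<in>\<Omega>. (f has_derivative blinfun_apply (f' p)) (at p) \<and>
             (f' has_derivative blinfun_apply (f'' p)) (at p)) \<and>
     continuous_on \<Omega> f'')"

text \<open>On an open \<open>\<Omega>\<close> the sphere of radius \<open>r\<close> about \<open>p \<in> \<Omega>\<close> is a compact subset of \<open>\<Omega>\<close> for all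
  small \<open>r > 0\<close>, so that for continuous \<open>f\<close> supremum and infimum below are a maximum and a
  minimum, and the values of \<open>f\<close> off \<open>\<Omega>\<close> do not matter.\<close>

definition linear_dilatation :: "(heis \<Rightarrow> heis) \<Rightarrow> heis \<Rightarrow> ereal" where
  "linear_dilatation f p = Limsup (at_right 0) (\<lambda>r. ereal
     ((SUP q\<in>{q. heis_dist p q = r}. heis_dist (f p) (f q)) /
      (INF q\<in>{q. heis_dist p q = r}. heis_dist (f p) (f q))))"

definition quasiconformal :: "heis set \<Rightarrow> heis set \<Rightarrow> (heis \<Rightarrow> heis) \<Rightarrow> bool" where
  "quasiconformal \<Omega> \<Omega>' f \<longleftrightarrow> (\<exists>g. homeomorphism \<Omega> \<Omega>' f g) \<and>
     (\<exists>H::real. \<forall>p\<in>\<Omega>. linear_dilatation f p \<le> ereal H)"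

definition orientation_preserving :: "heis set \<Rightarrow> (heis \<Rightarrow> heis) \<Rightarrow> bool" where
  "orientation_preserving \<Omega> f \<longleftrightarrow> (\<exists>\<mu> \<in> borel_measurable (lebesgue_on \<Omega>).
     esssup (lebesgue_on \<Omega>) (\<lambda>p. ereal (cmod (\<mu> p))) < 1 \<and>
     (AE p in lebesgue_on \<Omega>.
        Zbar_op (\<lambda>q. fst (f q)) p = \<mu> p * Z_op (\<lambda>q. fst (f q)) p \<and>
        Zbar_op (\<lambda>q. of_real (snd (f q)) + \<i> * of_real (cmod (fst (f q)) ^ 2)) p =
          \<mu> p * Z_op (\<lambda>q. of_real (snd (f q)) + \<i> * of_real (cmod (fst (f q)) ^ 2)) p))"

definition distortion :: "(heis \<Rightarrow> heis) \<Rightarrow> heis \<Rightarrow> real" where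
  "distortion f p =
     (cmod (Z_op (\<lambda>q. fst (f q)) p) + cmod (Zbar_op (\<lambda>q. fst (f q)) p)) /
     (cmod (Z_op (\<lambda>q. fst (f q)) p) - cmod (Zbar_op (\<lambda>q. fst (f q)) p))"

text \<open>A curve is a parameter interval together with a map that is relevant on it only.\<close>

type_synonym curve = "real set \<times> (real \<Rightarrow> heis)"

definition horizontal_curve :: "curve \<Rightarrow> bool" where
  "horizontal_curve c \<longleftrightarrow> (case c of (I, \<gamma>) \<Rightarrow>
     \<gamma> C1_differentiable_on I \<and>
     (\<forall>s\<in>I. snd (vector_derivative \<gamma> (at s)) =
        - 2 * Im (cnj (fst (\<gamma> s)) * fst (vector_derivative \<gamma> (at s)))))"

definition admissible :: "heis set \<Rightarrow> curve set \<Rightarrow> (heis \<Rightarrow> ennreal) set" where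
  "admissible \<Omega> \<Gamma> = {\<rho> \<in> borel_measurable (restrict_space borel \<Omega>).
     \<forall>(I, \<gamma>)\<in>\<Gamma>. (\<integral>\<^sup>+s\<in>I. \<rho> (\<gamma> s) * ennreal (cmod (fst (vector_derivative \<gamma> (at s)))) \<partial>lborel) \<ge> 1}"

definition modulus :: "heis set \<Rightarrow> curve set \<Rightarrow> ennreal" where
  "modulus \<Omega> \<Gamma> = (INF \<rho>\<in>admissible \<Omega> \<Gamma>. \<integral>\<^sup>+p\<in>\<Omega>. \<rho> p ^ 4 \<partial>lborel)"

definition image_curves :: "(heis \<Rightarrow> heis) \<Rightarrow> curve set \<Rightarrow> curve set" where
  "image_curves f \<Gamma> = (\<lambda>(I, \<gamma>). (I, f \<circ> \<gamma>)) ` \<Gamma>"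

definition cylinder :: "real \<Rightarrow> real \<Rightarrow> heis set" where
  "cylinder r R = {(z, t). 0 < t \<and> t < r \<and> cmod z < sqrt R}"

definition bottom_disc :: "real \<Rightarrow> real \<Rightarrow> heis set" where
  "bottom_disc r R = {(z, t). t = 0 \<and> cmod z \<le> sqrt R}"

definition top_disc :: "real \<Rightarrow> real \<Rightarrow> heis set" where
  "top_disc r R = {(z, t). t = r \<and> cmod z \<le> sqrt R}"

definition lateral_face :: "real \<Rightarrow> real \<Rightarrow> heis set" where
  "lateral_face r R = {(z, t). 0 \<le> t \<and> t \<le> r \<and> cmod z = sqrt R}"

text \<open>Members are functions on the whole type of which only the restriction to the open cylinder
  is meaningful; the boundary condition is on a continuous extension \<open>F\<close> to the closed cylinder.
  Contactness with nowhere vanishing factor is part of what a smooth quasiconformal map is here;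
  it makes the distortion function well defined everywhere.\<close>

definition qc_class :: "real \<Rightarrow> real \<Rightarrow> real \<Rightarrow> real \<Rightarrow> (heis \<Rightarrow> heis) set" where
  "qc_class a b a' b' = {f.
     quasiconformal (cylinder a b) (cylinder a' b') f \<and>
     C2_on (cylinder a b) f \<and>
     contact_on (cylinder a b) f \<and>
     orientation_preserving (cylinder a b) f \<and>
     (\<exists>F. continuous_on (closure (cylinder a b)) F \<and> (\<forall>p\<in>cylinder a b. F p = f p) \<and>
        (\<exists>G. homeomorphism (bottom_disc a b) (bottom_disc a' b') F G) \<and>
        (\<exists>G. homeomorphism (top_disc a b) (top_disc a' b') F G) \<and>
        (\<exists>G. homeomorphism (lateral_face a b) (lateral_face a' b') F G))}"

definition Gamma0_curve :: "complex \<Rightarrow> real \<Rightarrow> heis" where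
  "Gamma0_curve z s = (z * exp (- (\<i> * of_real s / (2 * of_real (cmod z ^ 2)))), s)"

definition Gamma0 :: "real \<Rightarrow> real \<Rightarrow> curve set" where
  "Gamma0 a b = {({0<..<a}, Gamma0_curve z) | z. 0 < cmod z \<and> cmod z < sqrt b}"

lemma Gamma0_curve_has_vector_derivative:
  "(Gamma0_curve z has_vector_derivative
     (- (\<i> * fst (Gamma0_curve z s) / (2 * of_real (cmod z ^ 2))), 1)) (at s)"
proof -
  define c where "c = - \<i> / (2 * complex_of_real (cmod z ^ 2))"
  have "((\<lambda>w. z * exp (c * w)) has_field_derivative c * (z * exp (c * of_real s))) (at (of_real s))"
    by (auto intro!: derivative_eq_intros)
  then have "((\<lambda>s. z * exp (c * of_real s)) has_vector_derivative c * (z * exp (c * of_real s))) (at s)"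
    by (rule has_vector_derivative_real_field)
  then have "((\<lambda>s. z * exp (- (\<i> * of_real s / (2 * of_real (cmod z ^ 2))))) has_vector_derivative
     (- (\<i> * fst (Gamma0_curve z s) / (2 * of_real (cmod z ^ 2))))) (at s)"
    by (simp add: c_def Gamma0_curve_def)
  then have "((\<lambda>s. (z * exp (- (\<i> * of_real s / (2 * of_real (cmod z ^ 2)))), s))
      has_vector_derivative (- (\<i> * fst (Gamma0_curve z s) / (2 * of_real (cmod z ^ 2))), 1)) (at s)"
    by (intro has_vector_derivative_Pair) auto
  then show ?thesis
    by (simp add: Gamma0_curve_def[abs_def])
qed

lemma Gamma0_horizontal:
  assumes "c \<in> Gamma0 a b"
  shows "horizontal_curve c"
proof -
  from assms obtain z where c: "c = ({0<..<a}, Gamma0_curve z)" and z: "cmod z > 0"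
    by (auto simp: Gamma0_def)
  let ?D = "\<lambda>s. (- (\<i> * fst (Gamma0_curve z s) / (2 * of_real (cmod z ^ 2))), 1 :: real)"
  have D: "vector_derivative (Gamma0_curve z) (at s) = ?D s" for s
    by (rule vector_derivative_at[OF Gamma0_curve_has_vector_derivative])
  have "Gamma0_curve z C1_differentiable_on {0<..<a}"
    unfolding C1_differentiable_on_def
  proof (intro exI conjI ballI)
    show "(Gamma0_curve z has_vector_derivative ?D s) (at s)" for s
      by (rule Gamma0_curve_has_vector_derivative)
    show "continuous_on {0<..<a} ?D"
      unfolding Gamma0_curve_def using z by (auto intro!: continuous_intros)
  qed
  moreover have "1 = - 2 * Im (cnj (fst (Gamma0_curve z s)) * fst (?D s))" for s
  proof -
    have n: "cmod (fst (Gamma0_curve z s)) = cmod z"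
      by (simp add: Gamma0_curve_def norm_mult)
    have "cnj (fst (Gamma0_curve z s)) * fst (?D s) =
        - \<i> * (fst (Gamma0_curve z s) * cnj (fst (Gamma0_curve z s))) / (2 * of_real (cmod z ^ 2))"
      by simp
    also have "\<dots> = - \<i> / 2"
      unfolding complex_norm_square[symmetric] n using z by simp
    finally show ?thesis
      by (simp only:) simp
  qed
  ultimately show ?thesis
    unfolding horizontal_curve_def c by (simp only: prod.case D snd_conv) blast
qed

definition rho0 :: "real \<Rightarrow> heis \<Rightarrow> real" where
  "rho0 a p = 2 * cmod (fst p) / a"

definition f_alpha :: "real \<Rightarrow> real \<Rightarrow> real \<Rightarrow> real \<Rightarrow> real \<Rightarrow> heis \<Rightarrow> heis" where
  "f_alpha a b a' b' \<alpha> = (\<lambda>(z, t).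
     (of_real (sqrt b') * exp (\<i> * of_real \<alpha>) * z *
        exp (\<i> / of_real (2 * b) * of_real (1 - a' * b / (a * b')) * of_real t) /
        of_real (sqrt ((1 - a * b' / (a' * b)) * cmod z ^ 2 + a * b' / a')),
      a' / a * t))"

end

theory Submission
  imports Defs
begin

text \<open>Write \<open>D = |Z f\<^sub>1| - |Zbar f\<^sub>1|\<close> and \<open>c = a' / a\<close>. Pushing \<open>rho0 a / D\<close> forward by \<open>f\<close> gives a
  density \<open>\<rho>\<close> on the image cylinder with \<open>\<integral> \<rho>\<^sup>4 = \<integral> K\<^sup>2 rho0\<^sup>4\<close>, because the Jacobian of a contact map
  is \<open>(|Z f\<^sub>1|\<^sup>2 - |Zbar f\<^sub>1|\<^sup>2)\<^sup>2\<close>. It is admissible for every horizontal curve joining the two end discs,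
  in particular for the leaves \<open>Gamma0_curve w\<close> of the image cylinder, whereas \<open>rho0 a'\<close> is admissible
  for \<open>f(Gamma0)\<close>. Hence the hypothesis forces \<open>\<integral> \<rho>\<^sup>4 \<le> \<integral> rho0\<^sup>4 \<le> \<integral> \<rho> rho0\<^sup>3\<close> over the image cylinder,
  so \<open>\<rho> = rho0 a'\<close>, that is \<open>|f\<^sub>1| D = c |z|\<close>, and \<open>rho0 a'\<close> is extremal for \<open>f(Gamma0)\<close>. Extremality
  gives equality in \<open>|df\<^sub>2| \<le> 2 |f\<^sub>1| |df\<^sub>1|\<close> along the leaves; together these make \<open>f\<close> map the leaf of \<open>w\<close>
  to the leaf of some \<open>A(w)\<close>, multiplying the height by \<open>c\<close>. The radial field is horizontal and is mapped
  to a field of constant height; written in terms of \<open>A\<close> this is a polynomial identity in the height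
  whose coefficients say that, in polar coordinates, \<open>|A|\<close> depends on the radius \<open>r\<close> only, \<open>arg A\<close> on
  the angle \<open>\<phi>\<close> only, and \<open>(arg A)' = c r\<^sup>3 |A|' / |A|\<^sup>3\<close>. Both sides are therefore a constant \<open>winding\<close>, which
  is \<open>1\<close> by injectivity, and integrating yields the asserted formula.\<close>

subsection \<open>Change of variables on the Heisenberg group\<close>

text \<open>Two pointwise bounds carry the argument. A horizontal vector at \<open>(z, t)\<close>
  with planar part \<open>v\<close> has height component at most \<open>2 |z| |v|\<close> in
  absolute value, with equality exactly when \<open>v\<close> is orthogonal to \<open>z\<close>, and
  the leaves move in this way; and \<open>f\<close> stretches \<open>v\<close> by at least
  \<open>D\<close>. Inequalities along leaves can be integrated because \<open>(w, s)\<close> to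
  \<open>Gamma0_curve w s\<close> preserves volume and \<open>rho0\<close> is constant on leaves.
  The equality case needs no Hoelder inequality: \<open>x^4 + 3 y^4 - 4 x y^3\<close> is
  \<open>(x - y)^2\<close> times a sum of squares, so a vanishing integral of this continuous
  function gives \<open>x = y\<close> pointwise. Boundary and axis shape the rest. Derivatives exist
  only inside the open cylinder, so the end discs enter through one-sided limits of heights. The
  axis \<open>z = 0\<close> carries no leaf, so the leaf arguments take place off it and continuity
  fills it in. Periodicity and injectivity leave winding 1 or -1; the sign comes from positivity of
  \<open>1 / |A|^2\<close> near the axis.\<close>

lemma nn_integral_eq_iff_absolutely_integrable:
  fixes k :: "'a::euclidean_space \<Rightarrow> real"
  assumes T: "open T" and k: "continuous_on T k" and nn: "\<And>x. x \<in> T \<Longrightarrow> 0 \<le> k x" and r: "0 \<le> r"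
  shows "(\<integral>\<^sup>+x\<in>T. ennreal (k x) \<partial>lborel) = ennreal r \<longleftrightarrow> k absolutely_integrable_on T \<and> integral T k = r"
proof
  assume L: "(\<integral>\<^sup>+x\<in>T. ennreal (k x) \<partial>lborel) = ennreal r"
  let ?k = "\<lambda>x. if x \<in> T then k x else 0"
  have m: "?k \<in> borel_measurable borel"
    using borel_measurable_continuous_on_if[of T k "\<lambda>_. 0"] T k by auto
  have "(\<integral>\<^sup>+x. ennreal (?k x) \<partial>lborel) = (\<integral>\<^sup>+x\<in>T. ennreal (k x) \<partial>lborel)"
    by (intro nn_integral_cong) (auto simp: indicator_def)
  with L have "(?k has_integral r) UNIV"
    by (intro nn_integral_has_integral m) (auto simp: nn r)
  then have "(k has_integral r) T"
    by (simp add: has_integral_restrict_UNIV)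
  then show "k absolutely_integrable_on T \<and> integral T k = r"
    by (auto simp: absolutely_integrable_on_iff_nonneg nn integral_unique)
next
  assume "k absolutely_integrable_on T \<and> integral T k = r"
  then have "(k has_integral r) T"
    using absolutely_integrable_on_def has_integral_integral by blast
  then show "(\<integral>\<^sup>+x\<in>T. ennreal (k x) \<partial>lborel) = ennreal r"
    by (intro nn_integral_has_integral_lebesgue') (auto simp: nn)
qed

text \<open>The change of variables theorem compares finite values of the two integrals. Two
  extended values with the same finite candidates agree, since otherwise both are infinite.\<close>

lemma ennreal_eqI:
  fixes x y :: ennreal
  assumes "\<And>r. 0 \<le> r \<Longrightarrow> x = ennreal r \<longleftrightarrow> y = ennreal r"
  shows "x = y"
proof (cases x)
  case (real r)
  with assms[of r] show ?thesis by simp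
next
  case top
  show ?thesis
  proof (cases y)
    case (real r)
    with assms[of r] show ?thesis by simp
  qed (use top in simp)
qed

lemma nn_integral_change_of_variables:
  fixes g :: "real^'m::{finite,wellorder} \<Rightarrow> real^'m::_" and h :: "real^'m::_ \<Rightarrow> real"
  assumes S: "open S" and der: "\<And>x. x \<in> S \<Longrightarrow> (g has_derivative g' x) (at x)"
    and inj: "inj_on g S" and J: "continuous_on S (\<lambda>x. det (matrix (g' x)))"
    and h: "continuous_on (g ` S) h" and nn: "\<And>y. y \<in> g ` S \<Longrightarrow> 0 \<le> h y"
  shows "(\<integral>\<^sup>+y\<in>g ` S. ennreal (h y) \<partial>lborel) =
    (\<integral>\<^sup>+x\<in>S. ennreal (\<bar>det (matrix (g' x))\<bar> * h (g x)) \<partial>lborel)" (is "?L = ?R")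
proof -
  have cg: "continuous_on S g"
    using der has_derivative_continuous continuous_at_imp_continuous_on by blast
  have og: "open (g ` S)"
    using cg S inj by (rule invariance_of_domain)
  have ck: "continuous_on S (\<lambda>x. \<bar>det (matrix (g' x))\<bar> * h (g x))"
    by (intro continuous_intros J continuous_on_compose2[OF h cg]) auto
  have "?L = ennreal r \<longleftrightarrow> ?R = ennreal r" if "0 \<le> r" for r
  proof -
    have S': "S \<in> sets lebesgue" using S by auto
    have "(\<lambda>x. \<bar>det (matrix (g' x))\<bar> *\<^sub>R vec (h (g x)) :: real^1) absolutely_integrable_on S \<and>
           integral S (\<lambda>x. \<bar>det (matrix (g' x))\<bar> *\<^sub>R vec (h (g x)) :: real^1) = vec r
     \<longleftrightarrow> (\<lambda>x. vec (h x) :: real^1) absolutely_integrable_on (g ` S) \<and> integral (g ` S) (\<lambda>x. vec (h x) :: real^1) = vec r"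
      using has_absolute_integral_change_of_variables[OF S' _ inj, of g' "\<lambda>x. vec (h x)" "vec r"]
        der has_derivative_at_withinI by blast
    then have "(\<lambda>x. \<bar>det (matrix (g' x))\<bar> * h (g x)) absolutely_integrable_on S \<and>
           integral S (\<lambda>x. \<bar>det (matrix (g' x))\<bar> * h (g x)) = r
     \<longleftrightarrow> h absolutely_integrable_on (g ` S) \<and> integral (g ` S) h = r"
      unfolding absolutely_integrable_on_1_iff integral_on_1_eq by (simp add: vec_eq_iff)
    with nn_integral_eq_iff_absolutely_integrable[OF og h nn that]
      nn_integral_eq_iff_absolutely_integrable[OF S ck _ that] nn
    show ?thesis by auto
  qed
  then show ?thesis
    by (rule ennreal_eqI)
qed

text \<open>Matrices, determinants and the change of variables theorem live on
  \<open>real^'n\<close>; these coordinates carry \<open>heis\<close> there.\<close>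

definition heis_to_vec :: "heis \<Rightarrow> real^3" where
  "heis_to_vec p = vector [Re (fst p), Im (fst p), snd p]"

definition vec_to_heis :: "real^3 \<Rightarrow> heis" where
  "vec_to_heis v = (Complex (v $ 1) (v $ 2), v $ 3)"

definition heis_det :: "(heis \<Rightarrow> heis) \<Rightarrow> real" where
  "heis_det A = det (matrix (heis_to_vec \<circ> A \<circ> vec_to_heis))"

lemma vec_to_heis_to_vec [simp]: "vec_to_heis (heis_to_vec p) = p"
  by (simp add: vec_to_heis_def heis_to_vec_def)

lemma heis_to_vec_to_heis [simp]: "heis_to_vec (vec_to_heis v) = v"
  by (simp add: vec_to_heis_def heis_to_vec_def vec_eq_iff forall_3)

lemma heis_to_vec_eq_iff [simp]: "heis_to_vec p = heis_to_vec q \<longleftrightarrow> p = q"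
  by (metis vec_to_heis_to_vec)

lemma bounded_linear_heis_to_vec: "bounded_linear heis_to_vec"
  unfolding linear_conv_bounded_linear[symmetric]
  by (rule linearI) (simp_all add: heis_to_vec_def vec_eq_iff forall_3)

lemma bounded_linear_vec_to_heis: "bounded_linear vec_to_heis"
  unfolding linear_conv_bounded_linear[symmetric]
  by (rule linearI) (simp_all add: vec_to_heis_def complex_eq_iff)

lemma heis_det:
  "heis_det A = det (vector [vector [Re (fst (A (1,0))), Re (fst (A (\<i>,0))), Re (fst (A (0,1)))],
     vector [Im (fst (A (1,0))), Im (fst (A (\<i>,0))), Im (fst (A (0,1)))],
     vector [snd (A (1,0)), snd (A (\<i>,0)), snd (A (0,1))]] :: real^3^3)"
proof -
  have *: "vec_to_heis (axis 1 1) = (1,0)" "vec_to_heis (axis 2 1) = (\<i>,0)" "vec_to_heis (axis 3 1) = (0,1)"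
    by (auto simp: vec_to_heis_def axis_def complex_eq_iff)
  show ?thesis
    unfolding heis_det_def by (rule arg_cong[where f=det]) (simp add: vec_eq_iff forall_3 matrix_def * heis_to_vec_def)
qed

text \<open>Lebesgue measure is characterised by its values on boxes, and coordinate boxes
  correspond to coordinate boxes with the same side lengths.\<close>

lemma distr_heis_to_vec: "distr lborel borel heis_to_vec = lborel"
proof (rule lborel_eqI[symmetric])
  fix l u :: "real^3"
  have B: "(Basis :: heis set) = {(1,0), (\<i>,0), (0,1)}"
      by (auto simp: Basis_prod_def Basis_complex_def)
  assume lu: "\<And>b. b \<in> Basis \<Longrightarrow> l \<bullet> b \<le> u \<bullet> b"
  have [measurable]: "heis_to_vec \<in> borel_measurable borel"
    by (intro borel_measurable_continuous_onI linear_continuous_on bounded_linear_heis_to_vec)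
  have lu': "l $ i \<le> u $ i" for i
    using lu[of "axis i 1"] by (simp add: inner_axis axis_in_Basis_iff)
  have eq: "heis_to_vec -` box l u = box (vec_to_heis l) (vec_to_heis u)"
  proof (rule set_eqI)
    fix p :: heis
    have "p \<in> heis_to_vec -` box l u \<longleftrightarrow> l $ 1 < Re (fst p) \<and> Re (fst p) < u $ 1 \<and>
        l $ 2 < Im (fst p) \<and> Im (fst p) < u $ 2 \<and> l $ 3 < snd p \<and> snd p < u $ 3"
      unfolding vimage_eq mem_box_cart forall_3 by (simp add: heis_to_vec_def conj_ac)
    also have "\<dots> \<longleftrightarrow> p \<in> box (vec_to_heis l) (vec_to_heis u)"
      unfolding mem_box B by (auto simp: vec_to_heis_def inner_prod_def)
    finally show "p \<in> heis_to_vec -` box l u \<longleftrightarrow> p \<in> box (vec_to_heis l) (vec_to_heis u)" .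
  qed
  have "emeasure (distr lborel borel heis_to_vec) (box l u) = emeasure lborel (box (vec_to_heis l) (vec_to_heis u))"
    by (subst emeasure_distr) (auto simp: eq)
  also have "\<dots> = (\<Prod>b\<in>Basis. (vec_to_heis u - vec_to_heis l) \<bullet> b)"
  proof (rule emeasure_lborel_box)
    fix d :: heis assume "d \<in> Basis"
    then have "d = (1,0) \<or> d = (\<i>,0) \<or> d = (0,1)" by (simp add: B)
    then show "vec_to_heis l \<bullet> d \<le> vec_to_heis u \<bullet> d"
      using lu'[of 1] lu'[of 2] lu'[of 3] by (elim disjE) (simp_all add: vec_to_heis_def)
  qed
  also have "(\<Prod>b\<in>Basis. (vec_to_heis u - vec_to_heis l) \<bullet> b) = (\<Prod>i\<in>UNIV. (u - l) $ i)"
  proof -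
    have ne: "(1::complex, 0::real) \<noteq> (\<i>, 0)" "(1::complex, 0::real) \<noteq> (0, 1)" "(\<i>, 0::real) \<noteq> (0, 1)"
      by (simp_all add: complex_eq_iff)
    show ?thesis
      unfolding B UNIV_3 by (subst prod.insert; (subst prod.insert)?) (use ne in \<open>auto simp: vec_to_heis_def\<close>)
  qed
  also have "\<dots> = (\<Prod>b\<in>Basis. (u - l) \<bullet> b)"
  proof -
    have "(\<Prod>b\<in>(\<lambda>i. axis i (1::real)) ` (UNIV::3 set). (u - l) \<bullet> b) = (\<Prod>i\<in>UNIV. (u - l) \<bullet> axis i 1)"
      by (rule prod.reindex_cong[OF _ refl refl]) (auto simp: inj_on_def axis_eq_axis)
    moreover have "(\<lambda>i. axis i (1::real)) ` (UNIV::3 set) = Basis"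
      by (auto simp: Basis_vec_def)
    ultimately show ?thesis by (simp add: inner_axis)
  qed
  finally show "emeasure (distr lborel borel heis_to_vec) (box l u) = (\<Prod>b\<in>Basis. (u - l) \<bullet> b)" .
qed auto

lemma heis_nn_integral_change_of_variables:
  fixes g :: "heis \<Rightarrow> heis" and h :: "heis \<Rightarrow> real"
  assumes S: "open S" and der: "\<And>x. x \<in> S \<Longrightarrow> (g has_derivative g' x) (at x)"
    and inj: "inj_on g S" and J: "continuous_on S (\<lambda>x. heis_det (g' x))"
    and h: "continuous_on (g ` S) h" and nn: "\<And>y. y \<in> g ` S \<Longrightarrow> 0 \<le> h y"
  shows "(\<integral>\<^sup>+y\<in>g ` S. ennreal (h y) \<partial>lborel) =
    (\<integral>\<^sup>+x\<in>S. ennreal (\<bar>heis_det (g' x)\<bar> * h (g x)) \<partial>lborel)"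
proof -
  note bl = bounded_linear_heis_to_vec bounded_linear_vec_to_heis
  have cL: "continuous_on A heis_to_vec" "continuous_on B vec_to_heis" for A B
    by (intro linear_continuous_on bl)+
  have mL [measurable]: "heis_to_vec \<in> borel_measurable borel"
    by (intro borel_measurable_continuous_onI cL)
  have cg: "continuous_on S g"
    using der has_derivative_continuous continuous_at_imp_continuous_on by blast
  have og: "open (g ` S)"
    using cg S inj by (rule invariance_of_domain)
  have img: "heis_to_vec ` X = vec_to_heis -` X" for X
    by (auto intro: image_eqI[of _ heis_to_vec "vec_to_heis x" for x])
  have transfer: "(\<integral>\<^sup>+x\<in>T. ennreal (k x) \<partial>lborel) =
      (\<integral>\<^sup>+x\<in>heis_to_vec ` T. ennreal (k (vec_to_heis x)) \<partial>lborel)"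
    if T: "open T" and k: "continuous_on T k" for T and k :: "heis \<Rightarrow> real"
  proof -
    have oT: "open (heis_to_vec ` T)" unfolding img
      using T cL(2) by (intro open_vimage) auto
    have "(\<lambda>x. if x \<in> heis_to_vec ` T then k (vec_to_heis x) else 0) \<in> borel_measurable borel"
      by (intro borel_measurable_continuous_on_if continuous_on_compose2[OF k cL(2)] borel_open oT) auto
    then have m: "(\<lambda>x. ennreal (if x \<in> heis_to_vec ` T then k (vec_to_heis x) else 0)) \<in> borel_measurable borel"
      by simp
    have "(\<integral>\<^sup>+x\<in>heis_to_vec ` T. ennreal (k (vec_to_heis x)) \<partial>lborel) =
       (\<integral>\<^sup>+x. ennreal (if x \<in> heis_to_vec ` T then k (vec_to_heis x) else 0) \<partial>distr lborel borel heis_to_vec)"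
      unfolding distr_heis_to_vec by (intro nn_integral_cong) auto
    also have "\<dots> = (\<integral>\<^sup>+x. ennreal (if heis_to_vec x \<in> heis_to_vec ` T then k (vec_to_heis (heis_to_vec x)) else 0) \<partial>lborel)"
      using m by (subst nn_integral_distr) auto
    also have "\<dots> = (\<integral>\<^sup>+x\<in>T. ennreal (k x) \<partial>lborel)"
      by (intro nn_integral_cong) (auto simp: img)
    finally show ?thesis ..
  qed
  define G where "G = heis_to_vec \<circ> g \<circ> vec_to_heis"
  define G' where "G' = (\<lambda>x. heis_to_vec \<circ> g' (vec_to_heis x) \<circ> vec_to_heis)"
  have GS: "G ` heis_to_vec ` S = heis_to_vec ` g ` S"
    by (auto simp: G_def image_image)
  have "(\<integral>\<^sup>+y\<in>G ` heis_to_vec ` S. ennreal (h (vec_to_heis y)) \<partial>lborel) =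
    (\<integral>\<^sup>+x\<in>heis_to_vec ` S. ennreal (\<bar>det (matrix (G' x))\<bar> * h (vec_to_heis (G x))) \<partial>lborel)"
  proof (rule nn_integral_change_of_variables)
    show "open (heis_to_vec ` S)" unfolding img
      using S cL(2) by (intro open_vimage) auto
    show "(G has_derivative G' x) (at x)" if "x \<in> heis_to_vec ` S" for x
      unfolding G_def G'_def o_def
      using that bounded_linear.has_derivative[OF bl(1) has_derivative_compose[OF bounded_linear.has_derivative[OF bl(2) has_derivative_ident] der]]
      by (auto simp: img)
    show "inj_on G (heis_to_vec ` S)"
      using inj by (auto simp: inj_on_def G_def)
    show "continuous_on (heis_to_vec ` S) (\<lambda>x. det (matrix (G' x)))"
      using continuous_on_compose2[OF J cL(2), of "heis_to_vec ` S"]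
      by (simp add: heis_det_def G'_def image_image)
    show "continuous_on (G ` heis_to_vec ` S) (\<lambda>y. h (vec_to_heis y))"
      unfolding GS by (intro continuous_on_compose2[OF h cL(2)]) auto
    show "0 \<le> h (vec_to_heis y)" if "y \<in> G ` heis_to_vec ` S" for y
    proof -
      from that[unfolded GS] obtain q where "y = heis_to_vec q" "q \<in> g ` S" by (rule imageE)
      with nn show ?thesis by simp
    qed
  qed
  moreover have "(\<integral>\<^sup>+y\<in>g ` S. ennreal (h y) \<partial>lborel) = (\<integral>\<^sup>+y\<in>G ` heis_to_vec ` S. ennreal (h (vec_to_heis y)) \<partial>lborel)"
    unfolding GS by (rule transfer[OF og h])
  moreover have "(\<integral>\<^sup>+x\<in>S. ennreal (\<bar>heis_det (g' x)\<bar> * h (g x)) \<partial>lborel) =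
    (\<integral>\<^sup>+x\<in>heis_to_vec ` S. ennreal (\<bar>det (matrix (G' x))\<bar> * h (vec_to_heis (G x))) \<partial>lborel)"
    using transfer[OF S, of "\<lambda>x. \<bar>heis_det (g' x)\<bar> * h (g x)"]
      continuous_on_mult[OF continuous_on_rabs[OF J] continuous_on_compose2[OF h cg]]
    by (simp add: heis_det_def G'_def G_def)
  ultimately show ?thesis by simp
qed

subsection \<open>Contact maps of class C2\<close>

text \<open>The increment of \<open>f\<close> in direction \<open>u\<close> is followed along
  \<open>v\<close>, with its expected linear part removed, and the mean value inequality is applied
  to it. The factor 2 collects the first-order errors of \<open>f'\<close> at the two moving
  points.\<close>

lemma second_difference_bound:
  fixes f :: "'a::real_normed_vector \<Rightarrow> 'b::real_normed_vector" and f' :: "'a \<Rightarrow> 'a \<Rightarrow>\<^sub>L 'b"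
    and F :: "'a \<Rightarrow>\<^sub>L 'a \<Rightarrow>\<^sub>L 'b"
  assumes der: "\<And>x. norm x < \<delta> \<Longrightarrow> (f has_derivative f' (p + x)) (at (p + x))"
    and F: "\<And>x. norm x < \<delta> \<Longrightarrow> norm (f' (p + x) - f' p - F x) \<le> e * norm x"
    and s: "norm u + norm v < \<delta>" and e: "0 \<le> e"
  shows "norm (f (p + u + v) - f (p + u) - f (p + v) + f p - F u v) \<le> 2 * e * (norm u + norm v) * norm v"
proof -
  define k where "k = (\<lambda>\<tau>::real. f (p + (u + \<tau> *\<^sub>R v)) - f (p + \<tau> *\<^sub>R v) - \<tau> *\<^sub>R F u v)"
  define k' where "k' = (\<lambda>\<tau>::real. f' (p + (u + \<tau> *\<^sub>R v)) v - f' (p + \<tau> *\<^sub>R v) v - F u v)"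
  have n1: "norm (\<tau> *\<^sub>R v) \<le> norm v" if "0 \<le> \<tau>" "\<tau> \<le> 1" for \<tau> :: real
    using that by (simp add: mult_left_le_one_le)
  have n2: "norm (u + \<tau> *\<^sub>R v) \<le> norm u + norm v" if "0 \<le> \<tau>" "\<tau> \<le> 1" for \<tau> :: real
    using n1[OF that] norm_triangle_ineq[of u "\<tau> *\<^sub>R v"] by simp
  have dk: "(k has_vector_derivative k' \<tau>) (at \<tau>)" if "0 \<le> \<tau>" "\<tau> \<le> 1" for \<tau>
  proof -
    have l1: "norm (\<tau> *\<^sub>R v) < \<delta>" and l2: "norm (u + \<tau> *\<^sub>R v) < \<delta>"
      using n1[OF that] n2[OF that] s norm_ge_zero[of u] by linarith+
    have 1: "((\<lambda>\<tau>. f (p + (u + \<tau> *\<^sub>R v))) has_derivative (\<lambda>h. f' (p + (u + \<tau> *\<^sub>R v)) (h *\<^sub>R v))) (at \<tau>)"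
      by (rule has_derivative_compose[of "\<lambda>\<tau>. p + (u + \<tau> *\<^sub>R v)" "\<lambda>h. h *\<^sub>R v" \<tau> UNIV f, OF _ der[OF l2]])
         (auto intro!: derivative_eq_intros)
    have 2: "((\<lambda>\<tau>. f (p + \<tau> *\<^sub>R v)) has_derivative (\<lambda>h. f' (p + \<tau> *\<^sub>R v) (h *\<^sub>R v))) (at \<tau>)"
      by (rule has_derivative_compose[of "\<lambda>\<tau>. p + \<tau> *\<^sub>R v" "\<lambda>h. h *\<^sub>R v" \<tau> UNIV f, OF _ der[OF l1]])
         (auto intro!: derivative_eq_intros)
    have 3: "((\<lambda>\<tau>. \<tau> *\<^sub>R F u v) has_derivative (\<lambda>h. h *\<^sub>R F u v)) (at \<tau>)"
      by (auto intro!: derivative_eq_intros)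
    show ?thesis
      unfolding has_vector_derivative_def k_def k'_def
      by (rule has_derivative_eq_rhs[OF has_derivative_diff[OF has_derivative_diff[OF 1 2] 3]])
         (simp add: blinfun.scaleR_right scaleR_diff_right)
  qed
  have bk: "norm (k' \<tau>) \<le> 2 * e * (norm u + norm v) * norm v" if "0 \<le> \<tau>" "\<tau> \<le> 1" for \<tau>
  proof -
    have "k' \<tau> = ((f' (p + (u + \<tau> *\<^sub>R v)) - f' p - F (u + \<tau> *\<^sub>R v)) - (f' (p + \<tau> *\<^sub>R v) - f' p - F (\<tau> *\<^sub>R v))) v"
      by (simp add: k'_def blinfun.diff_left blinfun.add_right blinfun.add_left)
    also have "norm \<dots> \<le> norm ((f' (p + (u + \<tau> *\<^sub>R v)) - f' p - F (u + \<tau> *\<^sub>R v)) - (f' (p + \<tau> *\<^sub>R v) - f' p - F (\<tau> *\<^sub>R v))) * norm v"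
      by (rule norm_blinfun)
    also have "\<dots> \<le> (e * norm (u + \<tau> *\<^sub>R v) + e * norm (\<tau> *\<^sub>R v)) * norm v"
      using n1[OF that] n2[OF that] s norm_ge_zero[of u] norm_ge_zero[of v]
      by (intro mult_right_mono[OF order_trans[OF norm_triangle_ineq4 add_mono[OF F F]]]) linarith+
    also have "\<dots> \<le> (e * (norm u + norm v) + e * (norm u + norm v)) * norm v"
      by (intro mult_right_mono add_mono mult_left_mono n2 that e)
         (use n1[OF that] norm_ge_zero[of u] norm_ge_zero[of v] in linarith)+
    finally show ?thesis by (simp add: algebra_simps)
  qed
  have "norm (k 1 - k 0) \<le> (\<lambda>\<tau>. \<tau> * (2 * e * (norm u + norm v) * norm v)) 1 - (\<lambda>\<tau>. \<tau> * (2 * e * (norm u + norm v) * norm v)) 0"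
  proof (rule differentiable_bound_general[where f'=k' and \<phi>'="\<lambda>_. 2 * e * (norm u + norm v) * norm v"])
    show "continuous_on {0..1} k"
      by (meson continuous_at_imp_continuous_on has_vector_derivative_continuous dk atLeastAtMost_iff)
    show "continuous_on {0..1} (\<lambda>\<tau>. \<tau> * (2 * e * (norm u + norm v) * norm v))"
      by (intro continuous_intros)
    show "((\<lambda>\<tau>. \<tau> * (2 * e * (norm u + norm v) * norm v)) has_vector_derivative 2 * e * (norm u + norm v) * norm v) (at x)" for x
      by (auto intro!: derivative_eq_intros simp flip: has_real_derivative_iff_has_vector_derivative)
  qed (use dk bk in auto)
  then show ?thesis
    by (simp add: k_def algebra_simps)
qed

text \<open>The second difference is symmetric in \<open>u\<close> and \<open>v\<close> and
  approximates both \<open>F u v\<close> and \<open>F v u\<close>. Scaling both vectors by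
  \<open>s\<close> and dividing by \<open>s^2\<close> makes the error arbitrarily small.\<close>

lemma second_derivative_symmetric:
  fixes f :: "'a::real_normed_vector \<Rightarrow> 'b::real_normed_vector" and f' :: "'a \<Rightarrow> 'a \<Rightarrow>\<^sub>L 'b"
    and F :: "'a \<Rightarrow>\<^sub>L 'a \<Rightarrow>\<^sub>L 'b"
  assumes S: "open S" "p \<in> S" and der: "\<And>q. q \<in> S \<Longrightarrow> (f has_derivative f' q) (at q)"
    and F: "(f' has_derivative F) (at p)"
  shows "F u v = F v u"
proof -
  define N where "N = norm u + norm v"
  have bd: "norm (F u v - F v u) \<le> e * (2 * N ^ 2)" if e: "e > 0" for e
  proof -
    obtain d1 where d1: "d1 > 0" "ball p d1 \<subseteq> S"
      using S open_contains_ball by blast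
    obtain d2 where d2: "d2 > 0" "\<And>y. norm (y - p) < d2 \<Longrightarrow> norm (f' y - f' p - F (y - p)) \<le> e * norm (y - p)"
      using F e unfolding has_derivative_at_alt by blast
    define \<delta> where "\<delta> = min d1 d2"
    have D: "(f has_derivative f' (p + x)) (at (p + x))" if "norm x < \<delta>" for x
      using that d1 by (intro der) (auto simp: \<delta>_def subset_eq dist_norm)
    have E: "norm (f' (p + x) - f' p - F x) \<le> e * norm x" if "norm x < \<delta>" for x
      using that d2(2)[of "p + x"] by (auto simp: \<delta>_def)
    define s where "s = \<delta> / (2 * (N + 1))"
    have N0: "0 \<le> N" by (simp add: N_def)
    have s: "s > 0"
      using d1 d2 N0 by (simp add: s_def \<delta>_def)
    have "s * N < s * (2 * (N + 1))"
      using s N0 by (intro mult_strict_left_mono) auto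
    also have "\<dots> = \<delta>"
      using N0 by (simp add: s_def)
    finally have sN: "s * N < \<delta>" .
    have sn: "norm (s *\<^sub>R u) + norm (s *\<^sub>R v) < \<delta>"
      using s sN by (simp add: N_def algebra_simps)
    let ?E = "f (p + s *\<^sub>R u + s *\<^sub>R v) - f (p + s *\<^sub>R u) - f (p + s *\<^sub>R v) + f p"
    have 1: "norm (?E - F (s *\<^sub>R u) (s *\<^sub>R v)) \<le> 2 * e * (norm (s *\<^sub>R u) + norm (s *\<^sub>R v)) * norm (s *\<^sub>R v)"
      by (rule second_difference_bound[OF D E sn]) (use e in auto)
    have 2: "norm (f (p + s *\<^sub>R v + s *\<^sub>R u) - f (p + s *\<^sub>R v) - f (p + s *\<^sub>R u) + f p - F (s *\<^sub>R v) (s *\<^sub>R u))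
       \<le> 2 * e * (norm (s *\<^sub>R v) + norm (s *\<^sub>R u)) * norm (s *\<^sub>R u)"
      by (rule second_difference_bound[OF D E]) (use e sn in auto)
    have eq: "f (p + s *\<^sub>R v + s *\<^sub>R u) - f (p + s *\<^sub>R v) - f (p + s *\<^sub>R u) + f p = ?E"
      by (simp add: algebra_simps)
    have "norm (F (s *\<^sub>R u) (s *\<^sub>R v) - F (s *\<^sub>R v) (s *\<^sub>R u)) =
        norm ((?E - F (s *\<^sub>R v) (s *\<^sub>R u)) - (?E - F (s *\<^sub>R u) (s *\<^sub>R v)))"
      by simp
    also have "\<dots> \<le> 2 * e * (norm (s *\<^sub>R v) + norm (s *\<^sub>R u)) * norm (s *\<^sub>R u) +
       2 * e * (norm (s *\<^sub>R u) + norm (s *\<^sub>R v)) * norm (s *\<^sub>R v)"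
      by (rule order_trans[OF norm_triangle_ineq4 add_mono[OF 2[unfolded eq] 1]])
    also have "\<dots> = s^2 * (e * (2 * N ^ 2))"
      using s by (simp add: N_def power2_eq_square algebra_simps)
    also have "F (s *\<^sub>R u) (s *\<^sub>R v) - F (s *\<^sub>R v) (s *\<^sub>R u) = s^2 *\<^sub>R (F u v - F v u)"
      by (simp add: blinfun.scaleR_right blinfun.scaleR_left power2_eq_square scaleR_diff_right)
    finally have "s^2 * norm (F u v - F v u) \<le> s^2 * (e * (2 * N ^ 2))" by simp
    with s show ?thesis by simp
  qed
  have "norm (F u v - F v u) \<le> 0"
  proof (rule field_le_epsilon)
    fix e :: real assume "e > 0"
    with bd[of "e / (2 * N ^ 2 + 1)"]
    have "norm (F u v - F v u) \<le> e * (2 * N ^ 2) / (2 * N ^ 2 + 1)"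
      by (simp add: add_nonneg_pos)
    also have "\<dots> \<le> e"
    proof -
      have "0 < 2 * N ^ 2 + 1" by (simp add: add_nonneg_pos)
      then show ?thesis using \<open>e > 0\<close> by (simp add: pos_divide_le_eq algebra_simps)
    qed
    finally show "norm (F u v - F v u) \<le> 0 + e" by simp
  qed
  then show ?thesis by simp
qed

section \<open>Horizontal vectors, the contact factor and the Jacobian\<close>

definition horizontal_lift :: "heis \<Rightarrow> complex \<Rightarrow> heis" where
  "horizontal_lift p v = (v, - 2 * Im (cnj (fst p) * v))"

lemma fst_horizontal_lift [simp]: "fst (horizontal_lift p v) = v"
  by (simp add: horizontal_lift_def)

lemma contact_form_real: "contact_form p v = of_real (snd v + 2 * Im (cnj (fst p) * fst v))"
  by (simp add: contact_form_def complex_eq_iff algebra_simps)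

lemma contact_form_horizontal_lift [simp]: "contact_form p (horizontal_lift p v) = 0"
  by (simp add: contact_form_real horizontal_lift_def)

lemma horizontal_lift_linear:
  "horizontal_lift p v = Re v *\<^sub>R horizontal_lift p 1 + Im v *\<^sub>R horizontal_lift p \<i>"
  by (simp add: horizontal_lift_def complex_eq_iff algebra_simps)

locale contact_C2 =
  fixes \<Omega> :: "heis set" and f :: "heis \<Rightarrow> heis" and f' :: "heis \<Rightarrow> heis \<Rightarrow>\<^sub>L heis"
    and f'' :: "heis \<Rightarrow> heis \<Rightarrow>\<^sub>L heis \<Rightarrow>\<^sub>L heis" and l :: "heis \<Rightarrow> real"
  assumes open_dom: "open \<Omega>"
    and der: "\<And>p. p \<in> \<Omega> \<Longrightarrow> (f has_derivative f' p) (at p)"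
    and der2: "\<And>p. p \<in> \<Omega> \<Longrightarrow> (f' has_derivative f'' p) (at p)"
    and contact: "\<And>p v. p \<in> \<Omega> \<Longrightarrow> contact_form (f p) (f' p v) = of_real (l p) * contact_form p v"
    and factor_nonzero: "\<And>p. p \<in> \<Omega> \<Longrightarrow> l p \<noteq> 0"
begin

text \<open>The planar part is enough: contactness makes the image of a horizontal vector
  horizontal, so its height component is determined. As a real linear map of the plane it has the
  complex coefficients \<open>Zf\<close> and \<open>Zbf\<close>.\<close>

definition hderiv :: "heis \<Rightarrow> complex \<Rightarrow> complex" where
  "hderiv p v = fst (f' p (horizontal_lift p v))"

abbreviation Zf where "Zf p \<equiv> Z_op (\<lambda>q. fst (f q)) p"
abbreviation Zbf where "Zbf p \<equiv> Zbar_op (\<lambda>q. fst (f q)) p"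

lemma contact_real:
  assumes "p \<in> \<Omega>"
  shows "snd (f' p v) + 2 * Im (cnj (fst (f p)) * fst (f' p v)) = l p * (snd v + 2 * Im (cnj (fst p) * fst v))"
  using contact[OF assms, of v] unfolding contact_form_real of_real_mult[symmetric] of_real_eq_iff .

lemma snd_horizontal:
  assumes "p \<in> \<Omega>"
  shows "snd (f' p (horizontal_lift p v)) = - 2 * Im (cnj (fst (f p)) * hderiv p v)"
  using contact_real[OF assms, of "horizontal_lift p v"] by (simp add: hderiv_def horizontal_lift_def)

lemma hderiv_linear: "hderiv p v = of_real (Re v) * hderiv p 1 + of_real (Im v) * hderiv p \<i>"
  unfolding hderiv_def
  by (subst horizontal_lift_linear) (simp only: blinfun.add_right blinfun.scaleR_right fst_add fst_scaleR scaleR_conv_of_real)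

lemma frechet_fst:
  assumes "p \<in> \<Omega>"
  shows "frechet_derivative (\<lambda>q. fst (f q)) (at p) v = fst (f' p v)"
  using frechet_derivative_at[OF has_derivative_fst[OF der[OF assms]]] by metis

lemma Zf_Zbf:
  assumes "p \<in> \<Omega>"
  shows "Zf p = (hderiv p 1 - \<i> * hderiv p \<i>) / 2" "Zbf p = (hderiv p 1 + \<i> * hderiv p \<i>) / 2"
proof -
  have "horizontal_lift p 1 = (1, 0) + (2 * Im (fst p)) *\<^sub>R (0, 1)"
    "horizontal_lift p \<i> = (\<i>, 0) - (2 * Re (fst p)) *\<^sub>R (0, 1)"
    by (simp_all add: horizontal_lift_def)
  then have H: "hderiv p 1 = fst (f' p (1, 0)) + of_real (2 * Im (fst p)) * fst (f' p (0, 1))"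
    "hderiv p \<i> = fst (f' p (\<i>, 0)) - of_real (2 * Re (fst p)) * fst (f' p (0, 1))"
    unfolding hderiv_def
    by (simp_all only: blinfun.add_right blinfun.diff_right blinfun.scaleR_right fst_add fst_diff fst_scaleR scaleR_conv_of_real)
  show "Zf p = (hderiv p 1 - \<i> * hderiv p \<i>) / 2"
    unfolding Z_op_def d_z_def d_t_def frechet_fst[OF assms] H by (simp add: complex_eq_iff field_simps)
  show "Zbf p = (hderiv p 1 + \<i> * hderiv p \<i>) / 2"
    unfolding Zbar_op_def d_zbar_def d_t_def frechet_fst[OF assms] H by (simp add: complex_eq_iff field_simps)
qed

lemma hderiv_eq:
  assumes "p \<in> \<Omega>"
  shows "hderiv p v = Zf p * v + Zbf p * cnj v"
  unfolding Zf_Zbf[OF assms] by (subst hderiv_linear) (simp add: complex_eq_iff field_simps)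

lemma hderiv_lower:
  assumes "p \<in> \<Omega>"
  shows "(cmod (Zf p) - cmod (Zbf p)) * cmod v \<le> cmod (hderiv p v)"
proof -
  have "cmod (Zf p * v) - cmod (Zbf p * cnj v) \<le> cmod (Zf p * v + Zbf p * cnj v)"
    by (metis add_diff_cancel_right' norm_triangle_ineq2 norm_minus_cancel diff_minus_eq_add)
  then show ?thesis
    by (simp add: hderiv_eq[OF assms] norm_mult left_diff_distrib)
qed

lemma hderiv_cross:
  assumes "p \<in> \<Omega>"
  shows "Im (cnj (hderiv p 1) * hderiv p \<i>) = (cmod (Zf p))\<^sup>2 - (cmod (Zbf p))\<^sup>2"
  unfolding Zf_Zbf[OF assms] cmod_power2 by (simp add: power2_eq_square field_simps)

text \<open>This is the pullback of the differential of the contact form, evaluated on the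
  horizontal plane, where the form itself vanishes. Concretely, the identity "horizontal lifts go to
  horizontal vectors" is differentiated in horizontal directions.\<close>

lemma contact_factor_eq:
  assumes p: "p \<in> \<Omega>"
  shows "l p = (cmod (Zf p))\<^sup>2 - (cmod (Zbf p))\<^sup>2"
proof -
  have D: "((\<lambda>q. snd (f' q (horizontal_lift q e)) + 2 * Im (cnj (fst (f q)) * fst (f' q (horizontal_lift q e))))
     has_derivative (\<lambda>w. snd (f'' p w (horizontal_lift p e) + f' p (0, - 2 * Im (cnj (fst w) * e)))
        + 2 * Im (cnj (fst (f' p w)) * hderiv p e
           + cnj (fst (f p)) * fst (f'' p w (horizontal_lift p e) + f' p (0, - 2 * Im (cnj (fst w) * e)))))) (at p)" for e
  proof -
    have hl: "((\<lambda>q. horizontal_lift q e) has_derivative (\<lambda>w. (0, - 2 * Im (cnj (fst w) * e)))) (at p)"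
      unfolding horizontal_lift_def
      by (rule has_derivative_Pair) (auto intro!: derivative_eq_intros)
    have B: "((\<lambda>q. f' q (horizontal_lift q e)) has_derivative
        (\<lambda>w. f' p (0, - 2 * Im (cnj (fst w) * e)) + f'' p w (horizontal_lift p e))) (at p)"
      by (rule bounded_bilinear.FDERIV[OF bounded_bilinear_blinfun_apply der2[OF p] hl])
    have M: "((\<lambda>q. cnj (fst (f q)) * fst (f' q (horizontal_lift q e))) has_derivative
       (\<lambda>w. cnj (fst (f p)) * fst (f' p (0, - 2 * Im (cnj (fst w) * e)) + f'' p w (horizontal_lift p e))
          + cnj (fst (f' p w)) * fst (f' p (horizontal_lift p e)))) (at p)"
      by (rule has_derivative_mult[OF has_derivative_cnj[OF has_derivative_fst[OF der[OF p]]] has_derivative_fst[OF B]])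
    show ?thesis
      by (rule has_derivative_eq_rhs[OF has_derivative_add[OF has_derivative_snd[OF B]
        has_derivative_mult_right[OF has_derivative_Im[OF M]]]])
        (auto simp: hderiv_def algebra_simps)
  qed
  have Z: "((\<lambda>q. snd (f' q (horizontal_lift q e)) + 2 * Im (cnj (fst (f q)) * fst (f' q (horizontal_lift q e))))
     has_derivative (\<lambda>w. 0)) (at p)" for e
  proof (rule has_derivative_transform_within_open[OF _ open_dom p])
    show "0 = snd (f' q (horizontal_lift q e)) + 2 * Im (cnj (fst (f q)) * fst (f' q (horizontal_lift q e)))" if "q \<in> \<Omega>" for q
      using contact_real[OF that, of "horizontal_lift q e"] by (simp add: horizontal_lift_def)
  qed auto
  have E: "snd (f'' p w (horizontal_lift p e) + f' p (0, - 2 * Im (cnj (fst w) * e)))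
        + 2 * Im (cnj (fst (f' p w)) * hderiv p e
           + cnj (fst (f p)) * fst (f'' p w (horizontal_lift p e) + f' p (0, - 2 * Im (cnj (fst w) * e)))) = 0" for e w
    using has_derivative_unique[OF D Z] by (metis (no_types, lifting))
  have sym: "f'' p (horizontal_lift p \<i>) (horizontal_lift p 1) = f'' p (horizontal_lift p 1) (horizontal_lift p \<i>)"
    by (rule second_derivative_symmetric[OF open_dom p der der2[OF p]])
  have h1: "fst (f' p (horizontal_lift p 1)) = hderiv p 1" "fst (f' p (horizontal_lift p \<i>)) = hderiv p \<i>"
    by (simp_all add: hderiv_def)
  have v: "f' p (0, 2) = 2 *\<^sub>R f' p (0, 1)" "f' p (0, -2) = - 2 *\<^sub>R f' p (0, 1)"
    by (simp_all flip: blinfun.scaleR_right)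
  \<comment> \<open>Each lift is differentiated along the other one. In the difference the second
    derivatives cancel by \<open>sym\<close>; what remains is the commutator of the two lifts, which
    is vertical with coefficient of size 4, and the cross term of
    \<open>hderiv_cross\<close>.\<close>
  note e1 = E[of "horizontal_lift p \<i>" 1] and e2 = E[of "horizontal_lift p 1" \<i>]
  have "4 * (snd (f' p (0,1)) + 2 * Im (cnj (fst (f p)) * fst (f' p (0,1)))) = 4 * Im (cnj (hderiv p 1) * hderiv p \<i>)"
    using e1 e2 unfolding sym h1 fst_horizontal_lift by (simp add: v algebra_simps)
  moreover have "snd (f' p (0,1)) + 2 * Im (cnj (fst (f p)) * fst (f' p (0,1))) = l p"
    using contact_real[OF p, of "(0,1)"] by simp
  ultimately show ?thesis
    using hderiv_cross[OF p] by simp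
qed

text \<open>In the frame of the two horizontal lifts and the vertical vector, with heights measured
  by the contact form, the derivative is block triangular: the vertical entry is \<open>l p\<close>
  and the horizontal block has determinant \<open>l p\<close> by \<open>contact_factor_eq\<close>.
  The changes of frame have determinant 1.\<close>

lemma heis_det_eq:
  assumes p: "p \<in> \<Omega>"
  shows "heis_det (f' p) = (l p)\<^sup>2"
proof -
  have H: "hderiv p 1 = fst (f' p (1, 0)) + of_real (2 * Im (fst p)) * fst (f' p (0, 1))"
    "hderiv p \<i> = fst (f' p (\<i>, 0)) - of_real (2 * Re (fst p)) * fst (f' p (0, 1))"
  proof -
    have "horizontal_lift p 1 = (1, 0) + (2 * Im (fst p)) *\<^sub>R (0, 1)"
      "horizontal_lift p \<i> = (\<i>, 0) - (2 * Re (fst p)) *\<^sub>R (0, 1)"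
      by (simp_all add: horizontal_lift_def)
    then show "hderiv p 1 = fst (f' p (1, 0)) + of_real (2 * Im (fst p)) * fst (f' p (0, 1))"
      "hderiv p \<i> = fst (f' p (\<i>, 0)) - of_real (2 * Re (fst p)) * fst (f' p (0, 1))"
      unfolding hderiv_def
      by (simp_all only: blinfun.add_right blinfun.diff_right blinfun.scaleR_right fst_add fst_diff fst_scaleR scaleR_conv_of_real)
  qed
  have s: "snd (f' p v) = l p * (snd v + 2 * Im (cnj (fst p) * fst v)) - 2 * Im (cnj (fst (f p)) * fst (f' p v))" for v
    using contact_real[OF p, of v] by simp
  have "heis_det (f' p) = l p * Im (cnj (hderiv p 1) * hderiv p \<i>)"
    unfolding heis_det det_3 vector_3 H s by (simp add: algebra_simps)
  also have "\<dots> = (l p)\<^sup>2"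
    unfolding hderiv_cross[OF p] contact_factor_eq[OF p, symmetric] by (simp add: power2_eq_square)
  finally show ?thesis .
qed

end

subsection \<open>Fibration of a cylinder by the leaves\<close>

lemma nn_integral_ge_increment_closed:
  fixes y \<phi> :: "real \<Rightarrow> real"
  assumes der: "\<And>s. p < s \<Longrightarrow> s < q \<Longrightarrow> (y has_real_derivative y' s) (at s)"
    and le: "\<And>s. p < s \<Longrightarrow> s < q \<Longrightarrow> y' s \<le> \<phi> s" and nn: "\<And>s. p < s \<Longrightarrow> s < q \<Longrightarrow> 0 \<le> \<phi> s"
    and cont: "continuous_on {p<..<q} \<phi>" and s: "p < s1" "s1 < s2" "s2 < q"
  shows "ennreal (y s2 - y s1) \<le> (\<integral>\<^sup>+s\<in>{p<..<q}. ennreal (\<phi> s) \<partial>lborel)"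
proof -
  have "(y' has_integral (y s2 - y s1)) {s1..s2}"
    using s der unfolding has_real_derivative_iff_has_vector_derivative
    by (intro fundamental_theorem_of_calculus) (auto intro: has_vector_derivative_at_within)
  moreover have I: "(\<phi> has_integral (integral {s1..s2} \<phi>)) {s1..s2}"
    using s by (intro integrable_integral integrable_continuous_real continuous_on_subset[OF cont]) auto
  ultimately have "y s2 - y s1 \<le> integral {s1..s2} \<phi>"
    by (rule has_integral_le) (use s le in auto)
  also have "ennreal (integral {s1..s2} \<phi>) = (\<integral>\<^sup>+s\<in>{s1..s2}. ennreal (\<phi> s) \<partial>lborel)"
    using s nn by (intro nn_integral_has_integral_lebesgue'[OF _ I, symmetric]) auto
  also have "\<dots> \<le> (\<integral>\<^sup>+s\<in>{p<..<q}. ennreal (\<phi> s) \<partial>lborel)"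
    using s by (intro nn_integral_mono) (auto simp: indicator_def)
  finally show ?thesis by (simp add: ennreal_leI)
qed

text \<open>At the ends of the interval only limits of \<open>y\<close> are available, so the bound
  on compact subintervals is passed to the limit one end at a time. An infinite integral is the
  trivial case.\<close>

lemma nn_integral_ge_increment:
  fixes y \<phi> :: "real \<Rightarrow> real"
  assumes der: "\<And>s. p < s \<Longrightarrow> s < q \<Longrightarrow> (y has_real_derivative y' s) (at s)"
    and le: "\<And>s. p < s \<Longrightarrow> s < q \<Longrightarrow> y' s \<le> \<phi> s" and nn: "\<And>s. p < s \<Longrightarrow> s < q \<Longrightarrow> 0 \<le> \<phi> s"
    and cont: "continuous_on {p<..<q} \<phi>" and pq: "p < q"
    and lim: "(y \<longlongrightarrow> y0) (at_right p)" "(y \<longlongrightarrow> y1) (at_left q)"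
  shows "ennreal (y1 - y0) \<le> (\<integral>\<^sup>+s\<in>{p<..<q}. ennreal (\<phi> s) \<partial>lborel)"
proof (cases "\<integral>\<^sup>+s\<in>{p<..<q}. ennreal (\<phi> s) \<partial>lborel")
  case (real x)
  have *: "y s2 - y s1 \<le> x" if "p < s1" "s1 < s2" "s2 < q" for s1 s2
    using nn_integral_ge_increment_closed[OF der le nn cont that] unfolding real(2)
    using real(1) by (simp add: ennreal_le_iff)
  have "y1 - y s1 \<le> x" if "p < s1" "s1 < q" for s1
  proof (rule tendsto_upperbound)
    show "((\<lambda>s2. y s2 - y s1) \<longlongrightarrow> y1 - y s1) (at_left q)"
      by (intro tendsto_intros lim)
    show "eventually (\<lambda>s2. y s2 - y s1 \<le> x) (at_left q)"
      using eventually_at_left_real[OF that(2)] by eventually_elim (use * that in auto)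
  qed auto
  then have "y1 - y0 \<le> x"
  proof (intro tendsto_upperbound)
    show "((\<lambda>s1. y1 - y s1) \<longlongrightarrow> y1 - y0) (at_right p)"
      by (intro tendsto_intros lim)
    show "eventually (\<lambda>s1. y1 - y s1 \<le> x) (at_right p)" if "\<And>s1. p < s1 \<Longrightarrow> s1 < q \<Longrightarrow> y1 - y s1 \<le> x"
      using eventually_at_right_real[OF pq] by eventually_elim (use that in auto)
  qed auto
  with real show ?thesis by (simp add: ennreal_leI)
qed simp

lemma Gamma0_curve_cis: "Gamma0_curve w s = (w * cis (- (s / (2 * (cmod w)\<^sup>2))), s)"
  by (simp add: Gamma0_curve_def cis_conv_exp)

lemma cmod_Gamma0_curve [simp]: "cmod (fst (Gamma0_curve w s)) = cmod w"
  by (simp add: Gamma0_curve_cis norm_mult)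

lemma snd_Gamma0_curve [simp]: "snd (Gamma0_curve w s) = s"
  by (simp add: Gamma0_curve_def)

text \<open>The label of the leaf through \<open>p\<close>, that is, the point where this leaf meets
  height 0. On the axis the value is 0, so \<open>Gamma0_curve_leaf\<close> holds at every
  point.\<close>

definition leaf :: "heis \<Rightarrow> complex" where
  "leaf p = fst p * cis (snd p / (2 * (cmod (fst p))\<^sup>2))"

lemma leaf_Gamma0_curve [simp]: "leaf (Gamma0_curve w s) = w"
  by (simp add: leaf_def Gamma0_curve_cis norm_mult mult.assoc cis_mult)

lemma Gamma0_curve_leaf: "Gamma0_curve (leaf p) (snd p) = p"
  by (simp add: leaf_def Gamma0_curve_cis norm_mult mult.assoc cis_mult)

lemma cmod_leaf [simp]: "cmod (leaf p) = cmod (fst p)"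
  by (simp add: leaf_def norm_mult)

lemma continuous_on_leaf: "continuous_on {p. fst p \<noteq> 0} leaf"
  unfolding leaf_def by (intro continuous_intros) auto

lemma has_derivative_Gamma0_curve:
  assumes w: "fst p \<noteq> 0"
  shows "((\<lambda>p. Gamma0_curve (fst p) (snd p)) has_derivative
    (\<lambda>h. ((fst h - (snd h / (2 * (cmod (fst p))\<^sup>2) - snd p * (fst p \<bullet> fst h) / (cmod (fst p)) ^ 4) *\<^sub>R (\<i> * fst p))
       * cis (- (snd p / (2 * (cmod (fst p))\<^sup>2))), snd h))) (at p)"
proof -
  have n: "((\<lambda>p::heis. (cmod (fst p))\<^sup>2) has_derivative (\<lambda>h. 2 * (fst p \<bullet> fst h))) (at p)"
    unfolding power2_norm_eq_inner by (rule has_derivative_eq_rhs, rule derivative_intros, (rule derivative_intros)+)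
      (auto simp: inner_commute)
  have n0: "2 * (cmod (fst p))\<^sup>2 \<noteq> 0" using w by simp
  have a: "((\<lambda>p::heis. - (snd p / (2 * (cmod (fst p))\<^sup>2))) has_derivative
     (\<lambda>h. - (snd h / (2 * (cmod (fst p))\<^sup>2) - snd p * (fst p \<bullet> fst h) / (cmod (fst p)) ^ 4))) (at p)"
    by (rule has_derivative_eq_rhs[OF has_derivative_minus[OF
          has_derivative_divide'[OF has_derivative_snd[OF has_derivative_ident] has_derivative_mult_right[OF n] n0]]])
      (use w in \<open>auto simp: field_simps power2_eq_square power4_eq_xxxx\<close>)
  have c: "((\<lambda>p::heis. cis (- (snd p / (2 * (cmod (fst p))\<^sup>2)))) has_derivative
     (\<lambda>h. (- (snd h / (2 * (cmod (fst p))\<^sup>2) - snd p * (fst p \<bullet> fst h) / (cmod (fst p)) ^ 4))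
        *\<^sub>R (\<i> * cis (- (snd p / (2 * (cmod (fst p))\<^sup>2)))))) (at p)"
    by (rule has_derivative_cis[OF a])
  show ?thesis
    unfolding Gamma0_curve_cis
    by (rule has_derivative_eq_rhs[OF has_derivative_Pair[OF
          has_derivative_mult[OF has_derivative_fst[OF has_derivative_ident] c] has_derivative_snd[OF has_derivative_ident]]])
      (simp add: scaleR_conv_of_real algebra_simps)
qed

text \<open>The map is a rotation of the plane after a shear: a vector is displaced along
  \<open>\<i> * w\<close> by an amount depending on its height and on its component along
  \<open>w\<close>, and \<open>\<i> * w\<close> is orthogonal to \<open>w\<close>.\<close>

lemma heis_det_Gamma0_curve:
  assumes w: "w \<noteq> 0"
  shows "heis_det (\<lambda>h. ((fst h - (snd h / (2 * (cmod w)\<^sup>2) - s * (w \<bullet> fst h) / (cmod w) ^ 4) *\<^sub>R (\<i> * w)) * cis x, snd h)) = 1"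
proof -
  define k where "k = s / (cmod w) ^ 4"
  have e: "s * (w \<bullet> v) / (cmod w) ^ 4 = k * (w \<bullet> v)" for v by (simp add: k_def)
  have "heis_det (\<lambda>h. ((fst h - (snd h / (2 * (cmod w)\<^sup>2) - s * (w \<bullet> fst h) / (cmod w) ^ 4) *\<^sub>R (\<i> * w)) * cis x, snd h))
     = (cos x)\<^sup>2 + (sin x)\<^sup>2"
    unfolding heis_det det_3 vector_3 e by (simp add: inner_complex_def algebra_simps power2_eq_square)
  then show ?thesis by simp
qed

lemma open_cylinder: "open (cylinder r R)"
  unfolding cylinder_def case_prod_beta
  by (intro open_Collect_conj open_Collect_less continuous_intros)

lemma nn_integral_cylinder_leaves:
  fixes h :: "heis \<Rightarrow> real"
  assumes h: "continuous_on (cylinder r R) h" and nn: "\<And>p. p \<in> cylinder r R \<Longrightarrow> 0 \<le> h p"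
  shows "(\<integral>\<^sup>+p\<in>cylinder r R. ennreal (h p) \<partial>lborel) =
    (\<integral>\<^sup>+w. (\<integral>\<^sup>+s\<in>{0<..<r}. ennreal (h (Gamma0_curve w s)) \<partial>lborel) * indicator {w. w \<noteq> 0 \<and> cmod w < sqrt R} w \<partial>lborel)"
proof -
  define P where "P = cylinder r R \<inter> {p. fst p \<noteq> 0}"
  have oP: "open P" unfolding P_def
    by (intro open_Int open_cylinder open_Collect_neq continuous_intros)
  let ?g = "\<lambda>p::heis. Gamma0_curve (fst p) (snd p)"
  have P_iff: "(w, s) \<in> P \<longleftrightarrow> w \<noteq> 0 \<and> cmod w < sqrt R \<and> s \<in> {0<..<r}" for w s
    by (auto simp: P_def cylinder_def)
  have gP: "?g p \<in> P \<longleftrightarrow> p \<in> P" for p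
    by (simp add: P_def cylinder_def Gamma0_curve_cis norm_mult case_prod_beta)
  have img: "?g ` P = P"
  proof
    show "?g ` P \<subseteq> P"
      by (rule image_subsetI) (erule iffD2[OF gP])
    show "P \<subseteq> ?g ` P"
    proof
      fix p assume "p \<in> P"
      then show "p \<in> ?g ` P"
        using gP[of "(leaf p, snd p)"] by (intro image_eqI[of _ _ "(leaf p, snd p)"]) (simp_all add: Gamma0_curve_leaf)
    qed
  qed
  have inj: "inj_on ?g P"
  proof (rule inj_onI)
    fix p q assume "?g p = ?g q"
    from arg_cong[OF this, of leaf] arg_cong[OF this, of snd] show "p = q"
      by (simp add: prod_eq_iff)
  qed
  have cg: "continuous_on P ?g"
    by (rule has_derivative_continuous_on, rule has_derivative_at_withinI, rule has_derivative_Gamma0_curve) (simp add: P_def)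
  have hP: "continuous_on P h" using h by (rule continuous_on_subset) (simp add: P_def)
  \<comment> \<open>The leaf coordinates degenerate on the axis, which is a null set.\<close>
  have "AE p in lborel. p \<notin> {0::complex} \<times> (UNIV::real set)"
    unfolding lborel_prod[symmetric]
    by (intro AE_not_in) (simp add: null_sets_def lborel.emeasure_pair_measure_Times)
  then have "(\<integral>\<^sup>+p\<in>cylinder r R. ennreal (h p) \<partial>lborel) = (\<integral>\<^sup>+p\<in>P. ennreal (h p) \<partial>lborel)"
    by (intro nn_integral_cong_AE) (auto elim!: eventually_mono simp: P_def indicator_def)
  also have "\<dots> = (\<integral>\<^sup>+p\<in>?g ` P. ennreal (h p) \<partial>lborel)" by (simp add: img)
  also have "\<dots> = (\<integral>\<^sup>+p\<in>P. ennreal (h (?g p)) \<partial>lborel)"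
  proof (subst heis_nn_integral_change_of_variables[OF oP has_derivative_Gamma0_curve inj])
    show "fst p \<noteq> 0" if "p \<in> P" for p using that by (simp add: P_def)
    have J: "heis_det (\<lambda>h. ((fst h - (snd h / (2 * (cmod (fst p))\<^sup>2) - snd p * (fst p \<bullet> fst h) / (cmod (fst p)) ^ 4) *\<^sub>R (\<i> * fst p))
       * cis (- (snd p / (2 * (cmod (fst p))\<^sup>2))), snd h)) = 1" if "p \<in> P" for p
      by (rule heis_det_Gamma0_curve) (use that in \<open>simp add: P_def\<close>)
    show "continuous_on P (\<lambda>p. heis_det (\<lambda>h. ((fst h - (snd h / (2 * (cmod (fst p))\<^sup>2) - snd p * (fst p \<bullet> fst h) / (cmod (fst p)) ^ 4) *\<^sub>R (\<i> * fst p))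
       * cis (- (snd p / (2 * (cmod (fst p))\<^sup>2))), snd h)))"
      by (subst continuous_on_cong[OF refl J]) auto
    show "continuous_on (?g ` P) h" by (simp add: img hP)
    show "0 \<le> h y" if "y \<in> ?g ` P" for y
      using nn that[unfolded img] by (simp add: P_def)
  qed (intro nn_integral_cong, auto simp: indicator_def heis_det_Gamma0_curve P_def)
  also have "\<dots> = (\<integral>\<^sup>+p. ennreal (if p \<in> P then h (?g p) else 0) \<partial>(lborel \<Otimes>\<^sub>M lborel))"
    unfolding lborel_prod by (intro nn_integral_cong) auto
  also have "\<dots> = (\<integral>\<^sup>+w. \<integral>\<^sup>+s. ennreal (if (w, s) \<in> P then h (?g (w, s)) else 0) \<partial>lborel \<partial>lborel)"
  proof (rule lborel.nn_integral_fst[symmetric])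
    have "(\<lambda>p. if p \<in> P then h (?g p) else 0) \<in> borel_measurable borel"
      by (intro borel_measurable_continuous_on_if continuous_on_compose2[OF hP cg] borel_open oP) (simp_all add: img)
    then show "(\<lambda>p. ennreal (if p \<in> P then h (?g p) else 0)) \<in> borel_measurable (lborel \<Otimes>\<^sub>M lborel)"
      by (simp add: lborel_prod)
  qed
  also have "\<dots> = (\<integral>\<^sup>+w. (\<integral>\<^sup>+s\<in>{0<..<r}. ennreal (h (Gamma0_curve w s)) \<partial>lborel) * indicator {w. w \<noteq> 0 \<and> cmod w < sqrt R} w \<partial>lborel)"
  proof (rule nn_integral_cong)
    fix w
    show "(\<integral>\<^sup>+s. ennreal (if (w, s) \<in> P then h (?g (w, s)) else 0) \<partial>lborel) =
       (\<integral>\<^sup>+s\<in>{0<..<r}. ennreal (h (Gamma0_curve w s)) \<partial>lborel) * indicator {w. w \<noteq> 0 \<and> cmod w < sqrt R} w"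
    proof (cases "w \<noteq> 0 \<and> cmod w < sqrt R")
      case True
      then show ?thesis unfolding P_iff by (auto intro!: nn_integral_cong simp: indicator_def)
    next
      case False
      then have "(w, s) \<notin> P" for s by (auto simp: P_iff)
      with False show ?thesis by simp
    qed
  qed
  finally show ?thesis .
qed

subsection \<open>The extremal density\<close>

lemma nn_integral_zero_continuous:
  fixes k :: "'a::euclidean_space \<Rightarrow> real"
  assumes T: "open T" and k: "continuous_on T k" and nn: "\<And>x. x \<in> T \<Longrightarrow> 0 \<le> k x"
    and z: "(\<integral>\<^sup>+x\<in>T. ennreal (k x) \<partial>lborel) = 0" and x: "x \<in> T"
  shows "k x = 0"
proof (rule ccontr)
  assume "k x \<noteq> 0"
  with nn[OF x] have kx: "k x > 0" by simp
  let ?U = "T \<inter> k -` {0<..}"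
  have oU: "open ?U"
    by (rule continuous_open_preimage[OF k T open_greaterThan])
  have "(\<lambda>x. if x \<in> T then k x else 0) \<in> borel_measurable borel"
    by (intro borel_measurable_continuous_on_if borel_open T k) auto
  then have m: "(\<lambda>x. ennreal (if x \<in> T then k x else 0)) \<in> borel_measurable lborel" by simp
  have "(\<integral>\<^sup>+x. ennreal (if x \<in> T then k x else 0) \<partial>lborel) = 0"
    unfolding z[symmetric] by (intro nn_integral_cong) auto
  then have "AE x in lborel. ennreal (if x \<in> T then k x else 0) = 0"
    using nn_integral_0_iff_AE[OF m] by simp
  then have "AE x in lborel. x \<notin> ?U"
    by eventually_elim (auto simp: ennreal_eq_0_iff split: if_splits)
  then have "?U \<in> null_sets lborel"
    using oU by (subst (asm) AE_iff_null_sets[symmetric]) auto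
  then have "negligible ?U"
    using negligible_iff_null_sets null_sets_completionI by blast
  with open_not_negligible[OF oU] x kx show False by auto
qed

lemma cylinder_eq: "cylinder r R = ball 0 (sqrt R) \<times> {0<..<r}"
  by (auto simp: cylinder_def dist_norm)

lemma closure_cylinder:
  assumes "r > 0" "R > 0"
  shows "closure (cylinder r R) = {p. 0 \<le> snd p \<and> snd p \<le> r \<and> cmod (fst p) \<le> sqrt R}"
  unfolding cylinder_eq closure_Times using assms by (auto simp: closure_ball closure_greaterThanLessThan dist_norm)

text \<open>Among all planar velocities whose horizontal lift climbs at unit rate this is the
  shortest: it is orthogonal to \<open>fst p\<close> and has length
  \<open>1 / (2 * cmod (fst p))\<close>. Off the axis it is the planar velocity of the leaf through
  \<open>p\<close>.\<close>

definition leaf_velocity :: "heis \<Rightarrow> complex" where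
  "leaf_velocity p = - (\<i> * fst p / (2 * of_real (cmod (fst p) ^ 2)))"

lemma cmod_leaf_velocity: "cmod (leaf_velocity p) = 1 / (2 * cmod (fst p))"
  by (simp add: leaf_velocity_def norm_mult norm_divide power2_eq_square)

lemma horizontal_lift_leaf_velocity:
  assumes "fst p \<noteq> 0"
  shows "horizontal_lift p (leaf_velocity p) = (leaf_velocity p, 1)"
proof -
  have "cnj (fst p) * leaf_velocity p = - \<i> * (fst p * cnj (fst p)) / (2 * of_real (cmod (fst p) ^ 2))"
    by (simp add: leaf_velocity_def)
  also have "\<dots> = - \<i> / 2"
    unfolding complex_norm_square[symmetric] using assms by simp
  finally show ?thesis by (simp add: horizontal_lift_def)
qed

lemma Gamma0_curve_velocity:
  assumes "w \<noteq> 0"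
  shows "(Gamma0_curve w has_vector_derivative
    horizontal_lift (Gamma0_curve w s) (leaf_velocity (Gamma0_curve w s))) (at s)"
proof -
  have "fst (Gamma0_curve w s) \<noteq> 0" using assms by (simp add: Gamma0_curve_def)
  then show ?thesis
    using Gamma0_curve_has_vector_derivative[of w s]
    by (simp add: horizontal_lift_leaf_velocity) (simp add: leaf_velocity_def)
qed

lemma Gamma0_curve_in_cylinder [simp]: "Gamma0_curve w s \<in> cylinder r R \<longleftrightarrow> 0 < s \<and> s < r \<and> cmod w < sqrt R"
proof -
  have "p \<in> cylinder r R \<longleftrightarrow> 0 < snd p \<and> snd p < r \<and> cmod (fst p) < sqrt R" for p
    by (auto simp: cylinder_def)
  then show ?thesis by simp
qed

lemma continuous_on_Gamma0_curve: "continuous_on A (Gamma0_curve w)"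
  unfolding Gamma0_curve_cis divide_inverse by (intro continuous_intros)

lemma (in contact_C2) continuous_hderiv:
  assumes v: "continuous_on A v" and A: "A \<subseteq> \<Omega>"
  shows "continuous_on A (\<lambda>p. hderiv p (v p))"
proof -
  have "continuous_on A f'"
    using der2 has_derivative_continuous A by (intro continuous_at_imp_continuous_on) blast
  then show ?thesis
    unfolding hderiv_def horizontal_lift_def by (intro continuous_intros v)
qed

lemma (in contact_C2) continuous_Zf: "continuous_on \<Omega> (\<lambda>p. Zf p)" "continuous_on \<Omega> (\<lambda>p. Zbf p)"
proof -
  have "continuous_on \<Omega> (\<lambda>p. (hderiv p 1 - \<i> * hderiv p \<i>) / 2)" "continuous_on \<Omega> (\<lambda>p. (hderiv p 1 + \<i> * hderiv p \<i>) / 2)"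
    by (intro continuous_intros continuous_hderiv order_refl; simp)+
  then show "continuous_on \<Omega> (\<lambda>p. Zf p)" "continuous_on \<Omega> (\<lambda>p. Zbf p)"
    by (simp_all add: Zf_Zbf cong: continuous_on_cong)
qed

text \<open>The Beltrami equation gives the weak inequality only almost everywhere. The set where it
  fails is open and null, hence empty; equality is excluded because it would make the contact factor
  vanish.\<close>

lemma (in contact_C2) orientation_pos:
  assumes or: "orientation_preserving \<Omega> f" and p: "p \<in> \<Omega>"
  shows "cmod (Zbf p) < cmod (Zf p)"
proof -
  obtain \<mu> where m: "\<mu> \<in> borel_measurable (lebesgue_on \<Omega>)"
    and e: "esssup (lebesgue_on \<Omega>) (\<lambda>p. ereal (cmod (\<mu> p))) < 1"
    and ae: "AE p in lebesgue_on \<Omega>. Zbf p = \<mu> p * Zf p"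
    using or unfolding orientation_preserving_def by (auto simp: eventually_conj_iff)
  have "AE p in lebesgue_on \<Omega>. ereal (cmod (\<mu> p)) \<le> esssup (lebesgue_on \<Omega>) (\<lambda>p. ereal (cmod (\<mu> p)))"
    by (rule esssup_AE)
  with ae have "AE p in lebesgue_on \<Omega>. cmod (Zbf p) \<le> cmod (Zf p)"
  proof eventually_elim
    case (elim p)
    then have "ereal (cmod (\<mu> p)) < 1" using e by order
    then have "cmod (\<mu> p) \<le> 1" by (simp add: one_ereal_def)
    then show ?case
      using elim by (simp add: norm_mult mult_left_le_one_le)
  qed
  then have ae': "AE p in lebesgue. p \<in> \<Omega> \<longrightarrow> cmod (Zbf p) \<le> cmod (Zf p)"
    by (subst (asm) AE_restrict_space_iff) (use open_dom in auto)
  let ?U = "\<Omega> \<inter> (\<lambda>p. cmod (Zbf p) - cmod (Zf p)) -` {0<..}"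
  have oU: "open ?U"
    by (intro continuous_open_preimage open_dom open_greaterThan continuous_intros continuous_Zf)
  have "AE p in lebesgue. p \<notin> ?U"
    using ae' by eventually_elim auto
  then have "?U \<in> null_sets lebesgue"
    using oU by (subst (asm) AE_iff_null_sets[symmetric]) auto
  then have "negligible ?U"
    by (simp add: negligible_iff_null_sets)
  with open_not_negligible[OF oU] have "?U = {}" by auto
  with p have "cmod (Zbf p) \<le> cmod (Zf p)" by force
  moreover have "cmod (Zbf p) \<noteq> cmod (Zf p)"
    using contact_factor_eq[OF p] factor_nonzero[OF p] by auto
  ultimately show ?thesis by simp
qed

section \<open>The extremal map and the heights along its image leaves\<close>

locale extremal_map = contact_C2 "cylinder a b" f f' f'' l
  for a b :: real and f f' f'' l +
  fixes a' b' :: real and g F :: "heis \<Rightarrow> heis"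
  assumes pos: "0 < a" "0 < b" "0 < a'" "0 < b'"
    and homeo: "homeomorphism (cylinder a b) (cylinder a' b') f g"
    and orient: "orientation_preserving (cylinder a b) f"
    and F_cont: "continuous_on (closure (cylinder a b)) F"
    and F_eq: "\<And>p. p \<in> cylinder a b \<Longrightarrow> F p = f p"
    and F_bottom: "\<And>p. p \<in> bottom_disc a b \<Longrightarrow> F p \<in> bottom_disc a' b'"
    and F_top: "\<And>p. p \<in> top_disc a b \<Longrightarrow> F p \<in> top_disc a' b'"
    and F_lateral: "\<And>p. p \<in> lateral_face a b \<Longrightarrow> F p \<in> lateral_face a' b'"
    and extremal: "modulus (cylinder a' b') (image_curves f (Gamma0 a b)) =
      (\<integral>\<^sup>+p\<in>cylinder a b. ennreal (distortion f p ^ 2 * rho0 a p ^ 4) \<partial>lborel)"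
begin

definition D :: "heis \<Rightarrow> real" where
  "D p = cmod (Zf p) - cmod (Zbf p)"

definition leaf_deriv :: "heis \<Rightarrow> complex" where
  "leaf_deriv p = hderiv p (leaf_velocity p)"

definition height_deriv :: "heis \<Rightarrow> real" where
  "height_deriv p = - 2 * Im (cnj (fst (f p)) * leaf_deriv p)"

text \<open>Division by the smallest stretch \<open>D\<close> ensures that the length of the image
  of a horizontal vector, weighted with this density, is at least the \<open>rho0 a\<close>-weighted
  length of the vector itself.\<close>

definition image_density :: "heis \<Rightarrow> real" where
  "image_density q = rho0 a (g q) / D (g q)"

lemma D_pos: "p \<in> cylinder a b \<Longrightarrow> 0 < D p"
  using orientation_pos[OF orient] by (simp add: D_def)

lemma f_in: "p \<in> cylinder a b \<Longrightarrow> f p \<in> cylinder a' b'"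
  and g_in: "q \<in> cylinder a' b' \<Longrightarrow> g q \<in> cylinder a b"
  and g_f: "p \<in> cylinder a b \<Longrightarrow> g (f p) = p"
  and f_g: "q \<in> cylinder a' b' \<Longrightarrow> f (g q) = q"
  and image_f: "f ` cylinder a b = cylinder a' b'"
  and cont_f: "continuous_on (cylinder a b) f" and cont_g: "continuous_on (cylinder a' b') g"
  using homeo by (auto simp: homeomorphism_def)

lemma inj_f: "inj_on f (cylinder a b)"
  by (metis g_f inj_onI)

lemma cont_D: "continuous_on (cylinder a b) D"
  unfolding D_def by (intro continuous_intros continuous_Zf)

lemma cont_image_density: "continuous_on (cylinder a' b') image_density"
proof -
  have "D (g q) \<noteq> 0" if "q \<in> cylinder a' b'" for q
    using D_pos[OF g_in[OF that]] by simp
  then show ?thesis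
    unfolding image_density_def rho0_def
    by (intro continuous_intros cont_g continuous_on_compose2[OF cont_D cont_g])
      (use pos g_in in auto)
qed

lemma image_density_nonneg: "q \<in> cylinder a' b' \<Longrightarrow> 0 \<le> image_density q"
  using D_pos[OF g_in] pos by (simp add: image_density_def rho0_def less_imp_le)

lemma cont_leaf_deriv: "continuous_on (cylinder a b \<inter> {p. fst p \<noteq> 0}) leaf_deriv"
  unfolding leaf_deriv_def leaf_velocity_def
  by (intro continuous_hderiv continuous_intros) auto

lemma cont_height_deriv: "continuous_on (cylinder a b \<inter> {p. fst p \<noteq> 0}) height_deriv"
  unfolding height_deriv_def
  by (intro continuous_intros cont_leaf_deriv continuous_on_subset[OF cont_f]) auto

lemma curve_deriv:
  assumes p: "p \<in> cylinder a b" "\<gamma> s = p" and \<gamma>: "(\<gamma> has_vector_derivative horizontal_lift p v) (at s)"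
  shows "((\<lambda>s. f (\<gamma> s)) has_vector_derivative (hderiv p v, - 2 * Im (cnj (fst (f p)) * hderiv p v))) (at s)"
proof -
  have "f' p (horizontal_lift p v) = (hderiv p v, - 2 * Im (cnj (fst (f p)) * hderiv p v))"
    using snd_horizontal[OF p(1), of v] by (simp add: prod_eq_iff hderiv_def)
  moreover have "((\<lambda>s. f (\<gamma> s)) has_derivative (\<lambda>h. f' p (h *\<^sub>R horizontal_lift p v))) (at s)"
    using \<gamma> unfolding has_vector_derivative_def
    by (rule has_derivative_compose) (use der[OF p(1)] p(2) in simp)
  ultimately show ?thesis
    unfolding has_vector_derivative_def by (simp add: blinfun.scaleR_right)
qed

lemma leaf_image_deriv:
  assumes "w \<noteq> 0" "cmod w < sqrt b" "0 < s" "s < a"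
  shows "((\<lambda>s. f (Gamma0_curve w s)) has_vector_derivative
     (leaf_deriv (Gamma0_curve w s), height_deriv (Gamma0_curve w s))) (at s)"
  unfolding leaf_deriv_def height_deriv_def
  by (rule curve_deriv[OF _ refl Gamma0_curve_velocity]) (use assms in auto)

lemma leaf_height_deriv:
  assumes "w \<noteq> 0" "cmod w < sqrt b" "0 < s" "s < a"
  shows "((\<lambda>s. snd (f (Gamma0_curve w s))) has_real_derivative height_deriv (Gamma0_curve w s)) (at s)"
  using has_derivative_snd[OF leaf_image_deriv[OF assms, unfolded has_vector_derivative_def]]
  by (simp add: has_field_derivative_def mult.commute[of _ "height_deriv _"])

lemma leaf_deriv_lower:
  assumes "p \<in> cylinder a b"
  shows "D p / (2 * cmod (fst p)) \<le> cmod (leaf_deriv p)"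
  using hderiv_lower[OF assms, of "leaf_velocity p"] by (simp add: leaf_deriv_def D_def cmod_leaf_velocity)

lemma height_deriv_bound: "\<bar>height_deriv p\<bar> \<le> 2 * cmod (fst (f p)) * cmod (leaf_deriv p)"
  using abs_Im_le_cmod[of "cnj (fst (f p)) * leaf_deriv p"] by (simp add: height_deriv_def abs_mult norm_mult)

lemma closure_eq: "closure (cylinder a b) = {p. 0 \<le> snd p \<and> snd p \<le> a \<and> cmod (fst p) \<le> sqrt b}"
  using closure_cylinder pos by simp

lemma F_leaf_limits:
  assumes w: "cmod w \<le> sqrt b"
  shows "((\<lambda>s. F (Gamma0_curve w s)) \<longlongrightarrow> F (Gamma0_curve w 0)) (at_right 0)"
    "((\<lambda>s. F (Gamma0_curve w s)) \<longlongrightarrow> F (Gamma0_curve w a)) (at_left a)"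
proof -
  have "continuous_on {0..a} (\<lambda>s. F (Gamma0_curve w s))"
    by (rule continuous_on_compose2[OF F_cont continuous_on_Gamma0_curve]) (use w in \<open>auto simp: closure_eq\<close>)
  with pos show "((\<lambda>s. F (Gamma0_curve w s)) \<longlongrightarrow> F (Gamma0_curve w 0)) (at_right 0)"
    "((\<lambda>s. F (Gamma0_curve w s)) \<longlongrightarrow> F (Gamma0_curve w a)) (at_left a)"
    using continuous_on_Icc_at_rightD continuous_on_Icc_at_leftD by blast+
qed

lemma height_leaf_limits:
  assumes w: "cmod w < sqrt b"
  shows "((\<lambda>s. snd (f (Gamma0_curve w s))) \<longlongrightarrow> 0) (at_right 0)"
    "((\<lambda>s. snd (f (Gamma0_curve w s))) \<longlongrightarrow> a') (at_left a)"
proof -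
  have "Gamma0_curve w 0 \<in> bottom_disc a b" "Gamma0_curve w a \<in> top_disc a b"
    using w by (auto simp: bottom_disc_def top_disc_def Gamma0_curve_cis norm_mult)
  from F_bottom[OF this(1)] F_top[OF this(2)]
  have e: "snd (F (Gamma0_curve w 0)) = 0" "snd (F (Gamma0_curve w a)) = a'"
    by (auto simp: bottom_disc_def top_disc_def)
  have "eventually (\<lambda>s. snd (F (Gamma0_curve w s)) = snd (f (Gamma0_curve w s))) (at_right 0)"
    using eventually_at_right_real[OF pos(1)] by eventually_elim (use w in \<open>simp add: F_eq\<close>)
  moreover have "((\<lambda>s. snd (F (Gamma0_curve w s))) \<longlongrightarrow> 0) (at_right 0)"
    using tendsto_snd[OF F_leaf_limits(1)[OF less_imp_le[OF w]]] by (simp add: e)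
  ultimately
  show "((\<lambda>s. snd (f (Gamma0_curve w s))) \<longlongrightarrow> 0) (at_right 0)"
    by (rule tendsto_cong[THEN iffD1])
  have "eventually (\<lambda>s. snd (F (Gamma0_curve w s)) = snd (f (Gamma0_curve w s))) (at_left a)"
    using eventually_at_left_real[OF pos(1)] by eventually_elim (use w in \<open>simp add: F_eq\<close>)
  moreover have "((\<lambda>s. snd (F (Gamma0_curve w s))) \<longlongrightarrow> a') (at_left a)"
    using tendsto_snd[OF F_leaf_limits(2)[OF less_imp_le[OF w]]] by (simp add: e)
  ultimately
  show "((\<lambda>s. snd (f (Gamma0_curve w s))) \<longlongrightarrow> a') (at_left a)"
    by (rule tendsto_cong[THEN iffD1])
qed

lemma continuous_on_leaf_compose:
  assumes h: "continuous_on (cylinder a b \<inter> {p. fst p \<noteq> 0}) h" and w: "w \<noteq> 0" "cmod w < sqrt b"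
  shows "continuous_on {0<..<a} (\<lambda>s. h (Gamma0_curve w s))"
proof -
  have "fst (Gamma0_curve w s) \<noteq> 0" for s using w cmod_Gamma0_curve[of w s] by fastforce
  with w show ?thesis
    by (intro continuous_on_compose2[OF h continuous_on_Gamma0_curve]) auto
qed

text \<open>Along a leaf the second component of \<open>f\<close> rises from 0 to \<open>a'\<close>.
  The positive part is taken because monotonicity is not yet known and the integrand must be
  nonnegative.\<close>

lemma height_increment:
  assumes w: "w \<noteq> 0" "cmod w < sqrt b"
  shows "1 \<le> (\<integral>\<^sup>+s\<in>{0<..<a}. ennreal (max 0 (height_deriv (Gamma0_curve w s)) / a') \<partial>lborel)"
proof -
  have "ennreal (a' / a' - 0 / a') \<le> (\<integral>\<^sup>+s\<in>{0<..<a}. ennreal (max 0 (height_deriv (Gamma0_curve w s)) / a') \<partial>lborel)"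
  proof (rule nn_integral_ge_increment)
    show "((\<lambda>s. snd (f (Gamma0_curve w s)) / a') has_real_derivative height_deriv (Gamma0_curve w s) / a') (at s)"
      if "0 < s" "s < a" for s
      using DERIV_cdivide[OF leaf_height_deriv[OF w that]] .
    show "continuous_on {0<..<a} (\<lambda>s. max 0 (height_deriv (Gamma0_curve w s)) / a')"
      by (intro continuous_intros continuous_on_leaf_compose[OF cont_height_deriv w]) (use pos in auto)
    show "((\<lambda>s. snd (f (Gamma0_curve w s)) / a') \<longlongrightarrow> 0 / a') (at_right 0)"
      "((\<lambda>s. snd (f (Gamma0_curve w s)) / a') \<longlongrightarrow> a' / a') (at_left a)"
      by (intro tendsto_intros height_leaf_limits w; use pos in simp)+
  qed (use pos in \<open>auto intro!: divide_right_mono\<close>)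
  with pos show ?thesis by simp
qed

section \<open>Upper bounds for the modulus and the energy of the image density\<close>

lemma modulus_le:
  assumes m: "(\<lambda>q. ennreal (\<sigma> q)) \<in> borel_measurable (restrict_space borel (cylinder a' b'))"
    and nn: "\<And>q. 0 \<le> \<sigma> q"
    and adm: "\<And>w. w \<noteq> 0 \<Longrightarrow> cmod w < sqrt b \<Longrightarrow>
      1 \<le> (\<integral>\<^sup>+s\<in>{0<..<a}. ennreal (\<sigma> (f (Gamma0_curve w s)) * cmod (leaf_deriv (Gamma0_curve w s))) \<partial>lborel)"
  shows "modulus (cylinder a' b') (image_curves f (Gamma0 a b)) \<le> (\<integral>\<^sup>+q\<in>cylinder a' b'. ennreal (\<sigma> q ^ 4) \<partial>lborel)"
proof -
  have "1 \<le> (\<integral>\<^sup>+s\<in>{0<..<a}. ennreal (\<sigma> ((f \<circ> Gamma0_curve w) s)) *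
      ennreal (cmod (fst (vector_derivative (f \<circ> Gamma0_curve w) (at s)))) \<partial>lborel)"
    if "0 < cmod w" "cmod w < sqrt b" for w
  proof -
    have w: "w \<noteq> 0" using that by auto
    have "(\<integral>\<^sup>+s\<in>{0<..<a}. ennreal (\<sigma> ((f \<circ> Gamma0_curve w) s)) *
        ennreal (cmod (fst (vector_derivative (f \<circ> Gamma0_curve w) (at s)))) \<partial>lborel) =
      (\<integral>\<^sup>+s\<in>{0<..<a}. ennreal (\<sigma> (f (Gamma0_curve w s)) * cmod (leaf_deriv (Gamma0_curve w s))) \<partial>lborel)"
    proof (rule nn_integral_cong)
      fix s
      show "ennreal (\<sigma> ((f \<circ> Gamma0_curve w) s)) *
        ennreal (cmod (fst (vector_derivative (f \<circ> Gamma0_curve w) (at s)))) * indicator {0<..<a} s =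
        ennreal (\<sigma> (f (Gamma0_curve w s)) * cmod (leaf_deriv (Gamma0_curve w s))) * indicator {0<..<a} s"
      proof (cases "0 < s \<and> s < a")
        case True
        then have "vector_derivative (f \<circ> Gamma0_curve w) (at s) =
            (leaf_deriv (Gamma0_curve w s), height_deriv (Gamma0_curve w s))"
          using leaf_image_deriv[OF w that(2)] by (auto intro!: vector_derivative_at simp: o_def)
        with nn show ?thesis by (simp add: ennreal_mult)
      qed auto
    qed
    with adm[OF w that(2)] show ?thesis by simp
  qed
  then have "(\<lambda>q. ennreal (\<sigma> q)) \<in> admissible (cylinder a' b') (image_curves f (Gamma0 a b))"
    using m by (auto simp: admissible_def image_curves_def Gamma0_def)
  then show ?thesis
    unfolding modulus_def by (rule INF_lower2) (simp add: ennreal_power nn)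
qed

lemma distortion_eq: "distortion f p = (cmod (Zf p) + cmod (Zbf p)) / D p"
  by (simp add: distortion_def D_def)

text \<open>The contact factor is the distortion times \<open>D^2\<close>, so the Jacobian divided
  by \<open>D^4\<close> is exactly the square of the distortion. The integrand of the hypothesis
  \<open>extremal\<close> appears after the change of variables.\<close>

lemma image_energy:
  "(\<integral>\<^sup>+q\<in>cylinder a' b'. ennreal (image_density q ^ 4) \<partial>lborel) =
    modulus (cylinder a' b') (image_curves f (Gamma0 a b))"
proof -
  have "(\<integral>\<^sup>+q\<in>f ` cylinder a b. ennreal (image_density q ^ 4) \<partial>lborel) =
    (\<integral>\<^sup>+p\<in>cylinder a b. ennreal (\<bar>heis_det (f' p)\<bar> * image_density (f p) ^ 4) \<partial>lborel)"
  proof (rule heis_nn_integral_change_of_variables[OF open_cylinder der inj_f])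
    have "continuous_on (cylinder a b) (\<lambda>p. ((cmod (Zf p))\<^sup>2 - (cmod (Zbf p))\<^sup>2)\<^sup>2)"
      by (intro continuous_intros continuous_Zf)
    then show "continuous_on (cylinder a b) (\<lambda>p. heis_det (f' p))"
      by (rule continuous_on_eq) (simp add: heis_det_eq contact_factor_eq)
    show "continuous_on (f ` cylinder a b) (\<lambda>q. image_density q ^ 4)"
      unfolding image_f by (intro continuous_intros cont_image_density)
  qed auto
  also have "\<dots> = (\<integral>\<^sup>+p\<in>cylinder a b. ennreal (distortion f p ^ 2 * rho0 a p ^ 4) \<partial>lborel)"
  proof (rule nn_integral_cong)
    fix p
    show "ennreal (\<bar>heis_det (f' p)\<bar> * image_density (f p) ^ 4) * indicator (cylinder a b) p =
      ennreal (distortion f p ^ 2 * rho0 a p ^ 4) * indicator (cylinder a b) p"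
    proof (cases "p \<in> cylinder a b")
      case True
      have "l p = (cmod (Zf p) + cmod (Zbf p)) * D p"
        unfolding contact_factor_eq[OF True] D_def by (simp add: power2_eq_square algebra_simps)
      then have "\<bar>heis_det (f' p)\<bar> * image_density (f p) ^ 4 = distortion f p ^ 2 * rho0 a p ^ 4"
        unfolding heis_det_eq[OF True] image_density_def g_f[OF True] distortion_eq
        using D_pos[OF True] by (simp add: field_simps power2_eq_square power4_eq_xxxx)
      then show ?thesis by simp
    qed simp
  qed
  finally show ?thesis by (simp add: image_f extremal)
qed

lemma rho0_nonneg: "0 < r \<Longrightarrow> 0 \<le> rho0 r q"
  by (simp add: rho0_def)

lemma cont_rho0: "0 < r \<Longrightarrow> continuous_on A (rho0 r)"
  unfolding rho0_def by (intro continuous_intros) auto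

lemma height_deriv_le:
  "max 0 (height_deriv p) / a' \<le> rho0 a' (f p) * cmod (leaf_deriv p)"
proof -
  have "max 0 (height_deriv p) \<le> 2 * cmod (fst (f p)) * cmod (leaf_deriv p)"
    using height_deriv_bound[of p] by simp
  from divide_right_mono[OF this, of a'] pos show ?thesis by (simp add: rho0_def)
qed

text \<open>The height gained along an image leaf is at most twice \<open>cmod (fst (f p))\<close>
  times the planar speed, so the total climb \<open>a'\<close> forces a
  \<open>rho0 a'\<close>-length of at least 1.\<close>

lemma modulus_le_rho0:
  "modulus (cylinder a' b') (image_curves f (Gamma0 a b)) \<le> (\<integral>\<^sup>+q\<in>cylinder a' b'. ennreal (rho0 a' q ^ 4) \<partial>lborel)"
proof (rule modulus_le)
  have "rho0 a' \<in> borel_measurable borel"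
    using pos by (intro borel_measurable_continuous_onI cont_rho0)
  then show "(\<lambda>q. ennreal (rho0 a' q)) \<in> borel_measurable (restrict_space borel (cylinder a' b'))"
    by (intro measurable_restrict_space1) simp
  show "1 \<le> (\<integral>\<^sup>+s\<in>{0<..<a}. ennreal (rho0 a' (f (Gamma0_curve w s)) * cmod (leaf_deriv (Gamma0_curve w s))) \<partial>lborel)"
    if "w \<noteq> 0" "cmod w < sqrt b" for w
    by (rule order_trans[OF height_increment[OF that]], intro nn_integral_mono mult_right_mono ennreal_leI height_deriv_le) auto
qed (use pos rho0_nonneg in auto)

lemma rho0_energy_finite: "(\<integral>\<^sup>+q\<in>cylinder a' b'. ennreal (rho0 a' q ^ 4) \<partial>lborel) < \<infinity>"
proof -
  have "(\<integral>\<^sup>+q\<in>cylinder a' b'. ennreal (rho0 a' q ^ 4) \<partial>lborel) \<le>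
     (\<integral>\<^sup>+q. ennreal ((2 * sqrt b' / a') ^ 4) * indicator (cylinder a' b') q \<partial>lborel)"
    using pos by (intro nn_integral_mono)
      (auto simp: indicator_def rho0_def cylinder_def intro!: ennreal_leI power_mono divide_right_mono)
  also have "\<dots> = ennreal ((2 * sqrt b' / a') ^ 4) * emeasure lborel (cylinder a' b')"
    by (rule nn_integral_cmult_indicator) (simp add: open_cylinder)
  also have "\<dots> < \<infinity>"
  proof -
    have "bounded (cylinder a' b')"
      unfolding cylinder_eq by (intro bounded_Times) auto
    then have "emeasure lborel (cylinder a' b') < \<infinity>"
      by (rule emeasure_bounded_finite)
    then show ?thesis
      by (simp add: ennreal_mult_less_top)
  qed
  finally show ?thesis .
qed

section \<open>The image density along the leaves of the image cylinder\<close>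

lemma g_deriv:
  assumes q: "q \<in> cylinder a' b'"
  obtains g' where "(g has_derivative g') (at q)" "\<And>v. f' (g q) (g' v) = v"
proof -
  have p: "g q \<in> cylinder a b" using g_in q by auto
  have lin: "linear (f' (g q))"
    by (simp add: blinfun.bounded_linear_right bounded_linear.linear)
  \<comment> \<open>A vector in the kernel is horizontal, since the contact factor does not vanish,
    and a horizontal vector is stretched by at least \<open>D > 0\<close>. Injectivity in finite
    dimension then allows the inverse function theorem.\<close>
  have "v = 0" if v: "f' (g q) v = 0" for v
  proof -
    have "contact_form (g q) v = 0"
      using contact[OF p, of v] factor_nonzero[OF p] v by (simp add: contact_form_def)
    then have h: "v = horizontal_lift (g q) (fst v)"
      unfolding contact_form_real of_real_eq_0_iff by (simp add: horizontal_lift_def prod_eq_iff)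
    then have "hderiv (g q) (fst v) = 0"
      using v by (metis hderiv_def fst_zero)
    then have "D (g q) * cmod (fst v) \<le> 0"
      using hderiv_lower[OF p, of "fst v"] by (simp add: D_def)
    then have "fst v = 0"
      using D_pos[OF p] by (simp add: mult_le_0_iff)
    then show "v = 0"
      using h by (simp add: horizontal_lift_def prod_eq_iff)
  qed
  then have "inj (f' (g q))"
    using linear_injective_0[OF lin] by blast
  then obtain g' where g': "linear g'" "\<forall>x. g' (f' (g q) x) = x" "\<forall>x. f' (g q) (g' x) = x"
    using linear_injective_isomorphism[OF lin] by blast
  have "(g has_derivative g') (at (f (g q)))"
    by (rule has_derivative_inverse_strong[OF open_cylinder p cont_f g_f der[OF p]])
      (use g' in \<open>auto simp: fun_eq_iff\<close>)
  moreover have "f' (g q) (g' v) = v" for v using g'(3) by blast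
  ultimately show ?thesis
    by (intro that[of g']) (simp_all add: f_g[OF q])
qed

text \<open>The preimage of a leaf is again horizontal. Its planar speed is at most
  \<open>1 / (2 * cmod w)\<close> divided by \<open>D\<close>, and the height changes at most at
  rate twice the distance to the axis times this speed.\<close>

lemma leaf_preimage_deriv:
  assumes w: "w \<noteq> 0" "cmod w < sqrt b'" and s: "0 < s" "s < a'"
  shows "\<exists>y'. ((\<lambda>s. snd (g (Gamma0_curve w s))) has_real_derivative y') (at s) \<and>
    y' \<le> a * image_density (Gamma0_curve w s) / (2 * cmod w)"
proof -
  define q where "q = Gamma0_curve w s"
  define p where "p = g q"
  have q: "q \<in> cylinder a' b'" using assms by (simp add: q_def)
  have p: "p \<in> cylinder a b" using g_in q by (simp add: p_def)
  obtain g' where g': "(g has_derivative g') (at q)" and f'g': "\<And>v. f' p (g' v) = v"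
    using g_deriv[OF q] unfolding p_def by blast
  define u where "u = g' (horizontal_lift q (leaf_velocity q))"
  have fu: "f' p u = horizontal_lift q (leaf_velocity q)" by (simp add: u_def f'g')
  have "contact_form p u = 0"
    using contact[OF p, of u] factor_nonzero[OF p] f_g[OF q] by (simp add: fu p_def[symmetric])
  then have u: "u = horizontal_lift p (fst u)"
    unfolding contact_form_real of_real_eq_0_iff by (simp add: horizontal_lift_def prod_eq_iff)
  have "hderiv p (fst u) = leaf_velocity q"
    unfolding hderiv_def u[symmetric] fu by simp
  then have b: "D p * cmod (fst u) \<le> 1 / (2 * cmod w)"
    using hderiv_lower[OF p, of "fst u"] by (simp add: D_def cmod_leaf_velocity q_def)
  have "((\<lambda>s. g (Gamma0_curve w s)) has_derivative (\<lambda>h. g' (h *\<^sub>R horizontal_lift q (leaf_velocity q)))) (at s)"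
    using Gamma0_curve_velocity[OF w(1), of s] unfolding has_vector_derivative_def q_def[symmetric]
    by (rule has_derivative_compose) (use g' in \<open>simp add: q_def\<close>)
  then have "((\<lambda>s. g (Gamma0_curve w s)) has_derivative (\<lambda>h. h *\<^sub>R u)) (at s)"
    using linear_scale[OF has_derivative_linear[OF g']] by (simp add: u_def)
  then have d: "((\<lambda>s. snd (g (Gamma0_curve w s))) has_real_derivative snd u) (at s)"
    using has_derivative_snd by (fastforce simp add: has_field_derivative_def mult.commute[of _ "snd u"])
  have "snd u = - 2 * Im (cnj (fst p) * fst u)"
    by (subst u) (simp add: horizontal_lift_def)
  also have "\<dots> \<le> 2 * (cmod (fst p) * cmod (fst u))"
    using abs_Im_le_cmod[of "cnj (fst p) * fst u"] by (simp add: norm_mult)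
  also have "\<dots> \<le> 2 * (cmod (fst p) * (1 / (2 * cmod w * D p)))"
    using b D_pos[OF p] w by (intro mult_left_mono) (auto simp: field_simps)
  also have "\<dots> = a * image_density q / (2 * cmod w)"
    using pos by (simp add: image_density_def p_def[symmetric] rho0_def)
  finally show ?thesis using d by (auto simp: q_def)
qed

lemma closure_cases:
  assumes "p \<in> closure (cylinder a b)"
  obtains "p \<in> cylinder a b" | "p \<in> bottom_disc a b" | "p \<in> top_disc a b" | "p \<in> lateral_face a b"
  using assms unfolding closure_eq
  by (cases p) (force simp: cylinder_def bottom_disc_def top_disc_def lateral_face_def)

text \<open>If the heights of the preimages of points approaching the interior of one end disc did not
  approach the height of that disc, these preimages would accumulate at a point of the closed
  cylinder which \<open>F\<close> does not send to that disc.\<close>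

lemma eventually_preimage_height:
  assumes K: "closed K" "K \<subseteq> closure (cylinder a b)" and lim: "(\<gamma> \<longlongrightarrow> q) net"
    and ev: "eventually (\<lambda>s. \<gamma> s \<in> cylinder a' b') net" and q: "q \<notin> F ` K"
  shows "eventually (\<lambda>s. g (\<gamma> s) \<notin> K) net"
proof -
  have "bounded (cylinder a b)"
    unfolding cylinder_eq by (intro bounded_Times) auto
  then have "compact K"
    using K by (meson bounded_closure bounded_subset compact_eq_bounded_closed)
  then have "closed (F ` K)"
    using K F_cont by (meson compact_continuous_image compact_imp_closed continuous_on_subset)
  then have "eventually (\<lambda>s. \<gamma> s \<in> - F ` K) net"
    using lim q by (intro topological_tendstoD) auto
  with ev show ?thesis
  proof eventually_elim
    case (elim s)
    then have "F (g (\<gamma> s)) = \<gamma> s"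
      using F_eq g_in f_g by simp
    with elim show ?case by (metis ComplD imageI)
  qed
qed

lemma g_height: "q \<in> cylinder a' b' \<Longrightarrow> 0 < snd (g q) \<and> snd (g q) < a"
  using g_in[of q] by (auto simp: cylinder_def)

lemma preimage_height_limits:
  assumes w: "cmod w < sqrt b'"
  shows "((\<lambda>s. snd (g (Gamma0_curve w s))) \<longlongrightarrow> 0) (at_right 0)"
    "((\<lambda>s. snd (g (Gamma0_curve w s))) \<longlongrightarrow> a) (at_left a')"
proof -
  have cont: "continuous_on {0..a'} (Gamma0_curve w)" by (rule continuous_on_Gamma0_curve)
  \<comment> \<open>A point of an end disc of the image with \<open>cmod w < sqrt b'\<close>
    therefore has its \<open>F\<close>-preimages only in the two end discs. The disc conditions
    \<open>F_top\<close> and \<open>F_bottom\<close> then exclude the opposite one.\<close>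
  have F_snd: "0 < snd (F p) \<and> snd (F p) < a' \<or> cmod (fst (F p)) = sqrt b' \<or> p \<in> bottom_disc a b \<or> p \<in> top_disc a b"
    if "p \<in> closure (cylinder a b)" for p
    using that
  proof (cases rule: closure_cases)
    case 1 then show ?thesis using f_in[OF 1] F_eq[OF 1] by (auto simp: cylinder_def)
  next
    case 4 then show ?thesis using F_lateral[OF 4] by (auto simp: lateral_face_def)
  qed auto
  have lim: "(Gamma0_curve w \<longlongrightarrow> Gamma0_curve w 0) (at_right 0)" "(Gamma0_curve w \<longlongrightarrow> Gamma0_curve w a') (at_left a')"
    using cont pos continuous_on_Icc_at_rightD continuous_on_Icc_at_leftD by blast+
  have ev0: "eventually (\<lambda>s. Gamma0_curve w s \<in> cylinder a' b') (at_right 0)"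
    using eventually_at_right_real[OF pos(3)] by eventually_elim (use w in simp)
  have ev1: "eventually (\<lambda>s. Gamma0_curve w s \<in> cylinder a' b') (at_left a')"
    using eventually_at_left_real[OF pos(3)] by eventually_elim (use w in simp)
  have cl: "closed {p \<in> closure (cylinder a b). e \<le> snd p}" "closed {p \<in> closure (cylinder a b). snd p \<le> e}" for e
    by (auto simp: Collect_conj_eq intro!: closed_Int closed_Collect_le continuous_intros)
  show "((\<lambda>s. snd (g (Gamma0_curve w s))) \<longlongrightarrow> 0) (at_right 0)"
  proof (rule order_tendstoI)
    fix e :: real assume "e < 0"
    from ev0 show "eventually (\<lambda>s. e < snd (g (Gamma0_curve w s))) (at_right 0)"
    proof eventually_elim
      case (elim s)
      with g_height[OF elim] \<open>e < 0\<close> show ?case by simp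
    qed
  next
    fix e :: real assume e: "0 < e"
    have "Gamma0_curve w 0 \<notin> F ` {p \<in> closure (cylinder a b). e \<le> snd p}"
    proof
      assume "Gamma0_curve w 0 \<in> F ` {p \<in> closure (cylinder a b). e \<le> snd p}"
      then obtain p where p: "p \<in> closure (cylinder a b)" "e \<le> snd p" "F p = Gamma0_curve w 0" by force
      with e w F_snd[OF p(1)] have "p \<in> top_disc a b" by (auto simp: bottom_disc_def)
      with F_top[of p] p(3) pos show False by (auto simp: top_disc_def dest: arg_cong[where f=snd])
    qed
    from eventually_preimage_height[OF cl(1) Collect_restrict lim(1) ev0 this] ev0
    show "eventually (\<lambda>s. snd (g (Gamma0_curve w s)) < e) (at_right 0)"
    proof eventually_elim
      case (elim s)
      with subsetD[OF closure_subset g_in[OF elim(2)]] show ?case by auto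
    qed
  qed
  show "((\<lambda>s. snd (g (Gamma0_curve w s))) \<longlongrightarrow> a) (at_left a')"
  proof (rule order_tendstoI)
    fix e :: real assume "a < e"
    from ev1 show "eventually (\<lambda>s. snd (g (Gamma0_curve w s)) < e) (at_left a')"
    proof eventually_elim
      case (elim s)
      with g_height[OF elim] \<open>a < e\<close> show ?case by simp
    qed
  next
    fix e :: real assume e: "e < a"
    have "Gamma0_curve w a' \<notin> F ` {p \<in> closure (cylinder a b). snd p \<le> e}"
    proof
      assume "Gamma0_curve w a' \<in> F ` {p \<in> closure (cylinder a b). snd p \<le> e}"
      then obtain p where p: "p \<in> closure (cylinder a b)" "snd p \<le> e" "F p = Gamma0_curve w a'" by force
      with e w F_snd[OF p(1)] have "p \<in> bottom_disc a b" by (auto simp: top_disc_def)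
      with F_bottom[of p] p(3) pos show False by (auto simp: bottom_disc_def dest: arg_cong[where f=snd])
    qed
    from eventually_preimage_height[OF cl(2) Collect_restrict lim(2) ev1 this] ev1
    show "eventually (\<lambda>s. e < snd (g (Gamma0_curve w s))) (at_left a')"
    proof eventually_elim
      case (elim s)
      with subsetD[OF closure_subset g_in[OF elim(2)]] show ?case by auto
    qed
  qed
qed

text \<open>The preimage of the leaf climbs from height 0 to height \<open>a\<close>; the rate bound
  of \<open>leaf_preimage_deriv\<close>, multiplied by \<open>2 * cmod w / a\<close>, is integrated
  over the leaf.\<close>

lemma leaf_image_density:
  assumes w: "w \<noteq> 0" "cmod w < sqrt b'"
  shows "ennreal (2 * cmod w) \<le> (\<integral>\<^sup>+s\<in>{0<..<a'}. ennreal (image_density (Gamma0_curve w s)) \<partial>lborel)"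
proof -
  have "\<forall>s\<in>{0<..<a'}. \<exists>y'. ((\<lambda>s. snd (g (Gamma0_curve w s))) has_real_derivative y') (at s) \<and>
    y' \<le> a * image_density (Gamma0_curve w s) / (2 * cmod w)"
    using leaf_preimage_deriv[OF w] by simp
  then obtain y' where y'': "\<forall>s\<in>{0<..<a'}. ((\<lambda>s. snd (g (Gamma0_curve w s))) has_real_derivative y' s) (at s) \<and>
    y' s \<le> a * image_density (Gamma0_curve w s) / (2 * cmod w)"
    by (rule bchoice[THEN exE])
  then have y': "\<And>s. 0 < s \<Longrightarrow> s < a' \<Longrightarrow> ((\<lambda>s. snd (g (Gamma0_curve w s))) has_real_derivative y' s) (at s)"
    "\<And>s. 0 < s \<Longrightarrow> s < a' \<Longrightarrow> y' s \<le> a * image_density (Gamma0_curve w s) / (2 * cmod w)"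
    by simp_all
  have k: "0 < 2 * cmod w / a" using w pos by simp
  have "ennreal (2 * cmod w / a * a - 2 * cmod w / a * 0) \<le> (\<integral>\<^sup>+s\<in>{0<..<a'}. ennreal (image_density (Gamma0_curve w s)) \<partial>lborel)"
  proof (rule nn_integral_ge_increment)
    show "((\<lambda>s. 2 * cmod w / a * snd (g (Gamma0_curve w s))) has_real_derivative 2 * cmod w / a * y' s) (at s)"
      if "0 < s" "s < a'" for s
      by (rule DERIV_cmult[OF y'(1)[OF that]])
    show "2 * cmod w / a * y' s \<le> image_density (Gamma0_curve w s)" if "0 < s" "s < a'" for s
      using mult_left_mono[OF y'(2)[OF that], of "2 * cmod w / a"] w pos by simp
    show "0 \<le> image_density (Gamma0_curve w s)" if "0 < s" "s < a'" for s
      by (rule image_density_nonneg) (use that w in simp)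
    show "continuous_on {0<..<a'} (\<lambda>s. image_density (Gamma0_curve w s))"
      by (rule continuous_on_compose2[OF cont_image_density continuous_on_Gamma0_curve]) (use w in auto)
    show "((\<lambda>s. 2 * cmod w / a * snd (g (Gamma0_curve w s))) \<longlongrightarrow> 2 * cmod w / a * 0) (at_right 0)"
      "((\<lambda>s. 2 * cmod w / a * snd (g (Gamma0_curve w s))) \<longlongrightarrow> 2 * cmod w / a * a) (at_left a')"
      by (intro tendsto_intros preimage_height_limits w)+
  qed (use pos in auto)
  with pos show ?thesis by simp
qed

text \<open>On the leaf of \<open>w\<close> the density \<open>rho0 a'\<close> is the constant
  \<open>2 * cmod w / a'\<close>. Its cube times the leaf inequality of
  \<open>leaf_image_density\<close> is integrated over all labels; the leaf length \<open>a'\<close>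
  turns the cube times \<open>2 * cmod w\<close> into the fourth power.\<close>

lemma mixed_energy:
  "(\<integral>\<^sup>+q\<in>cylinder a' b'. ennreal (rho0 a' q ^ 4) \<partial>lborel) \<le>
   (\<integral>\<^sup>+q\<in>cylinder a' b'. ennreal (image_density q * rho0 a' q ^ 3) \<partial>lborel)"
proof -
  have rho: "rho0 a' (Gamma0_curve w s) = 2 * cmod w / a'" for w s by (simp add: rho0_def)
  have "(\<integral>\<^sup>+q\<in>cylinder a' b'. ennreal (rho0 a' q ^ 4) \<partial>lborel) =
    (\<integral>\<^sup>+w. (\<integral>\<^sup>+s\<in>{0<..<a'}. ennreal ((2 * cmod w / a') ^ 4) \<partial>lborel) * indicator {w. w \<noteq> 0 \<and> cmod w < sqrt b'} w \<partial>lborel)"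
    by (subst nn_integral_cylinder_leaves) (use pos in \<open>auto intro!: continuous_intros cont_rho0 simp: rho\<close>)
  also have "\<dots> \<le> (\<integral>\<^sup>+w. (\<integral>\<^sup>+s\<in>{0<..<a'}. ennreal (image_density (Gamma0_curve w s) * (2 * cmod w / a') ^ 3) \<partial>lborel)
      * indicator {w. w \<noteq> 0 \<and> cmod w < sqrt b'} w \<partial>lborel)"
  proof (rule nn_integral_mono)
    fix w
    show "(\<integral>\<^sup>+s\<in>{0<..<a'}. ennreal ((2 * cmod w / a') ^ 4) \<partial>lborel) * indicator {w. w \<noteq> 0 \<and> cmod w < sqrt b'} w
      \<le> (\<integral>\<^sup>+s\<in>{0<..<a'}. ennreal (image_density (Gamma0_curve w s) * (2 * cmod w / a') ^ 3) \<partial>lborel)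
      * indicator {w. w \<noteq> 0 \<and> cmod w < sqrt b'} w"
    proof (cases "w \<noteq> 0 \<and> cmod w < sqrt b'")
      case True
      have c: "continuous_on {0<..<a'} (\<lambda>s. image_density (Gamma0_curve w s))"
        by (rule continuous_on_compose2[OF cont_image_density continuous_on_Gamma0_curve]) (use True in auto)
      have "(\<lambda>s. if s \<in> {0<..<a'} then image_density (Gamma0_curve w s) else 0) \<in> borel_measurable borel"
        by (intro borel_measurable_continuous_on_if c) auto
      then have m: "(\<lambda>s. ennreal (if s \<in> {0<..<a'} then image_density (Gamma0_curve w s) else 0)) \<in> borel_measurable lborel"
        by simp
      have "(\<integral>\<^sup>+s\<in>{0<..<a'}. ennreal ((2 * cmod w / a') ^ 4) \<partial>lborel) = ennreal ((2 * cmod w / a') ^ 4 * a')"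
        using pos by (subst nn_integral_cmult_indicator) (auto simp: ennreal_mult)
      also have "\<dots> = ennreal ((2 * cmod w / a') ^ 3) * ennreal (2 * cmod w)"
        using pos by (simp add: ennreal_mult[symmetric] field_simps power3_eq_cube power4_eq_xxxx)
      also have "\<dots> \<le> ennreal ((2 * cmod w / a') ^ 3) * (\<integral>\<^sup>+s\<in>{0<..<a'}. ennreal (image_density (Gamma0_curve w s)) \<partial>lborel)"
        using True by (intro mult_left_mono leaf_image_density) auto
      also have "\<dots> = ennreal ((2 * cmod w / a') ^ 3) * (\<integral>\<^sup>+s. ennreal (if s \<in> {0<..<a'} then image_density (Gamma0_curve w s) else 0) \<partial>lborel)"
        by (intro arg_cong2[where f="(*)"] nn_integral_cong) auto
      also have "\<dots> = (\<integral>\<^sup>+s. ennreal ((2 * cmod w / a') ^ 3) * ennreal (if s \<in> {0<..<a'} then image_density (Gamma0_curve w s) else 0) \<partial>lborel)"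
        by (rule nn_integral_cmult[OF m, symmetric])
      also have "\<dots> = (\<integral>\<^sup>+s\<in>{0<..<a'}. ennreal (image_density (Gamma0_curve w s) * (2 * cmod w / a') ^ 3) \<partial>lborel)"
        using pos True
        by (intro nn_integral_cong) (auto simp: indicator_def ennreal_mult'[symmetric] image_density_nonneg mult.commute)
      finally show ?thesis using True by simp
    qed simp
  qed
  also have "\<dots> = (\<integral>\<^sup>+q\<in>cylinder a' b'. ennreal (image_density q * rho0 a' q ^ 3) \<partial>lborel)"
    by (subst nn_integral_cylinder_leaves)
      (use pos rho0_nonneg image_density_nonneg in \<open>auto intro!: continuous_intros cont_rho0 cont_image_density simp: rho\<close>)
  finally show ?thesis .
qed

text \<open>\<open>e\<close> is the defect in Young's inequality with exponents 4 and 4/3. Its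
  integral is the sum of the image energy and three times the energy of \<open>rho0 a'\<close>,
  minus four times the mixed term; the bounds at hand make this at most 0.\<close>

lemma image_density_eq:
  assumes q: "q \<in> cylinder a' b'"
  shows "image_density q = rho0 a' q"
proof -
  let ?C = "cylinder a' b'"
  define e where "e = (\<lambda>q. image_density q ^ 4 + 3 * rho0 a' q ^ 4 - 4 * (image_density q * rho0 a' q ^ 3))"
  have e_eq: "e q = (image_density q - rho0 a' q)\<^sup>2 *
      ((image_density q + rho0 a' q)\<^sup>2 + 2 * (rho0 a' q)\<^sup>2)" for q
    unfolding e_def by (simp add: power2_eq_square power3_eq_cube power4_eq_xxxx algebra_simps)
  have e0: "0 \<le> e q" for q unfolding e_eq by simp
  have ce: "continuous_on ?C e"
    unfolding e_def using pos by (intro continuous_intros cont_rho0 cont_image_density)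
  have m: "(\<lambda>q. ennreal (k q) * indicator ?C q) \<in> borel_measurable lborel" if "continuous_on ?C k" for k :: "heis \<Rightarrow> real"
  proof -
    have "(\<lambda>q. if q \<in> ?C then k q else 0) \<in> borel_measurable borel"
      by (intro borel_measurable_continuous_on_if that) (auto simp: open_cylinder)
    then have "(\<lambda>q. ennreal (if q \<in> ?C then k q else 0)) \<in> borel_measurable lborel" by simp
    also have "(\<lambda>q. ennreal (if q \<in> ?C then k q else 0)) = (\<lambda>q. ennreal (k q) * indicator ?C q)"
      by (auto simp: fun_eq_iff)
    finally show ?thesis .
  qed
  let ?B = "\<integral>\<^sup>+q\<in>?C. ennreal (rho0 a' q ^ 4) \<partial>lborel"
  let ?M = "\<integral>\<^sup>+q\<in>?C. ennreal (image_density q * rho0 a' q ^ 3) \<partial>lborel"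
  let ?E = "\<integral>\<^sup>+q\<in>?C. ennreal (e q) \<partial>lborel"
  have c4: "continuous_on ?C (\<lambda>q. image_density q ^ 4)" "continuous_on ?C (\<lambda>q. rho0 a' q ^ 4)"
    "continuous_on ?C (\<lambda>q. image_density q * rho0 a' q ^ 3)"
    by (intro continuous_intros cont_rho0 cont_image_density pos)+
  \<comment> \<open>The negative term of \<open>e\<close> is moved to the other side, so that only
    sums occur in \<open>ennreal\<close>; the finite energy \<open>?B\<close> is cancelled at the
    end.\<close>
  have "?E + 4 * ?M = (\<integral>\<^sup>+q. ennreal (e q) * indicator ?C q + 4 * (ennreal (image_density q * rho0 a' q ^ 3) * indicator ?C q) \<partial>lborel)"
    unfolding nn_integral_cmult[OF m[OF c4(3)], symmetric]
    by (rule nn_integral_add[symmetric, OF m[OF ce] borel_measurable_times_ennreal[OF borel_measurable_const m[OF c4(3)]]])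
  also have "\<dots> = (\<integral>\<^sup>+q. ennreal (image_density q ^ 4) * indicator ?C q + 3 * (ennreal (rho0 a' q ^ 4) * indicator ?C q) \<partial>lborel)"
  proof (rule nn_integral_cong)
    fix q
    show "ennreal (e q) * indicator ?C q + 4 * (ennreal (image_density q * rho0 a' q ^ 3) * indicator ?C q) =
      ennreal (image_density q ^ 4) * indicator ?C q + 3 * (ennreal (rho0 a' q ^ 4) * indicator ?C q)"
    proof (cases "q \<in> ?C")
      case True
      have "ennreal (e q) + ennreal 4 * ennreal (image_density q * rho0 a' q ^ 3) =
         ennreal (image_density q ^ 4) + ennreal 3 * ennreal (rho0 a' q ^ 4)"
        using True image_density_nonneg[OF True] rho0_nonneg[of a' q] pos e0[of q]
        by (subst (1 2) ennreal_mult[symmetric], simp_all, subst (1 2) ennreal_plus[symmetric]) (auto simp: e_def)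
      then show ?thesis using True by simp
    qed simp
  qed
  also have "\<dots> = (\<integral>\<^sup>+q\<in>?C. ennreal (image_density q ^ 4) \<partial>lborel) + 3 * ?B"
    unfolding nn_integral_cmult[OF m[OF c4(2)], symmetric]
    by (rule nn_integral_add[OF m[OF c4(1)] borel_measurable_times_ennreal[OF borel_measurable_const m[OF c4(2)]]])
  also have "\<dots> \<le> ?B + 3 * ?B"
    unfolding image_energy by (intro add_right_mono modulus_le_rho0)
  finally have le: "?E + 4 * ?M \<le> ?B + 3 * ?B" .
  have "4 * ?B + ?E \<le> 4 * ?B + 0"
  proof -
    have "4 * ?B + ?E \<le> ?E + 4 * ?M"
      unfolding add.commute[of "4 * ?B"] by (intro add_left_mono mult_left_mono mixed_energy) auto
    also note le
    also have "?B + 3 * ?B = 4 * ?B + 0"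
      using distrib_right[of 1 3 ?B] by simp
    finally show ?thesis .
  qed
  then have "4 * ?B = \<infinity> \<or> ?E \<le> 0"
    unfolding ennreal_add_left_cancel_le by simp
  moreover have "4 * ?B < \<infinity>"
    using rho0_energy_finite by (simp add: ennreal_mult_less_top)
  ultimately have "?E = 0" by auto
  then have "e q = 0"
    by (intro nn_integral_zero_continuous[OF open_cylinder ce e0 _ q]) auto
  then show ?thesis
    unfolding e_eq using power2_less_0[of "image_density q + rho0 a' q"]
    by (auto simp: add_nonneg_eq_0_iff)
qed

lemma modulus_eq: "modulus (cylinder a' b') (image_curves f (Gamma0 a b)) = (\<integral>\<^sup>+q\<in>cylinder a' b'. ennreal (rho0 a' q ^ 4) \<partial>lborel)"
  unfolding image_energy[symmetric] by (intro nn_integral_cong) (auto simp: indicator_def image_density_eq)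

lemma D_eq:
  assumes p: "p \<in> cylinder a b"
  shows "cmod (fst (f p)) * D p = a' / a * cmod (fst p)"
  using image_density_eq[OF f_in[OF p]] g_f[OF p] D_pos[OF p] pos
  by (simp add: image_density_def rho0_def field_simps)

end

subsection \<open>Leaves are mapped to leaves\<close>

context extremal_map begin

lemma fst_Gamma0_curve_eq_0 [simp]: "fst (Gamma0_curve w s) = 0 \<longleftrightarrow> w = 0"
  by (metis cmod_Gamma0_curve norm_eq_zero)

lemma leaf_eq_0_iff [simp]: "leaf p = 0 \<longleftrightarrow> fst p = 0"
  by (metis cmod_leaf norm_eq_zero)

abbreviation punctured :: "heis set" where
  "punctured \<equiv> cylinder a b \<inter> {p. fst p \<noteq> 0}"

lemma open_punctured: "open punctured"
  by (intro open_Int open_cylinder open_Collect_neq continuous_intros)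

lemma f_nonzero:
  assumes "p \<in> punctured"
  shows "fst (f p) \<noteq> 0"
  using D_eq[of p] assms pos by auto

text \<open>With \<open>D\<close> known from \<open>D_eq\<close>, the stretch bound becomes a lower
  bound for the \<open>rho0 a'\<close>-speed of an image leaf. It says that on every piece of a leaf
  the image has at least its proportional share of length.\<close>

lemma leaf_speed_lower:
  assumes p: "p \<in> punctured"
  shows "1 / a \<le> rho0 a' (f p) * cmod (leaf_deriv p)"
proof -
  have p': "p \<in> cylinder a b" "fst p \<noteq> 0" using p by auto
  have "1 / a = 2 * cmod (fst (f p)) / a' * (D p / (2 * cmod (fst p)))"
    using D_eq[OF p'(1)] p'(2) pos by (simp add: field_simps)
  also have "\<dots> \<le> 2 * cmod (fst (f p)) / a' * cmod (leaf_deriv p)"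
    using pos by (intro mult_left_mono leaf_deriv_lower p') auto
  finally show ?thesis by (simp add: rho0_def)
qed

text \<open>The \<open>rho0 a'\<close>-length that an image leaf spends per unit of parameter
  without gaining normalised height.\<close>

definition deficit :: "heis \<Rightarrow> real" where
  "deficit p = rho0 a' (f p) * cmod (leaf_deriv p) - max 0 (height_deriv p) / a'"

lemma deficit_nonneg: "0 \<le> deficit p"
  using height_deriv_le[of p] by (simp add: deficit_def)

lemma cont_deficit: "continuous_on punctured deficit"
proof -
  have "continuous_on punctured (\<lambda>p. rho0 a' (f p))"
    by (rule continuous_on_compose2[OF cont_rho0[OF pos(3)] continuous_on_subset[OF cont_f]]) auto
  then show ?thesis
    unfolding deficit_def by (intro continuous_intros cont_leaf_deriv cont_height_deriv) (use pos in auto)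
qed

lemma measurable_leaf_compose:
  assumes h: "continuous_on punctured h" and w: "w \<noteq> 0" "cmod w < sqrt b"
  shows "(\<lambda>s. ennreal (h (Gamma0_curve w s)) * indicator {0<..<a} s) \<in> borel_measurable lborel"
proof -
  have "(\<lambda>s. if s \<in> {0<..<a} then h (Gamma0_curve w s) else 0) \<in> borel_measurable borel"
    by (intro borel_measurable_continuous_on_if continuous_on_leaf_compose[OF h w]) auto
  then have "(\<lambda>s. ennreal (if s \<in> {0<..<a} then h (Gamma0_curve w s) else 0)) \<in> borel_measurable lborel" by simp
  also have "(\<lambda>s. ennreal (if s \<in> {0<..<a} then h (Gamma0_curve w s) else 0)) =
      (\<lambda>s. ennreal (h (Gamma0_curve w s)) * indicator {0<..<a} s)"
    by (auto simp: fun_eq_iff)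
  finally show ?thesis .
qed

text \<open>The climb alone accounts for length 1, and length counted by the deficit comes on top of
  it.\<close>

lemma leaf_length_lower:
  assumes w: "w \<noteq> 0" "cmod w < sqrt b" and s: "0 < s1" "s1 < s2" "s2 < a" and \<epsilon>: "0 \<le> \<epsilon>"
    and d: "\<And>s. s1 \<le> s \<Longrightarrow> s \<le> s2 \<Longrightarrow> \<epsilon> \<le> deficit (Gamma0_curve w s)"
  shows "ennreal (1 + \<epsilon> * (s2 - s1)) \<le>
    (\<integral>\<^sup>+s\<in>{0<..<a}. ennreal (rho0 a' (f (Gamma0_curve w s)) * cmod (leaf_deriv (Gamma0_curve w s))) \<partial>lborel)"
proof -
  let ?h = "\<lambda>s. ennreal (max 0 (height_deriv (Gamma0_curve w s)) / a') * indicator {0<..<a} s"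
  have c: "continuous_on punctured (\<lambda>p. max 0 (height_deriv p) / a')"
    by (intro continuous_intros cont_height_deriv) (use pos in auto)
  have "ennreal (1 + \<epsilon> * (s2 - s1)) = 1 + ennreal \<epsilon> * ennreal (s2 - s1)"
    using \<epsilon> s by (simp add: ennreal_mult)
  also have "\<dots> = 1 + (\<integral>\<^sup>+s. ennreal \<epsilon> * indicator {s1..s2} s \<partial>lborel)"
    using s by (subst nn_integral_cmult_indicator) auto
  also have "\<dots> \<le> (\<integral>\<^sup>+s. ?h s \<partial>lborel) + (\<integral>\<^sup>+s. ennreal \<epsilon> * indicator {s1..s2} s \<partial>lborel)"
    by (intro add_right_mono height_increment w)
  also have "\<dots> = (\<integral>\<^sup>+s. ?h s + ennreal \<epsilon> * indicator {s1..s2} s \<partial>lborel)"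
    by (rule nn_integral_add[symmetric, OF measurable_leaf_compose[OF c w]]) simp
  also have "\<dots> \<le> (\<integral>\<^sup>+s\<in>{0<..<a}. ennreal (rho0 a' (f (Gamma0_curve w s)) * cmod (leaf_deriv (Gamma0_curve w s))) \<partial>lborel)"
  proof (rule nn_integral_mono)
    fix s
    have "max 0 (height_deriv (Gamma0_curve w s)) / a' + (if s \<in> {s1..s2} then \<epsilon> else 0) \<le>
        rho0 a' (f (Gamma0_curve w s)) * cmod (leaf_deriv (Gamma0_curve w s))"
      using d[of s] deficit_nonneg[of "Gamma0_curve w s"] by (auto simp: deficit_def)
    from ennreal_leI[OF this]
    have "ennreal (max 0 (height_deriv (Gamma0_curve w s)) / a') + ennreal (if s \<in> {s1..s2} then \<epsilon> else 0) \<le>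
        ennreal (rho0 a' (f (Gamma0_curve w s)) * cmod (leaf_deriv (Gamma0_curve w s)))"
      using \<epsilon> pos by (subst (asm) ennreal_plus) (simp_all del: ennreal_plus)
    then show "?h s + ennreal \<epsilon> * indicator {s1..s2} s \<le>
        ennreal (rho0 a' (f (Gamma0_curve w s)) * cmod (leaf_deriv (Gamma0_curve w s))) * indicator {0<..<a} s"
      using s by (auto simp: indicator_def split: if_splits)
  qed
  finally show ?thesis .
qed

text \<open>By continuity the deficit stays large on a neighbourhood that is a product in leaf
  coordinates: an open set of labels times one common height interval. This makes the gain in length
  uniform over those leaves.\<close>

lemma deficit_rectangle:
  assumes p0: "p0 \<in> punctured" and \<epsilon>: "\<epsilon> < deficit p0"
  obtains A s1 s2 where "open A" "leaf p0 \<in> A" "s1 < s2"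
    "\<And>w s. w \<in> A \<Longrightarrow> s1 \<le> s \<Longrightarrow> s \<le> s2 \<Longrightarrow> Gamma0_curve w s \<in> punctured \<and> \<epsilon> < deficit (Gamma0_curve w s)"
proof -
  let ?U = "punctured \<inter> deficit -` {\<epsilon><..}"
  have oU: "open ?U"
    by (rule continuous_open_preimage[OF cont_deficit open_punctured open_greaterThan])
  let ?\<Phi> = "\<lambda>p. Gamma0_curve (fst p) (snd p)"
  have "continuous_on {p. fst p \<noteq> 0} ?\<Phi>"
    by (rule has_derivative_continuous_on, rule has_derivative_at_withinI, rule has_derivative_Gamma0_curve) simp
  moreover have "open {p::heis. fst p \<noteq> 0}"
    by (intro open_Collect_neq continuous_intros)
  ultimately have "open ({p. fst p \<noteq> 0} \<inter> ?\<Phi> -` ?U)"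
    using oU by (rule continuous_open_preimage)
  moreover have "(leaf p0, snd p0) \<in> {p. fst p \<noteq> 0} \<inter> ?\<Phi> -` ?U"
  proof -
    have "leaf p0 \<noteq> 0" using p0 cmod_leaf[of p0] by (metis IntE mem_Collect_eq norm_eq_zero)
    with p0 \<epsilon> show ?thesis by (simp add: Gamma0_curve_leaf)
  qed
  ultimately obtain A B where AB': "open A" "open B" "(leaf p0, snd p0) \<in> A \<times> B" "A \<times> B \<subseteq> {p. fst p \<noteq> 0} \<inter> ?\<Phi> -` ?U"
    by (rule open_prod_elim)
  then have AB: "open A" "open B" "leaf p0 \<in> A" "snd p0 \<in> B" "A \<times> B \<subseteq> {p. fst p \<noteq> 0} \<inter> ?\<Phi> -` ?U"
    by simp_all
  obtain r where r: "r > 0" "cball (snd p0) r \<subseteq> B"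
    using AB open_contains_cball by blast
  have "Gamma0_curve w s \<in> ?U" if "w \<in> A" "snd p0 \<le> s" "s \<le> snd p0 + r" for w s
  proof -
    have "s \<in> B" using that r by (auto simp: subset_eq dist_real_def)
    then have "(w, s) \<in> {p. fst p \<noteq> 0} \<inter> ?\<Phi> -` ?U" using AB(5) that(1) by (auto simp only: subset_eq mem_Times_iff fst_conv snd_conv)
    then show ?thesis by simp
  qed
  then show ?thesis
    using r by (intro that[of A "snd p0" "snd p0 + r", OF AB(1) AB(3)]) auto
qed

text \<open>Where the image leaves are longer than necessary, \<open>rho0 a'\<close> can be scaled down on an open
  set of image leaves and stays admissible, so that it is not extremal.\<close>

lemma deficit_zero:
  assumes p0: "p0 \<in> punctured"
  shows "deficit p0 = 0"
proof (rule ccontr)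
  assume "deficit p0 \<noteq> 0"
  with deficit_nonneg[of p0] have d0: "0 < deficit p0" by simp
  define \<epsilon> where "\<epsilon> = deficit p0 / 2"
  have \<epsilon>: "0 < \<epsilon>" "\<epsilon> < deficit p0" using d0 by (auto simp: \<epsilon>_def)
  obtain A s1 s2 where A: "open A" "leaf p0 \<in> A" "s1 < s2"
    and AD: "\<And>w s. w \<in> A \<Longrightarrow> s1 \<le> s \<Longrightarrow> s \<le> s2 \<Longrightarrow> Gamma0_curve w s \<in> punctured \<and> \<epsilon> < deficit (Gamma0_curve w s)"
    using deficit_rectangle[OF p0 \<epsilon>(2)] by blast
  \<comment> \<open>The reciprocal of the length that \<open>leaf_length_lower\<close> guarantees
    for the image leaves with label in \<open>A\<close>.\<close>
  define k where "k = 1 / (1 + \<epsilon> * (s2 - s1))"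
  have k: "0 < k" "k < 1" 
  proof -
    have "0 < \<epsilon> * (s2 - s1)" using \<epsilon> A by simp
    then show "0 < k" "k < 1" by (simp_all add: k_def)
  qed
  \<comment> \<open>\<open>V\<close> is a union of entire image leaves, so the reduced density
    differs from \<open>rho0 a'\<close> by one constant factor along each leaf.\<close>
  define V where "V = cylinder a' b' \<inter> g -` (punctured \<inter> leaf -` A)"
  have oV: "open V" unfolding V_def
    by (intro continuous_open_preimage[OF cont_g open_cylinder]
        continuous_open_preimage[OF _ open_punctured A(1)] continuous_on_subset[OF continuous_on_leaf]) auto
  have q0: "f p0 \<in> V"
    using p0 A f_in g_f by (simp add: V_def)
  define \<sigma> where "\<sigma> = (\<lambda>q. if q \<in> V then k * rho0 a' q else rho0 a' q)"
  have le: "modulus (cylinder a' b') (image_curves f (Gamma0 a b)) \<le> (\<integral>\<^sup>+q\<in>cylinder a' b'. ennreal (\<sigma> q ^ 4) \<partial>lborel)"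
  proof (rule modulus_le)
    have "rho0 a' \<in> borel_measurable borel"
      using pos by (intro borel_measurable_continuous_onI cont_rho0)
    then have "\<sigma> \<in> borel_measurable borel"
      unfolding \<sigma>_def using oV by (intro measurable_If_set borel_measurable_times) auto
    then show "(\<lambda>q. ennreal (\<sigma> q)) \<in> borel_measurable (restrict_space borel (cylinder a' b'))"
      by (intro measurable_restrict_space1) simp
    show "0 \<le> \<sigma> q" for q using k pos rho0_nonneg by (simp add: \<sigma>_def)
    fix w assume w: "w \<noteq> 0" "cmod w < sqrt b"
    let ?h = "\<lambda>s. ennreal (rho0 a' (f (Gamma0_curve w s)) * cmod (leaf_deriv (Gamma0_curve w s))) * indicator {0<..<a} s"
    have inV: "f (Gamma0_curve w s) \<in> V \<longleftrightarrow> w \<in> A" if "0 < s" "s < a" for s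
    proof -
      have "Gamma0_curve w s \<in> punctured" using that w by auto
      then show ?thesis using f_in g_f by (simp add: V_def)
    qed
    show "1 \<le> (\<integral>\<^sup>+s\<in>{0<..<a}. ennreal (\<sigma> (f (Gamma0_curve w s)) * cmod (leaf_deriv (Gamma0_curve w s))) \<partial>lborel)"
    proof (cases "w \<in> A")
      case True
      have s12: "0 < s1" "s2 < a" using AD[OF True, of s1] AD[OF True, of s2] A(3) by auto
      have c: "continuous_on punctured (\<lambda>p. rho0 a' (f p) * cmod (leaf_deriv p))"
        by (intro continuous_intros cont_leaf_deriv
            continuous_on_compose2[OF cont_rho0[OF pos(3)] continuous_on_subset[OF cont_f]]) auto
      have "1 = ennreal k * ennreal (1 + \<epsilon> * (s2 - s1))"
        using k by (subst ennreal_mult[symmetric]) (auto simp: k_def)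
      also have "\<dots> \<le> ennreal k * (\<integral>\<^sup>+s. ?h s \<partial>lborel)"
        using AD[OF True] \<epsilon> A(3) by (intro mult_left_mono leaf_length_lower w s12) (auto simp: less_imp_le)
      also have "\<dots> = (\<integral>\<^sup>+s. ennreal k * ?h s \<partial>lborel)"
        by (rule nn_integral_cmult[symmetric, OF measurable_leaf_compose[OF c w]])
      also have "\<dots> = (\<integral>\<^sup>+s\<in>{0<..<a}. ennreal (\<sigma> (f (Gamma0_curve w s)) * cmod (leaf_deriv (Gamma0_curve w s))) \<partial>lborel)"
        using k True inV by (intro nn_integral_cong) (auto simp: indicator_def \<sigma>_def ennreal_mult'[symmetric] mult.assoc)
      finally show ?thesis .
    next
      case False
      have "1 \<le> (\<integral>\<^sup>+s. ?h s \<partial>lborel)"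
        by (rule order_trans[OF height_increment[OF w]], intro nn_integral_mono mult_right_mono ennreal_leI height_deriv_le) auto
      also have "\<dots> = (\<integral>\<^sup>+s\<in>{0<..<a}. ennreal (\<sigma> (f (Gamma0_curve w s)) * cmod (leaf_deriv (Gamma0_curve w s))) \<partial>lborel)"
        using False inV by (intro nn_integral_cong) (auto simp: indicator_def \<sigma>_def)
      finally show ?thesis .
    qed
  qed
  let ?X = "\<integral>\<^sup>+q\<in>cylinder a' b'. ennreal (\<sigma> q ^ 4) \<partial>lborel"
  let ?Y = "\<integral>\<^sup>+q\<in>V. ennreal ((1 - k ^ 4) * rho0 a' q ^ 4) \<partial>lborel"
  let ?B = "\<integral>\<^sup>+q\<in>cylinder a' b'. ennreal (rho0 a' q ^ 4) \<partial>lborel"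
  have k4: "k ^ 4 < 1" using k by (simp add: power_less_one_iff)
  have VC: "V \<subseteq> cylinder a' b'" by (simp add: V_def)
  have [measurable]: "rho0 a' \<in> borel_measurable borel" "V \<in> sets borel" "cylinder a' b' \<in> sets borel"
    using pos oV open_cylinder by (auto intro: borel_measurable_continuous_onI cont_rho0)
  have [measurable]: "\<sigma> \<in> borel_measurable borel" unfolding \<sigma>_def by measurable
  \<comment> \<open>\<open>?Y\<close> is the energy saved on \<open>V\<close>. Since
    \<open>rho0 a'\<close> already has the energy of the modulus, nothing can be saved, although the
    integrand of \<open>?Y\<close> is positive at \<open>f p0\<close>.\<close>
  have "?X + ?Y = (\<integral>\<^sup>+q. ennreal (\<sigma> q ^ 4) * indicator (cylinder a' b') q +
      ennreal ((1 - k ^ 4) * rho0 a' q ^ 4) * indicator V q \<partial>lborel)"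
    by (rule nn_integral_add[symmetric]) measurable
  also have "\<dots> = ?B"
  proof (rule nn_integral_cong)
    fix q
    show "ennreal (\<sigma> q ^ 4) * indicator (cylinder a' b') q +
      ennreal ((1 - k ^ 4) * rho0 a' q ^ 4) * indicator V q = ennreal (rho0 a' q ^ 4) * indicator (cylinder a' b') q"
    proof (cases "q \<in> V")
      case True
      have "ennreal (\<sigma> q ^ 4) + ennreal ((1 - k ^ 4) * rho0 a' q ^ 4) = ennreal (rho0 a' q ^ 4)"
      proof -
        have "0 \<le> \<sigma> q ^ 4" "0 \<le> (1 - k ^ 4) * rho0 a' q ^ 4" using k4 by simp_all
        from ennreal_plus[OF this] have "ennreal (\<sigma> q ^ 4) + ennreal ((1 - k ^ 4) * rho0 a' q ^ 4) =
            ennreal (\<sigma> q ^ 4 + (1 - k ^ 4) * rho0 a' q ^ 4)" by simp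
        also have "\<sigma> q ^ 4 + (1 - k ^ 4) * rho0 a' q ^ 4 = rho0 a' q ^ 4"
          using True by (simp add: \<sigma>_def power_mult_distrib algebra_simps)
        finally show ?thesis .
      qed
      then show ?thesis using True VC by auto
    qed (simp add: \<sigma>_def)
  qed
  finally have XY: "?X + ?Y = ?B" .
  have "?B \<le> ?X" using le by (simp add: modulus_eq)
  then have "?X + ?Y \<le> ?X + 0" unfolding XY by simp
  then have "?X = \<infinity> \<or> ?Y \<le> 0"
    unfolding ennreal_add_left_cancel_le by simp
  moreover have "?X \<le> ?X + ?Y" by simp
  then have "?X < \<infinity>" unfolding XY using rho0_energy_finite by (rule order_le_less_trans)
  ultimately have "?Y = 0" by auto
  then have "(1 - k ^ 4) * rho0 a' (f p0) ^ 4 = 0"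
    using k4 pos by (intro nn_integral_zero_continuous[OF oV _ _ _ q0]) (auto intro!: continuous_intros cont_rho0)
  then have "fst (f p0) = 0"
    using k4 pos by (simp add: rho0_def)
  with f_nonzero[OF p0] show False by simp
qed

lemma height_deriv_lower:
  assumes p: "p \<in> punctured"
  shows "a' / a \<le> height_deriv p"
proof -
  have "1 / a \<le> max 0 (height_deriv p) / a'"
    using leaf_speed_lower[OF p] deficit_zero[OF p] by (simp add: deficit_def)
  then have "a' / a \<le> max 0 (height_deriv p)"
    using pos by (simp add: field_simps)
  moreover have "0 < a' / a" using pos by simp
  ultimately show ?thesis by linarith
qed

lemma Gamma0_curve_punctured: "Gamma0_curve w s \<in> punctured \<longleftrightarrow> w \<noteq> 0 \<and> 0 < s \<and> s < a \<and> cmod w < sqrt b"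
  by auto

text \<open>Height minus its proportional value is nondecreasing along the leaf and tends to 0 at
  both ends, so it vanishes identically.\<close>

lemma height_on_leaf:
  assumes w: "w \<noteq> 0" "cmod w < sqrt b" and s: "0 < s" "s < a"
  shows "snd (f (Gamma0_curve w s)) = a' / a * s"
proof -
  define y where "y = (\<lambda>s. snd (f (Gamma0_curve w s)) - a' / a * s)"
  have mono: "y s1 \<le> y s2" if "0 < s1" "s1 \<le> s2" "s2 < a" for s1 s2
  proof (rule DERIV_nonneg_imp_nondecreasing[OF that(2)])
    fix x assume x: "s1 \<le> x" "x \<le> s2"
    have "(y has_real_derivative height_deriv (Gamma0_curve w x) - a' / a * 1) (at x)"
      unfolding y_def using x that w by (intro DERIV_diff DERIV_cmult leaf_height_deriv DERIV_ident) auto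
    moreover have "0 \<le> height_deriv (Gamma0_curve w x) - a' / a * 1"
      using height_deriv_lower[of "Gamma0_curve w x"] x that w by (simp add: Gamma0_curve_punctured)
    ultimately show "\<exists>y'. (y has_real_derivative y') (at x) \<and> 0 \<le> y'" by blast
  qed
  have "(y \<longlongrightarrow> 0 - a' / a * 0) (at_right 0)" "(y \<longlongrightarrow> a' - a' / a * a) (at_left a)"
    unfolding y_def by (intro tendsto_intros height_leaf_limits w)+
  then have l: "(y \<longlongrightarrow> 0) (at_right 0)" "(y \<longlongrightarrow> 0) (at_left a)" using pos by simp_all
  have "eventually (\<lambda>x. y x \<le> y s) (at_right 0)"
    using eventually_at_right_real[OF s(1)] by eventually_elim (use mono s in auto)
  then have "0 \<le> y s" by (intro tendsto_upperbound[OF l(1)]) auto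
  have "eventually (\<lambda>x. y s \<le> y x) (at_left a)"
    using eventually_at_left_real[OF s(2)] by eventually_elim (use mono s in auto)
  then have "y s \<le> 0" by (intro tendsto_lowerbound[OF l(2)]) auto
  with \<open>0 \<le> y s\<close> show ?thesis by (simp add: y_def)
qed

text \<open>Zero deficit is equality between the modulus and the absolute imaginary part of this
  product, so its real part vanishes; the imaginary part is known from the constant rate of
  climb.\<close>

lemma leaf_deriv_eq:
  assumes w: "w \<noteq> 0" "cmod w < sqrt b" and s: "0 < s" "s < a"
  shows "cnj (fst (f (Gamma0_curve w s))) * leaf_deriv (Gamma0_curve w s) = - (\<i> * of_real (a' / (2 * a)))"
proof -
  let ?p = "Gamma0_curve w s"
  have p: "?p \<in> punctured" using w s by (simp add: Gamma0_curve_punctured)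
  have "((\<lambda>s. snd (f (Gamma0_curve w s))) has_real_derivative a' / a * 1) (at s)"
  proof (rule has_field_derivative_transform_within_open[where S="{0<..<a}" and f="\<lambda>s. a' / a * s"])
    show "((\<lambda>s. a' / a * s) has_real_derivative a' / a * 1) (at s)"
      by (intro DERIV_cmult DERIV_ident)
  qed (use s w in \<open>auto simp: height_on_leaf\<close>)
  from DERIV_unique[OF this leaf_height_deriv[OF w s]] have h: "height_deriv ?p = a' / a" by simp
  let ?v = "cnj (fst (f ?p)) * leaf_deriv ?p"
  have im: "Im ?v = - (a' / (2 * a))"
    using h unfolding height_deriv_def by (simp add: field_simps)
  have "cmod ?v = a' / (2 * a)"
    using deficit_zero[OF p] h pos by (simp add: deficit_def rho0_def norm_mult field_simps)
  then have "(a' / (2 * a))\<^sup>2 = (Re ?v)\<^sup>2 + (a' / (2 * a))\<^sup>2"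
    using cmod_power2[of ?v] unfolding im by simp
  then have "Re ?v = 0" by simp
  with im show ?thesis
    by (intro complex_eqI)
      (simp_all only: uminus_complex.sel Re_i_times Im_i_times Re_complex_of_real Im_complex_of_real minus_zero)
qed

text \<open>The middle height is an arbitrary choice: by \<open>f_on_leaf\<close> every interior
  height gives the same label.\<close>

definition leaf_map :: "complex \<Rightarrow> complex" where
  "leaf_map w = leaf (f (Gamma0_curve w (a / 2)))"

text \<open>The vanishing real part in \<open>leaf_deriv_eq\<close> keeps the distance to the axis
  constant along the image curve. The planar part then solves a linear equation of pure rotation,
  with the angular speed of the leaf at that distance, rescaled by the rate of climb.\<close>

lemma f_on_leaf:
  assumes w: "w \<noteq> 0" "cmod w < sqrt b" and s: "0 < s" "s < a"
  shows "f (Gamma0_curve w s) = Gamma0_curve (leaf_map w) (a' / a * s)"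
proof -
  let ?\<phi> = "\<lambda>s. fst (f (Gamma0_curve w s))"
  let ?I = "{0<..<a}"
  have d: "(?\<phi> has_vector_derivative leaf_deriv (Gamma0_curve w x)) (at x within ?I)" if "x \<in> ?I" for x
    using has_derivative_fst[OF leaf_image_deriv[OF w, of x, unfolded has_vector_derivative_def]] that
    by (simp add: has_vector_derivative_def has_derivative_at_withinI)
  have *: "((\<lambda>s. ?\<phi> s \<bullet> ?\<phi> s) has_vector_derivative 0) (at x within ?I)" if x: "x \<in> ?I" for x
  proof -
    have "?\<phi> x \<bullet> leaf_deriv (Gamma0_curve w x) = Re (cnj (?\<phi> x) * leaf_deriv (Gamma0_curve w x))"
      by (simp add: inner_complex_def)
    also have "\<dots> = 0" using leaf_deriv_eq[OF w, of x] x by simp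
    finally have z: "?\<phi> x \<bullet> leaf_deriv (Gamma0_curve w x) = 0" .
    show ?thesis
      unfolding has_vector_derivative_def
      by (rule has_derivative_eq_rhs[OF has_derivative_inner[OF d[OF x, unfolded has_vector_derivative_def] d[OF x, unfolded has_vector_derivative_def]]])
        (simp add: z inner_commute[of "leaf_deriv _"])
  qed
  then obtain N where N: "\<And>x. x \<in> ?I \<Longrightarrow> ?\<phi> x \<bullet> ?\<phi> x = N"
    using has_vector_derivative_zero_constant[OF convex_real_interval(8) *] by blast
  have nz: "?\<phi> x \<noteq> 0" if "x \<in> ?I" for x
    using f_nonzero[of "Gamma0_curve w x"] w that by (simp add: Gamma0_curve_punctured)
  have N': "(cmod (?\<phi> x))\<^sup>2 = N" if "x \<in> ?I" for x
    using N[OF that] by (simp add: power2_norm_eq_inner)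
  have N0: "N \<noteq> 0" using nz[of s] N'[of s] s by auto
  have ld: "leaf_deriv (Gamma0_curve w x) = - (\<i> * of_real (a' / (2 * a * N)) * ?\<phi> x)" if x: "x \<in> ?I" for x
  proof -
    have "of_real N * leaf_deriv (Gamma0_curve w x) = ?\<phi> x * (cnj (?\<phi> x) * leaf_deriv (Gamma0_curve w x))"
      unfolding N'[OF x, symmetric] complex_norm_square by (simp add: mult.assoc)
    also have "\<dots> = ?\<phi> x * - (\<i> * of_real (a' / (2 * a)))"
      using leaf_deriv_eq[OF w, of x] x by simp
    finally have E: "of_real N * leaf_deriv (Gamma0_curve w x) = ?\<phi> x * - (\<i> * of_real (a' / (2 * a)))" .
    have "leaf_deriv (Gamma0_curve w x) = (of_real N * leaf_deriv (Gamma0_curve w x)) / of_real N"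
      using N0 by simp
    then have "leaf_deriv (Gamma0_curve w x) = ?\<phi> x * - (\<i> * of_real (a' / (2 * a))) / of_real N"
      by (simp only: E)
    then show ?thesis by (simp add: mult.commute)
  qed
  have *: "((\<lambda>s. ?\<phi> s * cis (a' / (2 * a * N) * s)) has_vector_derivative 0) (at x within ?I)" if x: "x \<in> ?I" for x
  proof -
    have c: "((\<lambda>s. cis (a' / (2 * a * N) * s)) has_derivative (\<lambda>h. (a' / (2 * a * N) * h) *\<^sub>R (\<i> * cis (a' / (2 * a * N) * x)))) (at x within ?I)"
      by (rule has_derivative_cis[OF has_derivative_mult_right[OF has_derivative_ident]])
    show ?thesis
      unfolding has_vector_derivative_def
      by (rule has_derivative_eq_rhs[OF has_derivative_mult[OF d[OF x, unfolded has_vector_derivative_def] c]])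
        (simp add: ld[OF x] fun_eq_iff scaleR_conv_of_real algebra_simps)
  qed
  then obtain K where K: "\<And>x. x \<in> ?I \<Longrightarrow> ?\<phi> x * cis (a' / (2 * a * N) * x) = K"
    using has_vector_derivative_zero_constant[OF convex_real_interval(8) *] by blast
  have lf: "leaf (f (Gamma0_curve w x)) = K" if x: "x \<in> ?I" for x
    using K[OF x] N'[OF x] height_on_leaf[OF w, of x] x by (simp add: leaf_def mult.commute mult.left_commute)
  have "leaf_map w = K" unfolding leaf_map_def using pos by (intro lf) auto
  then show ?thesis
    using Gamma0_curve_leaf[of "f (Gamma0_curve w s)"] lf[of s] s height_on_leaf[OF w s] by simp
qed

end

subsection \<open>The induced map of leaves\<close>

lemma has_derivative_Gamma0_curve_fst:
  assumes w: "w \<noteq> 0"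
  shows "((\<lambda>v. Gamma0_curve v s) has_derivative
    (\<lambda>h. ((h + (s * (w \<bullet> h) / (cmod w) ^ 4) *\<^sub>R (\<i> * w)) * cis (- (s / (2 * (cmod w)\<^sup>2))), 0))) (at w)"
proof -
  have 1: "((\<lambda>v. (v, s)) has_derivative (\<lambda>h. (h, 0))) (at w)"
    by (auto intro!: derivative_eq_intros)
  have 2: "((\<lambda>p. Gamma0_curve (fst p) (snd p)) has_derivative
    (\<lambda>h. ((fst h - (snd h / (2 * (cmod (fst (w, s)))\<^sup>2) - snd (w, s) * (fst (w, s) \<bullet> fst h) / (cmod (fst (w, s))) ^ 4) *\<^sub>R (\<i> * fst (w, s)))
       * cis (- (snd (w, s) / (2 * (cmod (fst (w, s)))\<^sup>2))), snd h))) (at (w, s))"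
    by (rule has_derivative_Gamma0_curve) (simp add: w)
  show ?thesis
    by (rule has_derivative_eq_rhs[OF has_derivative_compose[OF 1 2, simplified]]) simp
qed

lemma has_derivative_leaf:
  assumes q: "fst q \<noteq> 0"
  shows "\<exists>L. (leaf has_derivative L) (at q)"
proof -
  have n: "((\<lambda>p::heis. 2 * (fst p \<bullet> fst p)) has_derivative (\<lambda>h. 2 * (fst q \<bullet> fst h + fst h \<bullet> fst q))) (at q)"
    by (intro has_derivative_mult_right has_derivative_inner has_derivative_fst has_derivative_ident)
  have n0: "2 * (fst q \<bullet> fst q) \<noteq> 0" using q by simp
  show ?thesis
    unfolding leaf_def[abs_def] power2_norm_eq_inner
    by (rule exI, rule has_derivative_mult[OF has_derivative_fst[OF has_derivative_ident]
        has_derivative_cis[OF has_derivative_divide'[OF has_derivative_snd[OF has_derivative_ident] n n0]]])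
qed

text \<open>Separates the powers of the height \<open>s\<close> in
  \<open>radial_condition\<close>.\<close>

lemma quadratic_zero_on_interval:
  fixes \<alpha> \<beta> \<gamma> a :: real
  assumes a: "0 < a" and z: "\<And>s. 0 < s \<Longrightarrow> s < a \<Longrightarrow> \<alpha> + \<beta> * s + \<gamma> * s\<^sup>2 = 0"
  shows "\<alpha> = 0" "\<beta> = 0" "\<gamma> = 0"
proof -
  define t where "t = a / 4"
  have t: "t \<noteq> 0" "0 < t" "a = 4 * t" using a by (auto simp: t_def)
  have e: "\<alpha> + \<beta> * t + \<gamma> * t\<^sup>2 = 0" "\<alpha> + 2 * (\<beta> * t) + 4 * (\<gamma> * t\<^sup>2) = 0" "\<alpha> + 3 * (\<beta> * t) + 9 * (\<gamma> * t\<^sup>2) = 0"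
    using z[of t] z[of "2 * t"] z[of "3 * t"] t by (simp_all add: power_mult_distrib algebra_simps)
  then have "\<alpha> = 0" "\<beta> * t = 0" "\<gamma> * t\<^sup>2 = 0" by linarith+
  with t show "\<alpha> = 0" "\<beta> = 0" "\<gamma> = 0" by simp_all
qed

context extremal_map begin

abbreviation c :: real where "c \<equiv> a' / a"

lemma c_pos: "0 < c" using pos by simp

lemma leaf_map_nonzero:
  assumes w: "w \<noteq> 0" "cmod w < sqrt b"
  shows "leaf_map w \<noteq> 0"
  using f_nonzero[of "Gamma0_curve w (a / 2)"] w pos
  by (simp add: leaf_map_def)

definition leaf_map_deriv :: "complex \<Rightarrow> complex \<Rightarrow> complex" where
  "leaf_map_deriv w = frechet_derivative leaf_map (at w)"

lemma leaf_map_has_derivative: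
  assumes w: "w \<noteq> 0" "cmod w < sqrt b"
  shows "(leaf_map has_derivative leaf_map_deriv w) (at w)"
proof -
  let ?p = "Gamma0_curve w (a / 2)"
  have p: "?p \<in> punctured" using w pos by simp
  obtain L where L: "(leaf has_derivative L) (at (f ?p))"
    using has_derivative_leaf f_nonzero[OF p] by blast
  have "(leaf_map has_derivative (\<lambda>h. L (f' ?p ((h + (a / 2 * (w \<bullet> h) / (cmod w) ^ 4) *\<^sub>R (\<i> * w)) *
      cis (- (a / 2 / (2 * (cmod w)\<^sup>2))), 0)))) (at w)"
    unfolding leaf_map_def[abs_def]
    by (rule has_derivative_compose[OF has_derivative_compose[OF has_derivative_Gamma0_curve_fst[OF w(1)] der] L])
      (use p in auto)
  then show ?thesis
    unfolding leaf_map_deriv_def by (meson differentiableI frechet_derivative_works)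
qed

text \<open>The logarithmic derivative of \<open>leaf_map\<close> times the squared modulus: the
  real part measures the change of the modulus, the imaginary part the change of the
  argument.\<close>

definition rel_deriv :: "complex \<Rightarrow> complex \<Rightarrow> complex" where
  "rel_deriv w v = cnj (leaf_map w) * leaf_map_deriv w v"

lemma rel_deriv_linear:
  assumes w: "w \<noteq> 0" "cmod w < sqrt b"
  shows "rel_deriv w (u - r *\<^sub>R v) = rel_deriv w u - of_real r * rel_deriv w v" "rel_deriv w (r *\<^sub>R v) = of_real r * rel_deriv w v"
proof -
  note lin = has_derivative_linear[OF leaf_map_has_derivative[OF w]]
  show "rel_deriv w (u - r *\<^sub>R v) = rel_deriv w u - of_real r * rel_deriv w v" "rel_deriv w (r *\<^sub>R v) = of_real r * rel_deriv w v"
    unfolding rel_deriv_def linear_diff[OF lin] linear_scale[OF lin]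
    by (simp_all add: scaleR_conv_of_real algebra_simps)
qed

text \<open>The radial field is horizontal and \<open>f\<close> maps it to horizontal vectors of constant height.\<close>

lemma radial_condition:
  assumes w: "w \<noteq> 0" "cmod w < sqrt b" and s: "0 < s" "s < a"
  defines "\<delta> \<equiv> w - (s / (cmod w)\<^sup>2) *\<^sub>R (\<i> * w)"
  shows "Im (rel_deriv w \<delta>) + c * s / (cmod (leaf_map w))\<^sup>2 * Re (rel_deriv w \<delta>) = 0"
proof -
  let ?p = "Gamma0_curve w s" and ?A = "leaf_map w" and ?L = "leaf_map_deriv w"
  have p: "?p \<in> cylinder a b" using w s by simp
  have A0: "?A \<noteq> 0" by (rule leaf_map_nonzero[OF w])
  \<comment> \<open>The derivative with respect to the label at fixed height is computed twice,
    through \<open>f'\<close> and through \<open>leaf_map\<close>; uniqueness of derivatives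
    compares the two.\<close>
  have "((\<lambda>v. f (Gamma0_curve v s)) has_derivative
    (\<lambda>h. f' ?p ((h + (s * (w \<bullet> h) / (cmod w) ^ 4) *\<^sub>R (\<i> * w)) * cis (- (s / (2 * (cmod w)\<^sup>2))), 0))) (at w)"
    by (rule has_derivative_compose[OF has_derivative_Gamma0_curve_fst[OF w(1)] der[OF p]])
  moreover have "((\<lambda>v. f (Gamma0_curve v s)) has_derivative
    (\<lambda>h. ((?L h + (c * s * (?A \<bullet> ?L h) / (cmod ?A) ^ 4) *\<^sub>R (\<i> * ?A)) * cis (- (c * s / (2 * (cmod ?A)\<^sup>2))), 0))) (at w)"
  proof (rule has_derivative_transform_within_open)
    show "((\<lambda>v. Gamma0_curve (leaf_map v) (c * s)) has_derivative
      (\<lambda>h. ((?L h + (c * s * (?A \<bullet> ?L h) / (cmod ?A) ^ 4) *\<^sub>R (\<i> * ?A)) * cis (- (c * s / (2 * (cmod ?A)\<^sup>2))), 0))) (at w)"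
      by (rule has_derivative_compose[OF leaf_map_has_derivative[OF w] has_derivative_Gamma0_curve_fst[OF A0]])
    show "open (ball 0 (sqrt b) - {0::complex})" by (intro open_Diff) auto
  qed (use w s in \<open>auto simp: f_on_leaf\<close>)
  ultimately have E: "f' ?p ((h + (s * (w \<bullet> h) / (cmod w) ^ 4) *\<^sub>R (\<i> * w)) * cis (- (s / (2 * (cmod w)\<^sup>2))), 0) =
      ((?L h + (c * s * (?A \<bullet> ?L h) / (cmod ?A) ^ 4) *\<^sub>R (\<i> * ?A)) * cis (- (c * s / (2 * (cmod ?A)\<^sup>2))), 0)" for h
    using has_derivative_unique by (metis (no_types, lifting))
  \<comment> \<open>The correction by a multiple of \<open>\<i> * w\<close> in \<delta> compensates
    the shear of the leaf coordinates, so that at height \<open>s\<close> the label direction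
    \<delta> becomes the radial direction.\<close>
  have "w \<bullet> \<delta> = (cmod w)\<^sup>2"
    unfolding \<delta>_def cmod_power2 by (simp add: inner_complex_def power2_eq_square algebra_simps)
  then have "s * (w \<bullet> \<delta>) / (cmod w) ^ 4 = s / (cmod w)\<^sup>2"
    using w by (simp add: power2_eq_square power4_eq_xxxx)
  then have "\<delta> + (s * (w \<bullet> \<delta>) / (cmod w) ^ 4) *\<^sub>R (\<i> * w) = w"
    by (simp add: \<delta>_def)
  moreover have "(w * cis (- (s / (2 * (cmod w)\<^sup>2))), 0) = horizontal_lift ?p (fst ?p)"
  proof -
    have "Im (cnj (fst ?p) * fst ?p) = 0" by (simp add: algebra_simps)
    then show ?thesis by (simp add: horizontal_lift_def Gamma0_curve_cis)
  qed
  ultimately have E': "f' ?p (horizontal_lift ?p (fst ?p)) =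
      ((?L \<delta> + (c * s * (?A \<bullet> ?L \<delta>) / (cmod ?A) ^ 4) *\<^sub>R (\<i> * ?A)) * cis (- (c * s / (2 * (cmod ?A)\<^sup>2))), 0)"
    using E[of \<delta>] by simp
  let ?X = "(?L \<delta> + (c * s * (?A \<bullet> ?L \<delta>) / (cmod ?A) ^ 4) *\<^sub>R (\<i> * ?A))" and ?e = "cis (- (c * s / (2 * (cmod ?A)\<^sup>2)))"
  have fp: "fst (f ?p) = ?A * ?e"
    by (subst f_on_leaf[OF w s]) (simp add: Gamma0_curve_cis)
  have "Im (cnj (fst (f ?p)) * fst (f' ?p (horizontal_lift ?p (fst ?p)))) = 0"
    using snd_horizontal[OF p, of "fst ?p"] E' by (simp add: hderiv_def)
  then have z: "Im (cnj (?A * ?e) * (?X * ?e)) = 0" unfolding fp E' fst_conv .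
  have z1: "cnj (?A * ?e) * (?X * ?e) = (cnj ?A * ?X) * (?e * cnj ?e)"
    unfolding complex_cnj_mult by (simp only: mult_ac)
  have z2: "?e * cnj ?e = 1" unfolding complex_norm_square[symmetric] by simp
  have x1: "Im (cnj ?A * ?X) = 0" using z unfolding z1 z2 mult_1_right .
  have x2: "cnj ?A * ?X = rel_deriv w \<delta> + \<i> * of_real (c * s * (?A \<bullet> ?L \<delta>) / (cmod ?A) ^ 4 * (cmod ?A)\<^sup>2)"
    unfolding of_real_mult complex_norm_square by (simp add: rel_deriv_def scaleR_conv_of_real algebra_simps)
  have x3: "?A \<bullet> ?L \<delta> = Re (rel_deriv w \<delta>)" by (simp add: rel_deriv_def inner_complex_def)
  have "Im (rel_deriv w \<delta>) + c * s * Re (rel_deriv w \<delta>) / (cmod ?A) ^ 4 * (cmod ?A)\<^sup>2 = 0"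
    using x1 unfolding x2 unfolding x3 plus_complex.sel Im_i_times Re_complex_of_real .
  then show ?thesis using A0 by (simp add: power2_eq_square power4_eq_xxxx)
qed

text \<open>As \<delta> is affine in \<open>s\<close>, \<open>radial_condition\<close> is a
  quadratic polynomial in \<open>s\<close>. The directions \<open>w\<close> and
  \<open>\<i> * w\<close> are \<open>r d/dr\<close> and \<open>d/d\<phi>\<close> in polar
  coordinates, so the three coefficients concern the argument along rays, the modulus along circles,
  and the link between the two remaining derivatives.\<close>

lemma leaf_map_equations:
  assumes w: "w \<noteq> 0" "cmod w < sqrt b"
  shows "Im (rel_deriv w w) = 0" "Re (rel_deriv w (\<i> * w)) = 0"
    "Im (rel_deriv w (\<i> * w)) / (cmod w)\<^sup>2 = c * Re (rel_deriv w w) / (cmod (leaf_map w))\<^sup>2"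
proof -
  let ?n = "(cmod w)\<^sup>2" and ?N = "(cmod (leaf_map w))\<^sup>2"
  have n: "?n \<noteq> 0" "?N \<noteq> 0" using w leaf_map_nonzero[OF w] by auto
  have z: "Im (rel_deriv w w) + (c * Re (rel_deriv w w) / ?N - Im (rel_deriv w (\<i> * w)) / ?n) * s + (- (c * Re (rel_deriv w (\<i> * w)) / (?N * ?n))) * s\<^sup>2 = 0"
    if "0 < s" "s < a" for s
    using radial_condition[OF w that] unfolding rel_deriv_linear[OF w]
    by (simp add: algebra_simps power2_eq_square)
  note q = quadratic_zero_on_interval[OF pos(1) z]
  show "Im (rel_deriv w w) = 0" by (rule q(1))
  show "Im (rel_deriv w (\<i> * w)) / ?n = c * Re (rel_deriv w w) / ?N" using q(2) by simp
  show "Re (rel_deriv w (\<i> * w)) = 0" using q(3) c_pos pos n w by simp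
qed

section \<open>The leaf map in polar coordinates\<close>

definition radius :: "real \<Rightarrow> real" where
  "radius r = cmod (leaf_map (of_real r))"

definition polar :: "real \<Rightarrow> real \<Rightarrow> complex" where
  "polar r \<phi> = of_real r * cis \<phi>"

lemma cmod_polar [simp]: "cmod (polar r \<phi>) = \<bar>r\<bar>"
  by (simp add: polar_def norm_mult)

lemma polar_valid:
  assumes "0 < r" "r < sqrt b"
  shows "polar r \<phi> \<noteq> 0" "cmod (polar r \<phi>) < sqrt b"
proof -
  show "cmod (polar r \<phi>) < sqrt b" using assms by simp
  show "polar r \<phi> \<noteq> 0" using assms by (simp add: polar_def)
qed

lemma circle_deriv:
  assumes r: "0 < r" "r < sqrt b"
  shows "((\<lambda>\<phi>. leaf_map (polar r \<phi>)) has_derivative (\<lambda>h. h *\<^sub>R leaf_map_deriv (polar r \<phi>) (\<i> * polar r \<phi>))) (at \<phi>)"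
proof -
  have "((\<lambda>\<phi>. polar r \<phi>) has_derivative (\<lambda>h. h *\<^sub>R (\<i> * polar r \<phi>))) (at \<phi>)"
    unfolding polar_def by (rule has_derivative_eq_rhs[OF has_derivative_mult_right[OF has_derivative_cis[OF has_derivative_ident]]])
      (simp add: scaleR_conv_of_real mult_ac)
  from has_derivative_compose[OF this leaf_map_has_derivative[OF polar_valid[OF r]]]
  show ?thesis
    by (simp add: linear_scale[OF has_derivative_linear[OF leaf_map_has_derivative[OF polar_valid[OF r]]]])
qed

lemma ray_deriv:
  assumes r: "0 < r" "r < sqrt b"
  shows "((\<lambda>r. leaf_map (polar r \<phi>)) has_derivative (\<lambda>h. (h / r) *\<^sub>R leaf_map_deriv (polar r \<phi>) (polar r \<phi>))) (at r)"
proof -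
  have "((\<lambda>r. polar r \<phi>) has_derivative (\<lambda>h. (h / r) *\<^sub>R polar r \<phi>)) (at r)"
    unfolding polar_def by (rule has_derivative_eq_rhs[OF has_derivative_mult_left[OF has_derivative_of_real[OF has_derivative_ident]]])
      (use r in \<open>simp add: scaleR_conv_of_real\<close>)
  from has_derivative_compose[OF this leaf_map_has_derivative[OF polar_valid[OF r]]]
  show ?thesis
    by (simp only: linear_scale[OF has_derivative_linear[OF leaf_map_has_derivative[OF polar_valid[OF r]]]])
qed

lemma inner_leaf_map: "leaf_map w \<bullet> leaf_map_deriv w v = Re (rel_deriv w v)"
  by (simp add: rel_deriv_def inner_complex_def)

lemma cmod_leaf_map:
  assumes r: "0 < r" "r < sqrt b"
  shows "cmod (leaf_map (polar r \<phi>)) = radius r"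
proof -
  have *: "((\<lambda>\<phi>. leaf_map (polar r \<phi>) \<bullet> leaf_map (polar r \<phi>)) has_derivative (\<lambda>h. 0)) (at \<phi> within UNIV)" for \<phi>
    by (rule has_derivative_eq_rhs[OF has_derivative_inner[OF circle_deriv[OF r] circle_deriv[OF r]]])
      (simp add: inner_leaf_map inner_commute[of "leaf_map_deriv _ _"] leaf_map_equations(2)[OF polar_valid[OF r]])
  obtain N where N: "\<And>\<phi>. leaf_map (polar r \<phi>) \<bullet> leaf_map (polar r \<phi>) = N"
    using has_derivative_zero_constant[OF convex_UNIV *] by auto
  then have "leaf_map (polar r \<phi>) \<bullet> leaf_map (polar r \<phi>) = leaf_map (polar r 0) \<bullet> leaf_map (polar r 0)" by metis
  then show ?thesis
    unfolding power2_norm_eq_inner[symmetric] by (simp add: radius_def polar_def)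
qed

lemma radius_pos:
  assumes r: "0 < r" "r < sqrt b"
  shows "0 < radius r"
  unfolding cmod_leaf_map[OF r, of 0, symmetric] zero_less_norm_iff
  by (rule leaf_map_nonzero[OF polar_valid[OF r]])

lemma radius_squared_deriv:
  assumes r: "0 < r" "r < sqrt b"
  shows "((\<lambda>r. (radius r)\<^sup>2) has_real_derivative 2 * Re (rel_deriv (polar r \<phi>) (polar r \<phi>)) / r) (at r)"
proof (rule has_field_derivative_transform_within_open[where S="{0<..<sqrt b}"])
  have "((\<lambda>r. leaf_map (polar r \<phi>) \<bullet> leaf_map (polar r \<phi>)) has_derivative (*) (2 * Re (rel_deriv (polar r \<phi>) (polar r \<phi>)) / r)) (at r)"
    by (rule has_derivative_eq_rhs[OF has_derivative_inner[OF ray_deriv[OF r] ray_deriv[OF r]]])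
      (simp add: inner_leaf_map inner_commute[of "leaf_map_deriv _ _"] fun_eq_iff)
  then show "((\<lambda>r. leaf_map (polar r \<phi>) \<bullet> leaf_map (polar r \<phi>)) has_real_derivative 2 * Re (rel_deriv (polar r \<phi>) (polar r \<phi>)) / r) (at r)"
    by (simp add: has_field_derivative_def)
  show "leaf_map (polar x \<phi>) \<bullet> leaf_map (polar x \<phi>) = (radius x)\<^sup>2" if "x \<in> {0<..<sqrt b}" for x
    using cmod_leaf_map[of x \<phi>] that by (simp add: power2_norm_eq_inner[symmetric])
qed (use r in auto)

text \<open>Along a ray the derivative of \<open>leaf_map\<close> is a real multiple of its value,
  so the normalised value is constant.\<close>

lemma leaf_map_direction:
  assumes r: "0 < r" "r < sqrt b" and r0: "0 < r0" "r0 < sqrt b"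
  shows "leaf_map (polar r \<phi>) = of_real (radius r / radius r0) * leaf_map (polar r0 \<phi>)"
proof -
  let ?A = "\<lambda>r. leaf_map (polar r \<phi>)" and ?I = "{0<..<sqrt b}"
  have *: "((\<lambda>r. inverse (norm (?A r)) *\<^sub>R ?A r) has_derivative (\<lambda>h. 0)) (at x within ?I)" if "x \<in> ?I" for x
  proof -
    have x: "0 < x" "x < sqrt b" using that by auto
    have A0: "?A x \<noteq> 0" by (rule leaf_map_nonzero[OF polar_valid[OF x]])
    let ?D = "leaf_map_deriv (polar x \<phi>) (polar x \<phi>)"
    have d: "(?A has_derivative (\<lambda>h. (h / x) *\<^sub>R ?D)) (at x within ?I)"
      by (rule has_derivative_at_withinI[OF ray_deriv[OF x]])
    have n: "((\<lambda>r. norm (?A r)) has_derivative (\<lambda>h. ((h / x) *\<^sub>R ?D) \<bullet> sgn (?A x))) (at x within ?I)"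
      by (rule has_derivative_compose[OF d has_derivative_norm[OF A0]])
    have i: "((\<lambda>r. inverse (norm (?A r))) has_derivative
        (\<lambda>h. - (inverse (norm (?A x)) * (((h / x) *\<^sub>R ?D) \<bullet> sgn (?A x)) * inverse (norm (?A x))))) (at x within ?I)"
      by (rule Deriv.has_derivative_inverse[OF _ n]) (use A0 in simp)
    have "of_real ((norm (?A x))\<^sup>2) * ?D = ?A x * rel_deriv (polar x \<phi>) (polar x \<phi>)"
      unfolding complex_norm_square by (simp add: rel_deriv_def mult_ac)
    also have "rel_deriv (polar x \<phi>) (polar x \<phi>) = of_real (?A x \<bullet> ?D)"
      using leaf_map_equations(1)[OF polar_valid[OF x]] by (simp add: complex_eq_iff inner_leaf_map)
    finally have e: "((norm (?A x))\<^sup>2) *\<^sub>R ?D = (?A x \<bullet> ?D) *\<^sub>R ?A x"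
      by (simp add: scaleR_conv_of_real mult.commute)
    \<comment> \<open>The derivative equals its own projection to the line through the value;
      differentiating the normalised value removes precisely this projection.\<close>
    have e': "?D = ((?A x \<bullet> ?D) / (norm (?A x))\<^sup>2) *\<^sub>R ?A x"
      using arg_cong[OF e, of "\<lambda>z. (1 / (norm (?A x))\<^sup>2) *\<^sub>R z"] A0 by simp
    have s: "?D \<bullet> sgn (?A x) = (?A x \<bullet> ?D) / norm (?A x)"
      by (simp add: sgn_div_norm inner_commute divide_inverse)
    show ?thesis
    proof (rule has_derivative_eq_rhs[OF has_derivative_scaleR[OF i d]], rule ext)
      fix h
      have "inverse (norm (?A x)) *\<^sub>R (h / x) *\<^sub>R ?D +
         (- (inverse (norm (?A x)) * (((h / x) *\<^sub>R ?D) \<bullet> sgn (?A x)) * inverse (norm (?A x)))) *\<^sub>R ?A x =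
         (inverse (norm (?A x)) * (h / x)) *\<^sub>R ?D - (inverse (norm (?A x)) * (h / x)) *\<^sub>R (((?A x \<bullet> ?D) / (norm (?A x))\<^sup>2) *\<^sub>R ?A x)"
        by (simp add: s power2_eq_square divide_inverse mult_ac)
      also have "\<dots> = 0" unfolding e'[symmetric] by simp
      finally show "inverse (norm (?A x)) *\<^sub>R (h / x) *\<^sub>R ?D +
         (- (inverse (norm (?A x)) * (((h / x) *\<^sub>R ?D) \<bullet> sgn (?A x)) * inverse (norm (?A x)))) *\<^sub>R ?A x = 0" .
    qed
  qed
  obtain K where K: "\<And>x. x \<in> ?I \<Longrightarrow> inverse (norm (?A x)) *\<^sub>R ?A x = K"
    using has_derivative_zero_constant[OF convex_real_interval(8) *] by blast
  have E: "inverse (radius r) *\<^sub>R ?A r = inverse (radius r0) *\<^sub>R ?A r0"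
    using K[of r] K[of r0] r r0 cmod_leaf_map[OF r, of \<phi>] cmod_leaf_map[OF r0, of \<phi>] by simp
  have "?A r = radius r *\<^sub>R inverse (radius r) *\<^sub>R ?A r"
    using radius_pos[OF r] by simp
  then show ?thesis unfolding E by (simp add: scaleR_conv_of_real divide_inverse mult.assoc)
qed

definition twist :: "complex \<Rightarrow> real" where
  "twist w = Im (rel_deriv w (\<i> * w)) / (cmod (leaf_map w))\<^sup>2"

text \<open>\<open>twist\<close> is the angular derivative of the argument of \<open>leaf_map\<close>, which does not depend on the
  radius, and by \<open>leaf_map_equations\<close> it is a function of the radius only.\<close>

lemma twist_const:
  assumes r: "0 < r" "r < sqrt b" and r0: "0 < r0" "r0 < sqrt b"
  shows "twist (polar r \<phi>) = twist (polar r0 0)"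
proof -
  have rad: "twist (polar r \<phi>) = twist (polar r0 \<phi>)" for \<phi>
  proof -
    let ?k = "radius r / radius r0"
    have k: "?k \<noteq> 0" using radius_pos[OF r] radius_pos[OF r0] by simp
    have "((\<lambda>\<phi>. leaf_map (polar r \<phi>)) has_derivative (\<lambda>h. of_real ?k * (h *\<^sub>R leaf_map_deriv (polar r0 \<phi>) (\<i> * polar r0 \<phi>)))) (at \<phi>)"
      unfolding leaf_map_direction[OF r r0] by (rule has_derivative_mult_right[OF circle_deriv[OF r0]])
    from has_derivative_unique[OF this circle_deriv[OF r]]
    have "leaf_map_deriv (polar r \<phi>) (\<i> * polar r \<phi>) = of_real ?k * leaf_map_deriv (polar r0 \<phi>) (\<i> * polar r0 \<phi>)"
      by (metis scaleR_one)
    then have "rel_deriv (polar r \<phi>) (\<i> * polar r \<phi>) = of_real (?k\<^sup>2) * rel_deriv (polar r0 \<phi>) (\<i> * polar r0 \<phi>)"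
      unfolding rel_deriv_def leaf_map_direction[OF r r0] by (simp add: power2_eq_square)
    then show ?thesis
      using k unfolding twist_def cmod_leaf_map[OF r] cmod_leaf_map[OF r0] by (simp add: power_divide)
  qed
  \<comment> \<open>The radial derivative of the squared modulus is the same on every ray, because
    the modulus is; the third equation expresses \<open>twist\<close> by it.\<close>
  have ang: "twist (polar r0 \<phi>) = twist (polar r0 0)"
  proof -
    have R: "Re (rel_deriv (polar r0 \<phi>) (polar r0 \<phi>)) = Re (rel_deriv (polar r0 0) (polar r0 0))"
      using DERIV_unique[OF radius_squared_deriv[OF r0, of \<phi>] radius_squared_deriv[OF r0, of 0]] r0 by simp
    have tw: "twist (polar r0 \<psi>) = c * Re (rel_deriv (polar r0 \<psi>) (polar r0 \<psi>)) / (radius r0)\<^sup>2 * r0\<^sup>2 / (radius r0)\<^sup>2" for \<psi>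
      using leaf_map_equations(3)[OF polar_valid[OF r0], of \<psi>] r0 unfolding twist_def
      by (simp add: cmod_leaf_map field_simps)
    show ?thesis unfolding tw R ..
  qed
  show ?thesis using rad[of \<phi>] ang by simp
qed

section \<open>The winding and the radial law\<close>

definition winding :: real where "winding = twist (polar (sqrt b / 2) 0)"

lemma twist_eq:
  assumes r: "0 < r" "r < sqrt b"
  shows "twist (polar r \<phi>) = winding"
  unfolding winding_def by (rule twist_const[OF r]) (use pos in auto)

text \<open>On a circle the modulus is constant and the argument has constant speed
  \<open>winding\<close>, so multiplying by the opposite rotation gives a constant.\<close>

lemma leaf_map_rotate:
  assumes r: "0 < r" "r < sqrt b"
  shows "leaf_map (polar r \<phi>) = leaf_map (polar r 0) * cis (winding * \<phi>)"
proof -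
  let ?A = "\<lambda>\<phi>. leaf_map (polar r \<phi>)"
  have D: "leaf_map_deriv (polar r \<phi>) (\<i> * polar r \<phi>) = \<i> * of_real winding * ?A \<phi>" for \<phi>
  proof -
    have A0: "?A \<phi> \<noteq> 0" by (rule leaf_map_nonzero[OF polar_valid[OF r]])
    have "rel_deriv (polar r \<phi>) (\<i> * polar r \<phi>) = \<i> * of_real (winding * (cmod (?A \<phi>))\<^sup>2)"
      using leaf_map_equations(2)[OF polar_valid[OF r], of \<phi>] twist_eq[OF r, of \<phi>] A0
      unfolding twist_def by (intro complex_eqI) (simp_all add: field_simps)
    then have "cnj (?A \<phi>) * leaf_map_deriv (polar r \<phi>) (\<i> * polar r \<phi>) = cnj (?A \<phi>) * (\<i> * of_real winding * ?A \<phi>)"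
      unfolding rel_deriv_def of_real_mult complex_norm_square by (simp add: mult_ac)
    then show ?thesis using A0 by simp
  qed
  have c: "((\<lambda>\<phi>. cis (- winding * \<phi>)) has_derivative (\<lambda>h. (- winding * h) *\<^sub>R (\<i> * cis (- winding * \<phi>)))) (at \<phi> within UNIV)" for \<phi>
    by (rule has_derivative_cis[OF has_derivative_mult_right[OF has_derivative_ident]])
  have *: "((\<lambda>\<phi>. ?A \<phi> * cis (- winding * \<phi>)) has_derivative (\<lambda>h. 0)) (at \<phi> within UNIV)" for \<phi>
    by (rule has_derivative_eq_rhs[OF has_derivative_mult[OF circle_deriv[OF r] c]])
      (simp add: D fun_eq_iff scaleR_conv_of_real algebra_simps)
  obtain K where K: "\<And>\<phi>. ?A \<phi> * cis (- winding * \<phi>) = K"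
    using has_derivative_zero_constant[OF convex_UNIV *] by auto
  have "?A \<phi> = ?A \<phi> * cis (- winding * \<phi>) * cis (winding * \<phi>)" by (simp add: mult.assoc cis_mult)
  also have "?A \<phi> * cis (- winding * \<phi>) = ?A 0" using K[of \<phi>] K[of 0] by simp
  finally show ?thesis .
qed

lemma leaf_map_inj:
  assumes u: "u \<noteq> 0" "cmod u < sqrt b" and w: "w \<noteq> 0" "cmod w < sqrt b" and e: "leaf_map u = leaf_map w"
  shows "u = w"
proof -
  have "f (Gamma0_curve u (a / 2)) = f (Gamma0_curve w (a / 2))"
    using f_on_leaf[OF u, of "a / 2"] f_on_leaf[OF w, of "a / 2"] e pos by simp
  then have "Gamma0_curve u (a / 2) = Gamma0_curve w (a / 2)"
    using inj_onD[OF inj_f] u w pos by simp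
  then show ?thesis by (metis leaf_Gamma0_curve)
qed

text \<open>The third equation reads \<open>winding = c * r^3 * R' / R^3\<close> with
  \<open>R\<close> the radius function. It separates: \<open>-2 * R' / R^3\<close> is the derivative
  of \<open>1 / R^2\<close> and \<open>-2 * winding / (c * r^3)\<close> that of
  \<open>winding / (c * r^2)\<close>.\<close>

lemma radius_formula:
  obtains n where "\<And>r. 0 < r \<Longrightarrow> r < sqrt b \<Longrightarrow> 1 / (radius r)\<^sup>2 = winding / (c * r\<^sup>2) + n"
proof -
  let ?I = "{0<..<sqrt b}"
  have *: "((\<lambda>r. 1 / (radius r)\<^sup>2 - winding / (c * r\<^sup>2)) has_derivative (\<lambda>h. 0)) (at x within ?I)" if "x \<in> ?I" for x
  proof -
    have x: "0 < x" "x < sqrt b" using that by auto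
    have R0: "radius x \<noteq> 0" using radius_pos[OF x] by simp
    have "winding = c * Re (rel_deriv (polar x 0) (polar x 0)) / (radius x)\<^sup>2 * x\<^sup>2 / (radius x)\<^sup>2"
      using leaf_map_equations(3)[OF polar_valid[OF x], of 0] twist_eq[OF x, of 0] x unfolding twist_def
      by (simp add: cmod_leaf_map field_simps)
    then have Re: "Re (rel_deriv (polar x 0) (polar x 0)) = winding * (radius x)\<^sup>2 * (radius x)\<^sup>2 / (c * x\<^sup>2)"
      using x R0 c_pos pos by (simp add: field_simps)
    have "((\<lambda>r. 1 / (radius r)\<^sup>2) has_real_derivative - (2 * Re (rel_deriv (polar x 0) (polar x 0)) / x) / ((radius x)\<^sup>2)\<^sup>2) (at x)"
      using DERIV_inverse'[OF radius_squared_deriv[OF x, of 0]] R0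
      by (simp add: inverse_eq_divide power2_eq_square mult_ac)
    moreover have "((\<lambda>r. winding / (c * r\<^sup>2)) has_real_derivative - (2 * winding / (c * x ^ 3))) (at x)"
      using x pos by (auto intro!: derivative_eq_intros simp: field_simps power2_eq_square power3_eq_cube)
    ultimately have "((\<lambda>r. 1 / (radius r)\<^sup>2 - winding / (c * r\<^sup>2)) has_real_derivative
       - (2 * Re (rel_deriv (polar x 0) (polar x 0)) / x) / ((radius x)\<^sup>2)\<^sup>2 - - (2 * winding / (c * x ^ 3))) (at x)"
      by (rule DERIV_diff)
    moreover have "- (2 * Re (rel_deriv (polar x 0) (polar x 0)) / x) / ((radius x)\<^sup>2)\<^sup>2 - - (2 * winding / (c * x ^ 3)) = 0"
      unfolding Re using x R0 pos by (simp add: field_simps power2_eq_square power3_eq_cube)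
    ultimately show ?thesis
      by (auto simp: has_field_derivative_def mult_zero_left[abs_def] intro: has_derivative_at_withinI)
  qed
  obtain n where "\<And>r. r \<in> ?I \<Longrightarrow> 1 / (radius r)\<^sup>2 - winding / (c * r\<^sup>2) = n"
    using has_derivative_zero_constant[OF convex_real_interval(8) *] by blast
  then show ?thesis by (intro that[of n]) (auto simp: algebra_simps)
qed

end
lemma cis_eq_1_imp_int:
  assumes "cis (2 * pi * x) = 1"
  shows "x \<in> \<int>"
proof -
  have "cos (2 * pi * x) = 1" using assms by (metis cis.simps(1) one_complex.simps(1))
  then obtain k :: int where "2 * pi * x = of_int k * 2 * pi"
    using cos_one_2pi_int by blast
  then have "x = of_int k" by (simp add: field_simps)
  then show ?thesis by simp
qed

context extremal_map begin

text \<open>Going once around a circle shows that the winding is an integer; injectivity on the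
  circle shows that its reciprocal is one too. The value -1 is impossible since
  \<open>radius_formula\<close> would make \<open>1 / (radius r)^2\<close> negative for small
  \<open>r\<close>.\<close>

lemma winding_eq_1: "winding = 1"
proof -
  define r where "r = sqrt b / 2"
  have r: "0 < r" "r < sqrt b" using pos by (auto simp: r_def)
  note A0 = leaf_map_nonzero[OF polar_valid[OF r]]
  have inj: "cis \<phi> = 1" if "cis (winding * \<phi>) = 1" for \<phi>
  proof -
    have "leaf_map (polar r \<phi>) = leaf_map (polar r 0)"
      by (simp add: leaf_map_rotate[OF r, of \<phi>] that)
    from leaf_map_inj[OF polar_valid[OF r] polar_valid[OF r] this] show ?thesis
      using r by (simp add: polar_def)
  qed
  have "winding \<noteq> 0"
    using inj[of pi] by (auto simp: complex_eq_iff)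
  have "leaf_map (polar r (2 * pi)) = leaf_map (polar r 0)" by (simp add: polar_def)
  then have "cis (2 * pi * winding) = 1"
    using leaf_map_rotate[OF r, of "2 * pi"] A0[of 0] by (simp add: mult.commute)
  then have "winding \<in> \<int>" by (rule cis_eq_1_imp_int)
  moreover have "1 / winding \<in> \<int>"
    using inj[of "2 * pi * (1 / winding)"] \<open>winding \<noteq> 0\<close> by (intro cis_eq_1_imp_int) (simp add: cis_2pi)
  ultimately obtain i j :: int where ij: "winding = of_int i" "1 / winding = of_int j"
    by (auto elim!: Ints_cases)
  then have "real_of_int (i * j) = 1" using \<open>winding \<noteq> 0\<close> by (metis of_int_mult nonzero_mult_div_cancel_left times_divide_eq_right mult_1_right)
  then have "i * j = 1" by linarith
  then have "i = 1 \<or> i = -1" by (auto simp: zmult_eq_1_iff)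
  moreover have "i \<noteq> -1"
  proof
    assume "i = -1"
    then have winding: "winding = -1" using ij by simp
    obtain n where n: "\<And>r. 0 < r \<Longrightarrow> r < sqrt b \<Longrightarrow> 1 / (radius r)\<^sup>2 = winding / (c * r\<^sup>2) + n"
      using radius_formula by blast
    have *: "1 < n * (c * r\<^sup>2)" if "0 < r" "r < sqrt b" for r
    proof -
      have "0 < 1 / (radius r)\<^sup>2" using radius_pos[OF that] by simp
      then have "1 / (c * r\<^sup>2) < n" using n[OF that] winding by simp
      moreover have "0 < c * r\<^sup>2" using that pos by simp
      ultimately show ?thesis by (simp only: pos_divide_less_eq)
    qed
    have n0: "0 < n * c * r\<^sup>2" using *[OF r] by (simp add: mult.assoc)
    have nc: "0 < n * c" by (rule zero_less_mult_pos2[OF n0]) (use r in simp)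
    \<comment> \<open>A radius at which the right-hand side of \<open>radius_formula\<close> with
      winding -1 is no longer positive.\<close>
    define \<rho> where "\<rho> = min r (1 / sqrt (n * c))"
    have \<rho>: "0 < \<rho>" "\<rho> < sqrt b" "\<rho> \<le> 1 / sqrt (n * c)" using nc r by (auto simp: \<rho>_def)
    have "\<rho>\<^sup>2 \<le> (1 / sqrt (n * c))\<^sup>2" using \<rho> by (intro power_mono) auto
    also have "(1 / sqrt (n * c))\<^sup>2 = 1 / (n * c)" using nc by (simp add: power_divide)
    finally have "\<rho>\<^sup>2 * (n * c) \<le> 1" by (simp only: pos_le_divide_eq[OF nc])
    then have "n * (c * \<rho>\<^sup>2) \<le> 1" by (simp only: mult_ac)
    with *[OF \<rho>(1,2)] show False by simp
  qed
  ultimately show ?thesis using ij by simp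
qed

text \<open>\<open>F\<close> is continuous up to the lateral face and maps it to the lateral face;
  the approach takes place at the fixed height \<open>a / 2\<close>.\<close>

lemma radius_boundary: "((\<lambda>r. radius r) \<longlongrightarrow> sqrt b') (at_left (sqrt b))"
proof -
  let ?s = "a / 2"
  have s: "0 < ?s" "?s < a" using pos by auto
  let ?g = "\<lambda>r. Gamma0_curve (of_real r) ?s"
  have b: "0 < sqrt b" using pos by simp
  have c: "continuous_on {sqrt b / 2..sqrt b} ?g"
    unfolding Gamma0_curve_cis by (intro continuous_intros) (use b in auto)
  have "continuous_on {sqrt b / 2..sqrt b} (\<lambda>r. cmod (fst (F (?g r))))"
    by (intro continuous_intros continuous_on_compose2[OF F_cont c]) (use b s in \<open>auto simp: closure_eq\<close>)
  then have "((\<lambda>r. cmod (fst (F (?g r)))) \<longlongrightarrow> cmod (fst (F (?g (sqrt b))))) (at_left (sqrt b))"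
    by (rule continuous_on_Icc_at_leftD) (use b in auto)
  moreover have "?g (sqrt b) \<in> lateral_face a b"
    using s b by (auto simp: lateral_face_def Gamma0_curve_cis norm_mult)
  from F_lateral[OF this] have "cmod (fst (F (?g (sqrt b)))) = sqrt b'"
    by (auto simp: lateral_face_def)
  moreover have "eventually (\<lambda>r. cmod (fst (F (?g r))) = radius r) (at_left (sqrt b))"
    using eventually_at_left_real[OF b]
  proof eventually_elim
    case (elim r)
    then have r: "0 < r" "r < sqrt b" by auto
    have "F (?g r) = Gamma0_curve (leaf_map (of_real r)) (c * ?s)"
      using f_on_leaf[of "of_real r" ?s] F_eq[of "?g r"] r s by simp
    then show ?case by (simp add: radius_def)
  qed
  ultimately show ?thesis
    by (simp add: tendsto_cong)
qed

text \<open>The constant of integration is found by letting \<open>r\<close> tend to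
  \<open>sqrt b\<close>.\<close>

lemma radius_eq:
  assumes r: "0 < r" "r < sqrt b"
  shows "1 / (radius r)\<^sup>2 = 1 / (c * r\<^sup>2) + 1 / b' - 1 / (c * b)"
proof -
  obtain n where n: "\<And>r. 0 < r \<Longrightarrow> r < sqrt b \<Longrightarrow> 1 / (radius r)\<^sup>2 = winding / (c * r\<^sup>2) + n"
    using radius_formula by blast
  have b: "0 < sqrt b" "0 < sqrt b'" using pos by auto
  have "((\<lambda>r. 1 / (radius r)\<^sup>2 - 1 / (c * r\<^sup>2)) \<longlongrightarrow> 1 / (sqrt b')\<^sup>2 - 1 / (c * (sqrt b)\<^sup>2)) (at_left (sqrt b))"
    by (intro tendsto_intros radius_boundary) (use pos in auto)
  moreover have "eventually (\<lambda>r. 1 / (radius r)\<^sup>2 - 1 / (c * r\<^sup>2) = n) (at_left (sqrt b))"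
    using eventually_at_left_real[OF b(1)] by eventually_elim (use n winding_eq_1 in auto)
  ultimately have "((\<lambda>r. n) \<longlongrightarrow> 1 / (sqrt b')\<^sup>2 - 1 / (c * (sqrt b)\<^sup>2)) (at_left (sqrt b))"
    by (simp add: tendsto_cong)
  then have "n = 1 / b' - 1 / (c * b)"
    using pos by (simp add: tendsto_const_iff)
  then show ?thesis using n[OF r] winding_eq_1 by simp
qed

section \<open>The explicit formula\<close>

lemma f_eq_punctured:
  obtains \<alpha> where "\<And>p. p \<in> punctured \<Longrightarrow> f p = f_alpha a b a' b' \<alpha> p"
proof -
  define r0 where "r0 = sqrt b / 2"
  have r0: "0 < r0" "r0 < sqrt b" using pos by (auto simp: r0_def)
  \<comment> \<open>The rotation left undetermined by the equations. It does not depend on the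
    radius chosen, as the argument of \<open>leaf_map\<close> is constant on rays.\<close>
  define \<alpha> where "\<alpha> = Arg (leaf_map (polar r0 0))"
  have A: "leaf_map (polar r \<phi>) = of_real (radius r) * cis (\<alpha> + \<phi>)" if r: "0 < r" "r < sqrt b" for r \<phi>
  proof -
    have "leaf_map (polar r0 0) = of_real (radius r0) * cis \<alpha>"
      using rcis_cmod_Arg[of "leaf_map (polar r0 0)"] cmod_leaf_map[OF r0] by (simp add: rcis_def \<alpha>_def)
    then have "leaf_map (polar r 0) = of_real (radius r) * cis \<alpha>"
      using leaf_map_direction[OF r r0, of 0] radius_pos[OF r0] by simp
    then show ?thesis
      using leaf_map_rotate[OF r, of \<phi>] by (simp add: winding_eq_1 cis_mult mult.assoc)
  qed
  have "f p = f_alpha a b a' b' \<alpha> p" if p: "p \<in> punctured" for p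
  proof -
    obtain z t where zt: "p = (z, t)" by (cases p)
    define r where "r = cmod z"
    have r: "0 < r" "r < sqrt b" and t: "0 < t" "t < a"
      using p by (auto simp: zt cylinder_def r_def)
    have "sqrt (r\<^sup>2) < sqrt b" using r by simp
    then have rb: "r\<^sup>2 < b" by (simp only: real_sqrt_less_iff)
    define \<theta> where "\<theta> = Arg z"
    have z: "z = polar r \<theta>"
      using rcis_cmod_Arg[of z] by (simp add: rcis_def polar_def r_def \<theta>_def)
    define \<phi> where "\<phi> = \<theta> + t / (2 * r\<^sup>2)"
    have lp: "leaf p = polar r \<phi>"
      using r by (simp add: leaf_def zt z polar_def norm_mult mult.assoc cis_mult \<phi>_def)
    have "f p = f (Gamma0_curve (leaf p) t)"
      using Gamma0_curve_leaf[of p] by (simp add: zt)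
    also have "\<dots> = Gamma0_curve (leaf_map (polar r \<phi>)) (c * t)"
      unfolding lp by (rule f_on_leaf[OF polar_valid[OF r] t])
    also have "\<dots> = (of_real (radius r) * cis (\<alpha> + \<phi> - c * t / (2 * (radius r)\<^sup>2)), c * t)"
      using radius_pos[OF r] by (simp add: Gamma0_curve_cis A[OF r] norm_mult mult.assoc cis_mult)
    finally have fp: "f p = (of_real (radius r) * cis (\<alpha> + \<phi> - c * t / (2 * (radius r)\<^sup>2)), c * t)" .
    \<comment> \<open>The radicand in \<open>f_alpha\<close>. Rewritten with the factor
      \<open>1 - r^2 / b\<close> it is visibly positive inside the cylinder.\<close>
    define Q where "Q = (1 - a * b' / (a' * b)) * r\<^sup>2 + a * b' / a'"
    have Q: "Q = (a * b' / a') * (1 - r\<^sup>2 / b) + r\<^sup>2"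
      using pos by (simp add: Q_def field_simps)
    have Q0: "0 < Q" unfolding Q using pos rb r by (intro add_pos_pos mult_pos_pos) auto
    have "1 / (radius r)\<^sup>2 = Q / (b' * r\<^sup>2)"
      unfolding radius_eq[OF r] Q_def using pos r by (simp add: field_simps)
    then have rad2: "(radius r)\<^sup>2 = b' * r\<^sup>2 / Q"
      using Q0 radius_pos[OF r] r pos by (simp add: field_simps)
    have rad: "radius r = sqrt b' * r / sqrt Q"
    proof -
      have "radius r = sqrt ((radius r)\<^sup>2)" using radius_pos[OF r] by simp
      also have "\<dots> = sqrt b' * r / sqrt Q"
        unfolding rad2 using r by (simp add: real_sqrt_divide real_sqrt_mult)
      finally show ?thesis .
    qed
    \<comment> \<open>Unwinding the source leaf adds \<open>t / (2 * r^2)\<close>, and winding along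
      the image leaf subtracts the same term by \<open>radius_eq\<close>. Only the part coming from
      the constant of integration survives, so the rotation depends on the height alone.\<close>
    have ang: "\<alpha> + \<phi> - c * t / (2 * (radius r)\<^sup>2) = \<alpha> + \<theta> + 1 / (2 * b) * (1 - a' * b / (a * b')) * t"
    proof -
      have "c * t / (2 * (radius r)\<^sup>2) = c * t / 2 * (1 / (radius r)\<^sup>2)" by simp
      also have "\<dots> = t / (2 * r\<^sup>2) - 1 / (2 * b) * (1 - a' * b / (a * b')) * t"
        unfolding radius_eq[OF r] using pos r by (simp add: field_simps)
      finally show ?thesis by (simp add: \<phi>_def)
    qed
    have e1: "exp (\<i> * of_real \<alpha>) = cis \<alpha>" by (simp add: cis_conv_exp)
    have e2: "exp (\<i> / of_real (2 * b) * of_real (1 - a' * b / (a * b')) * of_real t) = cis (1 / (2 * b) * (1 - a' * b / (a * b')) * t)"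
      unfolding cis_conv_exp by (rule arg_cong[where f=exp]) simp
    have "of_real (radius r) * cis (\<alpha> + \<theta> + 1 / (2 * b) * (1 - a' * b / (a * b')) * t) =
        of_real (sqrt b') * cis \<alpha> * z * cis (1 / (2 * b) * (1 - a' * b / (a * b')) * t) / of_real (sqrt Q)"
      unfolding rad z polar_def cis_mult[symmetric] by (simp add: mult_ac)
    then show ?thesis
      unfolding fp ang unfolding zt f_alpha_def prod.case e1 e2 Q_def r_def by simp
  qed
  then show ?thesis by (rule that)
qed

lemma f_alpha_continuous:
  "continuous_on (cylinder a b) (f_alpha a b a' b' \<alpha>)"
proof -
  have "(1 - a * b' / (a' * b)) * (cmod z)\<^sup>2 + a * b' / a' > 0" if "cmod z < sqrt b" for z
  proof -
    have "sqrt ((cmod z)\<^sup>2) < sqrt b" using that by simp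
    then have rb: "(cmod z)\<^sup>2 < b" by (simp only: real_sqrt_less_iff)
    have "(1 - a * b' / (a' * b)) * (cmod z)\<^sup>2 + a * b' / a' = (a * b' / a') * (1 - (cmod z)\<^sup>2 / b) + (cmod z)\<^sup>2"
      using pos by (simp add: field_simps)
    moreover have "0 < (a * b' / a') * (1 - (cmod z)\<^sup>2 / b)"
      using pos rb by (intro mult_pos_pos) auto
    ultimately show ?thesis by (simp add: add_pos_nonneg)
  qed
  then show ?thesis
    unfolding f_alpha_def case_prod_beta by (intro continuous_intros) (force simp: cylinder_def)+
qed

lemma f_eq:
  "\<exists>\<alpha>. \<forall>p\<in>cylinder a b. f p = f_alpha a b a' b' \<alpha> p"
proof -
  obtain \<alpha> where \<alpha>: "\<And>p. p \<in> punctured \<Longrightarrow> f p = f_alpha a b a' b' \<alpha> p"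
    using f_eq_punctured by blast
  have "f p = f_alpha a b a' b' \<alpha> p" if p: "p \<in> cylinder a b" for p
  proof (cases "fst p = 0")
    case True
    \<comment> \<open>A point of the axis is approached at its own height through points off the
      axis, where both maps already agree.\<close>
    let ?g = "\<lambda>x::real. (complex_of_real x, snd p)"
    have gp: "?g 0 = p" using True by (simp add: prod_eq_iff)
    have b: "0 < sqrt b" using pos by simp
    have c: "continuous_on {0..sqrt b / 2} ?g" by (intro continuous_intros)
    have sub: "?g ` {0..sqrt b / 2} \<subseteq> cylinder a b"
      using p by (auto simp: cylinder_def) (use b in linarith)
    have L1: "((\<lambda>x. f (?g x)) \<longlongrightarrow> f (?g 0)) (at_right 0)"
      by (rule continuous_on_Icc_at_rightD[OF continuous_on_compose2[OF cont_f c sub]]) (use b in simp)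
    have L2: "((\<lambda>x. f_alpha a b a' b' \<alpha> (?g x)) \<longlongrightarrow> f_alpha a b a' b' \<alpha> (?g 0)) (at_right 0)"
      by (rule continuous_on_Icc_at_rightD[OF continuous_on_compose2[OF f_alpha_continuous c sub]]) (use b in simp)
    have ev: "eventually (\<lambda>x. f (?g x) = f_alpha a b a' b' \<alpha> (?g x)) (at_right 0)"
      using eventually_at_right_real[OF b]
    proof eventually_elim
      case (elim x)
      then show ?case using p by (intro \<alpha>) (auto simp: cylinder_def)
    qed
    have "f (?g 0) = f_alpha a b a' b' \<alpha> (?g 0)"
      by (rule tendsto_unique[OF trivial_limit_at_right_real iffD1[OF tendsto_cong[OF ev] L1] L2])
    then show ?thesis unfolding gp .
  next
    case False
    with p show ?thesis by (intro \<alpha>) simp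
  qed
  then show ?thesis by blast
qed

end

section \<open>From membership in \<open>qc_class\<close> to the locale
  \<open>extremal_map\<close>\<close>

theorem theorem2p2p1:
  fixes a b a' b' :: real and f :: "heis \<Rightarrow> heis"
  assumes "a > 0" "b > 0" "a' > 0" "b' > 0"
    and "a * b' / (a' * b) > 1"
    and "f \<in> qc_class a b a' b'"
    and "modulus (cylinder a' b') (image_curves f (Gamma0 a b)) =
      (\<integral>\<^sup>+p\<in>cylinder a b. ennreal (distortion f p ^ 2 * rho0 a p ^ 4) \<partial>lborel)"
  shows "\<exists>\<alpha>::real. \<forall>p\<in>cylinder a b. f p = f_alpha a b a' b' \<alpha> p"
proof -
  let ?C = "cylinder a b"
  have qc: "quasiconformal ?C (cylinder a' b') f" "C2_on ?C f" "contact_on ?C f" "orientation_preserving ?C f"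
    using assms(6) by (auto simp: qc_class_def)
  obtain F G1 G2 G3 where F: "continuous_on (closure ?C) F" "\<And>p. p \<in> ?C \<Longrightarrow> F p = f p"
    "homeomorphism (bottom_disc a b) (bottom_disc a' b') F G1"
    "homeomorphism (top_disc a b) (top_disc a' b') F G2"
    "homeomorphism (lateral_face a b) (lateral_face a' b') F G3"
    using assms(6) unfolding qc_class_def by blast
  obtain g where g: "homeomorphism ?C (cylinder a' b') f g"
    using qc(1) unfolding quasiconformal_def by blast
  obtain f' f'' where f': "\<And>p. p \<in> ?C \<Longrightarrow> (f has_derivative blinfun_apply (f' p)) (at p)"
    "\<And>p. p \<in> ?C \<Longrightarrow> (f' has_derivative blinfun_apply (f'' p)) (at p)"
    using qc(2) unfolding C2_on_def by blast
  obtain l :: "heis \<Rightarrow> real" where l: "\<And>p. p \<in> ?C \<Longrightarrow> l p \<noteq> 0"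
    "\<And>p v. p \<in> ?C \<Longrightarrow> contact_form (f p) (frechet_derivative f (at p) v) = of_real (l p) * contact_form p v"
    using qc(3) unfolding contact_on_def by blast
  interpret extremal_map a b f f' f'' l a' b' g F
  proof
    show "contact_form (f p) (f' p v) = of_real (l p) * contact_form p v" if "p \<in> ?C" for p v
      using l(2)[OF that, of v] frechet_derivative_at[OF f'(1)[OF that]] by simp
  qed (use assms open_cylinder f' l g qc(4) F in \<open>auto simp: homeomorphism_def\<close>)
  show ?thesis by (rule f_eq)
qed

end
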